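(* Let $\mathfrak g$ be an affine Kac–Moody algebra of type $A_n^{(1)}$ ($n\ge 1$), $A_{2n-1}^{(2)}$ ($n\ge 3$), $D_n^{(1)}$ ($n\ge 4$), $A_{2n}^{(2)}$ ($n\ge 2$), $D_{n+1}^{(2)}$ ($n\ge 2$) or $B_n^{(1)}$ ($n\ge 3$), let $\lambda$ be a dominant integral weight of level $1$, and let $\mathbf Y(\lambda)$ be the set of all reduced proper Young walls built on the ground-state wall $Y_\lambda$. For all $i\in I$ and $Y\in\mathbf Y(\lambda)$, we have $$\tilde e_iY\in\mathbf Y(\lambda)\cup\{0\}\quad\text{and}\quad \tilde f_iY\in\mathbf Y(\lambda)\cup\{0\}.$$ Hence the set $\mathbf Y(\lambda)$ has an affine crystal structure for the quantum affine algebra $U_q(\mathfrak g)$ (given by the restrictions of $\mathrm{wt},\tilde e_i,\tilde f_i,\varepsilon_i,\varphi_i$).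
   Context: **Affine data.** $I=\{0,1,\dots,n\}$; $A=(a_{ij})_{i,j\in I}$ is the affine Cartan matrix with $a_{ii}=2$ and the following nonzero off-diagonal entries (with null root $\delta$). - $A_n^{(1)}$: for $n\ge2$, $a_{ij}=-1$ for $i-j\equiv\pm1$ mod $n+1$; for $n=1$, $a_{01}=a_{10}=-2$. $\delta=\alpha_0+\cdots+\alpha_n$. Level 1 weights: $\Lambda_i$ ($i\in I$). - $A_{2n-1}^{(2)}$: edges $0-2$, $1-2$, $2-3,\dots,(n-2)-(n-1)$ simple ($a_{ij}=a_{ji}=-1$), and $a_{n-1,n}=-2$, $a_{n,n-1}=-1$. $\delta=\alpha_0+\alpha_1+2\alpha_2+\cdots+2\alpha_{n-1}+\alpha_n$. Level 1 weights: $\Lambda_0,\Lambda_1$. - $D_n^{(1)}$: simple edges $0-2$, $1-2$, $2-3,\dots,(n-3)-(n-2)$, $(n-2)-(n-1)$, $(n-2)-n$. $\delta=\alpha_0+\alpha_1+2\alpha_2+\cdots+2\alpha_{n-2}+\alpha_{n-1}+\alpha_n$. Level 1 weights: $\Lambda_0,\Lambda_1,\Lambda_{n-1},\Lambda_n$. - $A_{2n}^{(2)}$: $a_{01}=-2$, $a_{10}=-1$, simple edges $1-2,\dots,(n-2)-(n-1)$, $a_{n-1,n}=-2$, $a_{n,n-1}=-1$. $\delta=2\alpha_0+\cdots+2\alpha_{n-1}+\alpha_n$. Level 1 weight: $\Lambda_0$. - $D_{n+1}^{(2)}$: $a_{01}=-2$, $a_{10}=-1$, simple edges $1-2,\dots,(n-2)-(n-1)$,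 $a_{n,n-1}=-2$, $a_{n-1,n}=-1$. $\delta=\alpha_0+\cdots+\alpha_n$. Level 1 weights: $\Lambda_0,\Lambda_n$. - $B_n^{(1)}$: simple edges $0-2$, $1-2$, $2-3,\dots,(n-2)-(n-1)$, $a_{n,n-1}=-2$, $a_{n-1,n}=-1$. $\delta=\alpha_0+\alpha_1+2\alpha_2+\cdots+2\alpha_n$. Level 1 weights: $\Lambda_0,\Lambda_1,\Lambda_n$. $P^\vee=\mathbf Zh_0\oplus\cdots\oplus\mathbf Zh_n\oplus\mathbf Zd$, $\mathfrak h=\mathbf C\otimes P^\vee$; $\alpha_i,\Lambda_i\in\mathfrak h^*$ are defined by $\alpha_i(h_j)=a_{ji}$, $\alpha_i(d)=\delta_{0,i}$, $\Lambda_i(h_j)=\delta_{ij}$, $\Lambda_i(d)=0$. $P=\{\lambda\in\mathfrak h^*:\lambda(P^\vee)\subset\mathbf Z\}$. "Dominant integral weight of level 1" means one of the weights listed above for the given type. **Crystals.** An affine crystal (for $U_q(\mathfrak g)$) is a set $B$ with maps $\mathrm{wt}:B\to P$, $\varepsilon_i,\varphi_i:B\to\mathbf Z\cup\{-\infty\}$, $\tilde e_i,\tilde f_i:B\to B\cup\{0\}$ ($i\in I$) such that: (i) $\varphi_i(b)=\varepsilon_i(b)+\langle h_i,\mathrm{wt}(b)\rangle$, and $\mathrm{wt}(\tilde e_ib)=\mathrm{wt}(b)+\alpha_i$ when $\tilde e_ib\in B$, $\mathrm{wt}(\tilde f_ib)=\mathrm{wt}(b)-\alpha_i$ when $\tilde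 f_ib\in B$; (ii) if $\tilde e_ib\in B$ then $\varepsilon_i(\tilde e_ib)=\varepsilon_i(b)-1$, $\varphi_i(\tilde e_ib)=\varphi_i(b)+1$; (iii) if $\tilde f_ib\in B$ then $\varepsilon_i(\tilde f_ib)=\varepsilon_i(b)+1$, $\varphi_i(\tilde f_ib)=\varphi_i(b)-1$; (iv) $\tilde f_ib=b'$ iff $b=\tilde e_ib'$ for $b,b'\in B$; (v) if $\varepsilon_i(b)=-\infty$ then $\tilde e_ib=\tilde f_ib=0$. **Blocks, levels and stacking patterns.** A wall consists of columns $y_0,y_1,y_2,\dots$ numbered from right to left, extending infinitely to the left; write $Y=(y_k)_{k\ge0}$. Each column is a stack of coloured blocks (colours in $I$), all blocks having unit width, of three shapes: *cubes* (unit height, unit thickness), *half-height blocks* (height $\frac12$, unit thickness), *half-thickness blocks* (unit height, thickness $\frac12$). In each column the blocks fill prescribed successive levels from bottom to top. Notation for a level: $j$ = a cube of colour $j$; $\underline j$ = a half-height block of colour $j$; $[a,b]$ (a split level of height 1) = two half-thickness blocks, of colours $a,b$, one occupying the back half and the other the front half; in each column it is prescribed which colour is at the back. The patterns, repeated periodically upward, and ground-state walls are: - $A_n^{(1)}$, $Y_{\Lambda_i}$: column $k$ has cubes of colours $i-k,\,i-k+1,\,i-k+2,\dots$ (mod $n+1$) from the bottom. $Y_{\Lambda_i}$ is the empty wall (no blocks). - $A_{2n-1}^{(2)}$, $Y_{\Lambda_0}$ and $Y_{\Lambda_1}$: every column is $[0,1],2,3,\dots,n-1,n,n-1,\dots,3,2$,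 then repeated. For $\Lambda_0$: at each split level the back colour is $1$ in columns with $k$ even and $0$ in columns with $k$ odd. For $\Lambda_1$: back colour $0$ for $k$ even, $1$ for $k$ odd. - $D_n^{(1)}$, $Y_{\Lambda_0},Y_{\Lambda_1}$: every column is $[0,1],2,\dots,n-2,[n-1,n],n-2,\dots,2$, repeated. Back colours at $[0,1]$ as for $A_{2n-1}^{(2)}$; at $[n-1,n]$ (for both $\Lambda_0$ and $\Lambda_1$) the back colour is $n$ for $k$ even and $n-1$ for $k$ odd. - $D_n^{(1)}$, $Y_{\Lambda_{n-1}},Y_{\Lambda_n}$: every column is $[n-1,n],n-2,\dots,2,[0,1],2,\dots,n-2$, repeated. At $[n-1,n]$ the back colour is, for $\Lambda_{n-1}$: $n$ for $k$ even, $n-1$ for $k$ odd; for $\Lambda_n$: $n-1$ for $k$ even, $n$ for $k$ odd. At $[0,1]$ (both cases) the back colour is $1$ for $k$ even, $0$ for $k$ odd. - $A_{2n}^{(2)}$, $Y_{\Lambda_0}$: every column is $\underline0,\underline0,1,2,\dots,n-1,n,n-1,\dots,2,1$, repeated. - $D_{n+1}^{(2)}$: for $Y_{\Lambda_0}$ every column is $\underline0,\underline0,1,\dots,n-1,\underline n,\underline n,n-1,\dots,1$, repeated; for $Y_{\Lambda_n}$ every column is $\underline n,\underline n,n-1,\dots,1,\underline0,\underline0,1,\dots,n-1$, repeated. - $B_n^{(1)}$: for $Y_{\Lambda_0},Y_{\Lambda_1}$ every column is $[0,1],2,\dots,n-1,\underline n,\underline n,n-1,\dots,2$, repeated, with back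 colours at $[0,1]$ as for $A_{2n-1}^{(2)}$; for $Y_{\Lambda_n}$ every column is $\underline n,\underline n,n-1,\dots,2,[0,1],2,\dots,n-1$, repeated, with back colour at $[0,1]$ equal to $1$ for $k$ even and $0$ for $k$ odd. In all types except $A_n^{(1)}$, the ground-state wall $Y_\lambda$ has in each column exactly one block, at the lowest level: the back block if the lowest level is split, or the first half-height block otherwise. **Young walls.** A Young wall on the ground state $\lambda$ is obtained from $Y_\lambda$ by adding finitely many blocks such that: (1) it contains all blocks of $Y_\lambda$; (2) blocks are stacked in columns following the pattern, and no block is placed on top of a column whose top is of half-unit thickness (so a split level must have both halves filled before building above it, but either half of a split level may be filled first); (3) except for the right-most column, there is no free space to the right of any block (if a position—level, and front/back half at a split level—is filled in column $k\ge1$, the same position is filled in column $k-1$); (4) the heights of the columns are weakly decreasing from right to left. Heights are measured from the base, including the ground-state blocks; a half-filled split level counts with its full height $1$. A column is *full* if its height is an integer and its top is of unit thickness. A Young wall is *proper* if no two full columns have the same height; for type $A_n^{(1)}$ every Young wall is defined to be proper. $\mathbf F(\lambda)$ denotes the set of proper Young walls on $Y_\lambda$. **Crystal structure maps.** A block of colour $i$ of $Y\in\mathbf F(\lambda)$ is a removable $i$-block if removing it leaves a proper Young wall (on $Y_\lambda$); a column is $i$-removable if its top is a removable $i$-block. An $i$-admissible slot is a place where an $i$-block may be added to obtain a proper Young wall; a column is $i$-admissible if its top is an $i$-admissible slot. A column is twice $i$-removable (twice $i$-admissible) if two $i$-blocks can be successively removed from (added to) it, giving proper Young walls; "once" means once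 but not twice. To each column assign: $--$ if twice $i$-removable; $-$ if once $i$-removable but not $i$-admissible; $-+$ if once $i$-removable and once $i$-admissible; $+$ if once $i$-admissible but not $i$-removable; $++$ if twice $i$-admissible; nothing otherwise. Write these signs in the order of the columns from left to right ($\dots,y_2,y_1,y_0$) and cancel successively all $(+,-)$ pairs ($+$ immediately to the left of $-$) to get a finite sequence of $-$'s followed by $+$'s, the $i$-signature of $Y$. $\tilde e_iY$ is obtained by removing the $i$-block from the column corresponding to the right-most $-$ in the $i$-signature ($\tilde e_iY=0$ if there is no $-$); $\tilde f_iY$ is obtained by adding an $i$-block to the column corresponding to the left-most $+$ ($\tilde f_iY=0$ if there is no $+$). $\varepsilon_i(Y)$, $\varphi_i(Y)$ are the numbers of $-$'s, respectively $+$'s, in the $i$-signature, and $\mathrm{wt}(Y)=\lambda-\sum_{i\in I}k_i\alpha_i$, where $k_i$ is the number of $i$-blocks of $Y$ that have been added to $Y_\lambda$. **Reduced walls.** Define integers $a_i$ by $\sum a_i\alpha_i=\delta$, except for type $D_{n+1}^{(2)}$, where $\sum a_i\alpha_i=2\delta$. A $\delta$-column is a part of a column (consecutive in the stack) consisting of exactly $a_i$ blocks of colour $i$ for each $i\in I$; it may begin or end in the middle of a split level. A column of $Y\in\mathbf F(\lambda)$ contains a removable $\delta$ if a $\delta$-column may be removed from (the top of) that column so that the result is still a proper Young wall. $Y$ is *reduced* if none of its columns contains a removable $\delta$. $\mathbf Y(\lambda)\subset\mathbf F(\lambda)$ is the set of reduced proper Young walls. *)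

theory Defs
  imports Complex_Main "HOL-Library.Extended"
begin

section \<open>Affine data\<close>

text \<open>The constructors stand for the families of types
  $A_n^{(1)}$, $A_{2n-1}^{(2)}$, $D_n^{(1)}$, $A_{2n}^{(2)}$, $D_{n+1}^{(2)}$, $B_n^{(1)}$,
  in this order. In every case the index set is $I = \{0,\dots,n\}$.\<close>

datatype affine_type = A1 | A2odd | D1 | A2even | D2 | B1

fun rank_ok :: "affine_type \<Rightarrow> nat \<Rightarrow> bool" where
  "rank_ok A1 n \<longleftrightarrow> 1 \<le> n"
| "rank_ok A2odd n \<longleftrightarrow> 3 \<le> n"
| "rank_ok D1 n \<longleftrightarrow> 4 \<le> n"
| "rank_ok A2even n \<longleftrightarrow> 2 \<le> n"
| "rank_ok D2 n \<longleftrightarrow> 2 \<le> n"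
| "rank_ok B1 n \<longleftrightarrow> 3 \<le> n"

text \<open>The simple edges $a$--$(a+1)$, \dots, $(b-1)$--$b$; and the two edges $0$--$2$, $1$--$2$.\<close>

definition chain :: "nat \<Rightarrow> nat \<Rightarrow> nat \<Rightarrow> nat \<Rightarrow> bool" where
  "chain a b i j \<longleftrightarrow> a \<le> i \<and> i \<le> b \<and> a \<le> j \<and> j \<le> b \<and> (j = i + 1 \<or> i = j + 1)"

definition fork :: "nat \<Rightarrow> nat \<Rightarrow> bool" where
  "fork i j \<longleftrightarrow> {i, j} = {0, 2} \<or> {i, j} = {1, 2}"

fun off_diagonal :: "affine_type \<Rightarrow> nat \<Rightarrow> nat \<Rightarrow> nat \<Rightarrow> int" where
  "off_diagonal A1 n i j =
     (if n = 1 then - 2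
      else if (int i - int j) mod (int n + 1) \<in> {1, int n} then - 1 else 0)"
| "off_diagonal A2odd n i j =
     (if (i, j) = (n - 1, n) then - 2
      else if (i, j) = (n, n - 1) \<or> fork i j \<or> chain 2 (n - 1) i j then - 1 else 0)"
| "off_diagonal D1 n i j =
     (if fork i j \<or> chain 2 (n - 1) i j \<or> {i, j} = {n - 2, n} then - 1 else 0)"
| "off_diagonal A2even n i j =
     (if (i, j) = (0, 1) \<or> (i, j) = (n - 1, n) then - 2
      else if (i, j) = (1, 0) \<or> (i, j) = (n, n - 1) \<or> chain 1 (n - 1) i j then - 1 else 0)"
| "off_diagonal D2 n i j =
     (if (i, j) = (0, 1) \<or> (i, j) = (n, n - 1) then - 2
      else if (i, j) = (1, 0) \<or> (i, j) = (n - 1, n) \<or> chain 1 (n - 1) i j then - 1 else 0)"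
| "off_diagonal B1 n i j =
     (if (i, j) = (n, n - 1) then - 2
      else if (i, j) = (n - 1, n) \<or> fork i j \<or> chain 2 (n - 1) i j then - 1 else 0)"

definition cartan :: "affine_type \<Rightarrow> nat \<Rightarrow> nat \<Rightarrow> nat \<Rightarrow> int" where
  "cartan t n i j =
     (if i \<le> n \<and> j \<le> n then (if i = j then 2 else off_diagonal t n i j) else 0)"

fun null_root_coeff :: "affine_type \<Rightarrow> nat \<Rightarrow> nat \<Rightarrow> nat" where
  "null_root_coeff A1 n i = 1"
| "null_root_coeff A2odd n i = (if i \<in> {0, 1, n} then 1 else 2)"
| "null_root_coeff D1 n i = (if i \<in> {0, 1, n - 1, n} then 1 else 2)"
| "null_root_coeff A2even n i = (if i = n then 1 else 2)"
| "null_root_coeff D2 n i = 1"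
| "null_root_coeff B1 n i = (if i \<in> {0, 1} then 1 else 2)"

text \<open>The indices $l$ for which $\Lambda_l$ is a dominant integral weight of level 1.\<close>

fun level1 :: "affine_type \<Rightarrow> nat \<Rightarrow> nat set" where
  "level1 A1 n = {0..n}"
| "level1 A2odd n = {0, 1}"
| "level1 D1 n = {0, 1, n - 1, n}"
| "level1 A2even n = {0}"
| "level1 D2 n = {0, n}"
| "level1 B1 n = {0, 1, n}"

text \<open>A weight in $P$ is an element of $\mathfrak h^*$ with integral values on $P^\vee$. It is
  represented by its values on the basis $h_0, \dots, h_n, d$ of $P^\vee$; for \<open>i > n\<close> the
  element \<open>Coroot i\<close> does not occur in the basis, and the value there is fixed to be 0.\<close>

datatype coweight_basis = Coroot nat | Degree

type_synonym weight = "coweight_basis \<Rightarrow> int"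

definition weight_lattice :: "nat \<Rightarrow> weight set" where
  "weight_lattice n = {\<mu>. \<forall>i>n. \<mu> (Coroot i) = 0}"

fun simple_root :: "(nat \<Rightarrow> nat \<Rightarrow> int) \<Rightarrow> nat \<Rightarrow> weight" where
  "simple_root A i (Coroot j) = A j i"
| "simple_root A i Degree = (if i = 0 then 1 else 0)"

fun fundamental_weight :: "nat \<Rightarrow> weight" where
  "fundamental_weight l (Coroot j) = (if j = l then 1 else 0)"
| "fundamental_weight l Degree = 0"

section \<open>Affine crystals\<close>

text \<open>The element $0$ of $B \cup \{0\}$ is \<open>None\<close>, and $\mathbf Z \cup \{-\infty\}$ is the type
  \<open>int extended\<close> without \<open>\<infinity>\<close>.\<close>

definition affine_crystal ::
  "nat \<Rightarrow> (nat \<Rightarrow> nat \<Rightarrow> int) \<Rightarrow> 'b set \<Rightarrow> ('b \<Rightarrow> weight) \<Rightarrow>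
   (nat \<Rightarrow> 'b \<Rightarrow> int extended) \<Rightarrow> (nat \<Rightarrow> 'b \<Rightarrow> int extended) \<Rightarrow>
   (nat \<Rightarrow> 'b \<Rightarrow> 'b option) \<Rightarrow> (nat \<Rightarrow> 'b \<Rightarrow> 'b option) \<Rightarrow> bool" where
  "affine_crystal n A B wt \<epsilon> \<phi> e f \<longleftrightarrow>
     (\<forall>b\<in>B. wt b \<in> weight_lattice n) \<and>
     (\<forall>i\<in>{0..n}. \<forall>b\<in>B.
        \<epsilon> i b \<noteq> \<infinity> \<and> \<phi> i b \<noteq> \<infinity> \<and>
        e i b \<in> insert None (Some ` B) \<and> f i b \<in> insert None (Some ` B) \<and>
        \<phi> i b = \<epsilon> i b + Fin (wt b (Coroot i)) \<and>
        (\<forall>b'\<in>B. e i b = Some b' \<longrightarrow>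
           wt b' = (\<lambda>x. wt b x + simple_root A i x) \<and>
           \<epsilon> i b' = \<epsilon> i b - 1 \<and> \<phi> i b' = \<phi> i b + 1) \<and>
        (\<forall>b'\<in>B. f i b = Some b' \<longrightarrow>
           wt b' = (\<lambda>x. wt b x - simple_root A i x) \<and>
           \<epsilon> i b' = \<epsilon> i b + 1 \<and> \<phi> i b' = \<phi> i b - 1) \<and>
        (\<forall>b'\<in>B. f i b = Some b' \<longleftrightarrow> e i b' = Some b) \<and>
        (\<epsilon> i b = -\<infinity> \<longrightarrow> e i b = None \<and> f i b = None))"

section \<open>Stacking patterns and ground-state walls\<close>

text \<open>In \<open>Split b f\<close> the colour \<open>b\<close> is at the back and the colour \<open>f\<close> at the front.\<close>

datatype level = Cube nat | Half_Height nat | Split nat nat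

text \<open>The part of a level that a block occupies: all of it, or one half of a split level.\<close>

datatype part = Whole | Back | Front

text \<open>Columns are numbered from right to left and levels from bottom to top, both from 0.
  A wall is identified with the set of places that are filled by blocks.\<close>

datatype place = Place (column: nat) (height_index: nat) (part: part)

type_synonym wall = "place set"

text \<open>A split level whose back colour is \<open>b\<close> for \<open>k\<close> even and \<open>c\<close> for \<open>k\<close> odd.\<close>

definition alt_split :: "nat \<Rightarrow> nat \<Rightarrow> nat \<Rightarrow> level" where
  "alt_split k b c = (if even k then Split b c else Split c b)"

text \<open>One period of the pattern of column \<open>k\<close>, for the ground state $\Lambda_l$.\<close>

fun pattern :: "affine_type \<Rightarrow> nat \<Rightarrow> nat \<Rightarrow> nat \<Rightarrow> level list" where
  "pattern A1 n l k =
     map (\<lambda>m. Cube (nat ((int l - int k + int m) mod (int n + 1)))) [0..<n + 1]"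
| "pattern A2odd n l k =
     [if l = 0 then alt_split k 1 0 else alt_split k 0 1]
     @ map Cube [2..<n] @ [Cube n] @ map Cube (rev [2..<n])"
| "pattern D1 n l k =
     (if l \<le> 1 then
        [if l = 0 then alt_split k 1 0 else alt_split k 0 1] @ map Cube [2..<n - 1]
        @ [alt_split k n (n - 1)] @ map Cube (rev [2..<n - 1])
      else
        [if l = n - 1 then alt_split k n (n - 1) else alt_split k (n - 1) n]
        @ map Cube (rev [2..<n - 1]) @ [alt_split k 1 0] @ map Cube [2..<n - 1])"
| "pattern A2even n l k =
     [Half_Height 0, Half_Height 0] @ map Cube [1..<n] @ [Cube n] @ map Cube (rev [1..<n])"
| "pattern D2 n l k =
     (if l = 0 then
        [Half_Height 0, Half_Height 0] @ map Cube [1..<n]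
        @ [Half_Height n, Half_Height n] @ map Cube (rev [1..<n])
      else
        [Half_Height n, Half_Height n] @ map Cube (rev [1..<n])
        @ [Half_Height 0, Half_Height 0] @ map Cube [1..<n])"
| "pattern B1 n l k =
     (if l \<le> 1 then
        [if l = 0 then alt_split k 1 0 else alt_split k 0 1] @ map Cube [2..<n]
        @ [Half_Height n, Half_Height n] @ map Cube (rev [2..<n])
      else
        [Half_Height n, Half_Height n] @ map Cube (rev [2..<n])
        @ [alt_split k 1 0] @ map Cube [2..<n])"

definition level_at :: "affine_type \<Rightarrow> nat \<Rightarrow> nat \<Rightarrow> nat \<Rightarrow> nat \<Rightarrow> level" where
  "level_at t n l k m = pattern t n l k ! (m mod length (pattern t n l k))"

fun parts :: "level \<Rightarrow> part set" where
  "parts (Cube c) = {Whole}"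
| "parts (Half_Height c) = {Whole}"
| "parts (Split b f) = {Back, Front}"

fun level_height :: "level \<Rightarrow> rat" where
  "level_height (Cube c) = 1"
| "level_height (Half_Height c) = 1 / 2"
| "level_height (Split b f) = 1"

fun level_colour :: "level \<Rightarrow> part \<Rightarrow> nat" where
  "level_colour (Cube c) s = c"
| "level_colour (Half_Height c) s = c"
| "level_colour (Split b f) s = (if s = Back then b else f)"

definition places :: "affine_type \<Rightarrow> nat \<Rightarrow> nat \<Rightarrow> place set" where
  "places t n l = {p. part p \<in> parts (level_at t n l (column p) (height_index p))}"

definition colour :: "affine_type \<Rightarrow> nat \<Rightarrow> nat \<Rightarrow> place \<Rightarrow> nat" where
  "colour t n l p = level_colour (level_at t n l (column p) (height_index p)) (part p)"

definition ground_wall :: "affine_type \<Rightarrow> nat \<Rightarrow> nat \<Rightarrow> wall" where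
  "ground_wall t n l =
     (if t = A1 then {}
      else {p \<in> places t n l. height_index p = 0 \<and> part p \<noteq> Front})"

section \<open>Young walls\<close>

definition occupied :: "wall \<Rightarrow> nat \<Rightarrow> nat set" where
  "occupied Y k = {m. \<exists>s. Place k m s \<in> Y}"

definition level_filled :: "affine_type \<Rightarrow> nat \<Rightarrow> nat \<Rightarrow> wall \<Rightarrow> nat \<Rightarrow> nat \<Rightarrow> bool" where
  "level_filled t n l Y k m \<longleftrightarrow> (\<forall>s\<in>parts (level_at t n l k m). Place k m s \<in> Y)"

definition column_height :: "affine_type \<Rightarrow> nat \<Rightarrow> nat \<Rightarrow> wall \<Rightarrow> nat \<Rightarrow> rat" where
  "column_height t n l Y k = (\<Sum>m\<in>occupied Y k. level_height (level_at t n l k m))"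

definition young_wall :: "affine_type \<Rightarrow> nat \<Rightarrow> nat \<Rightarrow> wall \<Rightarrow> bool" where
  "young_wall t n l Y \<longleftrightarrow>
     Y \<subseteq> places t n l \<and> ground_wall t n l \<subseteq> Y \<and> finite (Y - ground_wall t n l) \<and>
     (\<forall>k m s. Place k (Suc m) s \<in> Y \<longrightarrow> level_filled t n l Y k m) \<and>
     (\<forall>k m s. Place (Suc k) m s \<in> Y \<longrightarrow> Place k m s \<in> Y) \<and>
     (\<forall>k. column_height t n l Y (Suc k) \<le> column_height t n l Y k)"

definition full_column :: "affine_type \<Rightarrow> nat \<Rightarrow> nat \<Rightarrow> wall \<Rightarrow> nat \<Rightarrow> bool" where
  "full_column t n l Y k \<longleftrightarrow>
     column_height t n l Y k \<in> \<int> \<and> (\<forall>m\<in>occupied Y k. level_filled t n l Y k m)"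

definition proper :: "affine_type \<Rightarrow> nat \<Rightarrow> nat \<Rightarrow> wall \<Rightarrow> bool" where
  "proper t n l Y \<longleftrightarrow>
     t = A1 \<or>
     (\<forall>j k. j \<noteq> k \<and> full_column t n l Y j \<and> full_column t n l Y k \<longrightarrow>
        column_height t n l Y j \<noteq> column_height t n l Y k)"

definition proper_walls :: "affine_type \<Rightarrow> nat \<Rightarrow> nat \<Rightarrow> wall set" where
  "proper_walls t n l = {Y. young_wall t n l Y \<and> proper t n l Y}"

section \<open>Kashiwara operators\<close>

definition removable_block ::
  "affine_type \<Rightarrow> nat \<Rightarrow> nat \<Rightarrow> nat \<Rightarrow> wall \<Rightarrow> place \<Rightarrow> bool" where
  "removable_block t n l i Y p \<longleftrightarrow>
     p \<in> Y \<and> colour t n l p = i \<and> Y - {p} \<in> proper_walls t n l"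

definition admissible_slot ::
  "affine_type \<Rightarrow> nat \<Rightarrow> nat \<Rightarrow> nat \<Rightarrow> wall \<Rightarrow> place \<Rightarrow> bool" where
  "admissible_slot t n l i Y p \<longleftrightarrow>
     p \<notin> Y \<and> colour t n l p = i \<and> insert p Y \<in> proper_walls t n l"

definition removable :: "affine_type \<Rightarrow> nat \<Rightarrow> nat \<Rightarrow> nat \<Rightarrow> wall \<Rightarrow> nat \<Rightarrow> bool" where
  "removable t n l i Y k \<longleftrightarrow> (\<exists>p. column p = k \<and> removable_block t n l i Y p)"

definition admissible :: "affine_type \<Rightarrow> nat \<Rightarrow> nat \<Rightarrow> nat \<Rightarrow> wall \<Rightarrow> nat \<Rightarrow> bool" where
  "admissible t n l i Y k \<longleftrightarrow> (\<exists>p. column p = k \<and> admissible_slot t n l i Y p)"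

definition twice_removable :: "affine_type \<Rightarrow> nat \<Rightarrow> nat \<Rightarrow> nat \<Rightarrow> wall \<Rightarrow> nat \<Rightarrow> bool" where
  "twice_removable t n l i Y k \<longleftrightarrow>
     (\<exists>p. column p = k \<and> removable_block t n l i Y p \<and> removable t n l i (Y - {p}) k)"

definition twice_admissible :: "affine_type \<Rightarrow> nat \<Rightarrow> nat \<Rightarrow> nat \<Rightarrow> wall \<Rightarrow> nat \<Rightarrow> bool" where
  "twice_admissible t n l i Y k \<longleftrightarrow>
     (\<exists>p. column p = k \<and> admissible_slot t n l i Y p \<and> admissible t n l i (insert p Y) k)"

definition once_removable :: "affine_type \<Rightarrow> nat \<Rightarrow> nat \<Rightarrow> nat \<Rightarrow> wall \<Rightarrow> nat \<Rightarrow> bool" where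
  "once_removable t n l i Y k \<longleftrightarrow> removable t n l i Y k \<and> \<not> twice_removable t n l i Y k"

definition once_admissible :: "affine_type \<Rightarrow> nat \<Rightarrow> nat \<Rightarrow> nat \<Rightarrow> wall \<Rightarrow> nat \<Rightarrow> bool" where
  "once_admissible t n l i Y k \<longleftrightarrow> admissible t n l i Y k \<and> \<not> twice_admissible t n l i Y k"

datatype sign = Sign_Plus | Sign_Minus

definition column_signs ::
  "affine_type \<Rightarrow> nat \<Rightarrow> nat \<Rightarrow> nat \<Rightarrow> wall \<Rightarrow> nat \<Rightarrow> sign list" where
  "column_signs t n l i Y k =
     (if twice_removable t n l i Y k then [Sign_Minus, Sign_Minus]
      else if once_removable t n l i Y k \<and> \<not> admissible t n l i Y k then [Sign_Minus]
      else if once_removable t n l i Y k \<and> once_admissible t n l i Y k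
        then [Sign_Minus, Sign_Plus]
      else if once_admissible t n l i Y k \<and> \<not> removable t n l i Y k then [Sign_Plus]
      else if twice_admissible t n l i Y k then [Sign_Plus, Sign_Plus]
      else [])"

text \<open>Each sign carries the number of its column. Only finitely many columns of a proper
  Young wall have a sign, so the sequence may be started at any column beyond which there
  are no signs.\<close>

definition sign_sequence ::
  "affine_type \<Rightarrow> nat \<Rightarrow> nat \<Rightarrow> nat \<Rightarrow> wall \<Rightarrow> (nat \<times> sign) list" where
  "sign_sequence t n l i Y =
     (let N = (LEAST N. \<forall>k\<ge>N. column_signs t n l i Y k = [])
      in concat (map (\<lambda>k. map (Pair k) (column_signs t n l i Y k)) (rev [0..<N])))"

text \<open>If \<open>xs\<close> has the form $-\cdots-+\cdots+$, then so has \<open>cancel_cons x xs\<close>: a $+$ put in front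
  of a $-$ cancels with it.\<close>

fun cancel_cons :: "nat \<times> sign \<Rightarrow> (nat \<times> sign) list \<Rightarrow> (nat \<times> sign) list" where
  "cancel_cons (k, Sign_Plus) ((j, Sign_Minus) # xs) = xs"
| "cancel_cons x xs = x # xs"

definition signature ::
  "affine_type \<Rightarrow> nat \<Rightarrow> nat \<Rightarrow> nat \<Rightarrow> wall \<Rightarrow> (nat \<times> sign) list" where
  "signature t n l i Y = foldr cancel_cons (sign_sequence t n l i Y) []"

definition minus_columns :: "affine_type \<Rightarrow> nat \<Rightarrow> nat \<Rightarrow> nat \<Rightarrow> wall \<Rightarrow> nat list" where
  "minus_columns t n l i Y =
     map fst (filter (\<lambda>x. snd x = Sign_Minus) (signature t n l i Y))"

definition plus_columns :: "affine_type \<Rightarrow> nat \<Rightarrow> nat \<Rightarrow> nat \<Rightarrow> wall \<Rightarrow> nat list" where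
  "plus_columns t n l i Y =
     map fst (filter (\<lambda>x. snd x = Sign_Plus) (signature t n l i Y))"

definition e_op :: "affine_type \<Rightarrow> nat \<Rightarrow> nat \<Rightarrow> nat \<Rightarrow> wall \<Rightarrow> wall option" where
  "e_op t n l i Y =
     (let ks = minus_columns t n l i Y
      in if ks = [] then None
         else Some (Y - {THE p. column p = last ks \<and> removable_block t n l i Y p}))"

definition f_op :: "affine_type \<Rightarrow> nat \<Rightarrow> nat \<Rightarrow> nat \<Rightarrow> wall \<Rightarrow> wall option" where
  "f_op t n l i Y =
     (let ks = plus_columns t n l i Y
      in if ks = [] then None
         else Some (insert (THE p. column p = hd ks \<and> admissible_slot t n l i Y p) Y))"

definition wall_eps :: "affine_type \<Rightarrow> nat \<Rightarrow> nat \<Rightarrow> nat \<Rightarrow> wall \<Rightarrow> int extended" where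
  "wall_eps t n l i Y = Fin (int (length (minus_columns t n l i Y)))"

definition wall_phi :: "affine_type \<Rightarrow> nat \<Rightarrow> nat \<Rightarrow> nat \<Rightarrow> wall \<Rightarrow> int extended" where
  "wall_phi t n l i Y = Fin (int (length (plus_columns t n l i Y)))"

definition wall_wt :: "affine_type \<Rightarrow> nat \<Rightarrow> nat \<Rightarrow> wall \<Rightarrow> weight" where
  "wall_wt t n l Y =
     (\<lambda>x. fundamental_weight l x -
        (\<Sum>i\<in>{0..n}. int (card {p \<in> Y - ground_wall t n l. colour t n l p = i})
                      * simple_root (cartan t n) i x))"

section \<open>Reduced walls\<close>

definition delta_coeff :: "affine_type \<Rightarrow> nat \<Rightarrow> nat \<Rightarrow> nat" where
  "delta_coeff t n i = (if t = D2 then 2 * null_root_coeff t n i else null_root_coeff t n i)"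

text \<open>The last condition says that the blocks are consecutive in the stack. It does not constrain
  the lowest and the highest level of \<open>R\<close>, which may be half-filled split levels.\<close>

definition delta_column ::
  "affine_type \<Rightarrow> nat \<Rightarrow> nat \<Rightarrow> wall \<Rightarrow> nat \<Rightarrow> place set \<Rightarrow> bool" where
  "delta_column t n l Y k R \<longleftrightarrow>
     R \<subseteq> Y \<and> (\<forall>p\<in>R. column p = k) \<and>
     (\<forall>i\<in>{0..n}. card {p \<in> R. colour t n l p = i} = delta_coeff t n i) \<and>
     (\<forall>p\<in>R. \<forall>q\<in>R. \<forall>r\<in>Y. column r = k \<and>
        height_index p < height_index r \<and> height_index r < height_index q \<longrightarrow> r \<in> R)"

text \<open>Whenever \<open>Y - R\<close> is a Young wall, \<open>R\<close> lies at the top of its column.\<close>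

definition removable_delta :: "affine_type \<Rightarrow> nat \<Rightarrow> nat \<Rightarrow> wall \<Rightarrow> nat \<Rightarrow> bool" where
  "removable_delta t n l Y k \<longleftrightarrow>
     (\<exists>R. delta_column t n l Y k R \<and> Y - R \<in> proper_walls t n l)"

definition reduced_walls :: "affine_type \<Rightarrow> nat \<Rightarrow> nat \<Rightarrow> wall set" where
  "reduced_walls t n l = {Y \<in> proper_walls t n l. \<forall>k. \<not> removable_delta t n l Y k}"

end

theory Submission
  imports Defs
begin

text \<open>The state of a column is given by its top, so a wall is a sequence of column states. If the
  neighbours are disregarded, a single column, continued downwards along its periodic pattern, is
  already a crystal: \<open>phi\<close> and \<open>eps\<close> count the blocks of a colour that can be put on it or taken
  off it, and a block of colour $j$ changes $\varphi_i - \varepsilon_i$ by $-a_{ij}$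
  (\<open>step_weight\<close>). The latter depends on the levels next to the block only and is the way in which
  the patterns encode the Cartan matrix. A sequence that ends in ground states is a proper
  Young wall if and only if a relation \<open>fits\<close> holds between neighbouring columns: the left one is
  contained in the right one, and they are not full columns of the same height.

  The proof rests on the fact that this relation is stable under the tensor product rule for two
  factors (\<open>fits_step_left\<close>, \<open>fits_step_right\<close>): if $\varphi_i$ of the left column exceeds
  $\varepsilon_i$ of the right one, then the left column may receive an $i$-block, and if
  $\varepsilon_i$ of the right column exceeds $\varphi_i$ of the left one, then the right
  column may lose an $i$-block. This has two consequences.

  First, the pluses and minuses that neighbours block form adjacent cancelling pairs
  (\<open>blocked_pairs\<close>). So the signature of a wall is the one computed from \<open>phi\<close> and \<open>eps\<close> of
  its columns (\<open>signature_eq\<close>), and the crystal axioms follow as for tensor products of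
  crystals: an operator turns one surviving sign into the opposite one (\<open>move_op\<close>), and the sum of
  $\varphi_i - \varepsilon_i$ over the columns gives the weight (\<open>phi_minus_eps\<close>).

  Second, removing a $\delta$ from a column lowers it by a period of its pattern, because the
  colours of the removed blocks determine what remains (\<open>removable_delta_iff\<close>). So a wall is reduced
  if and only if no column \<open>a\<close> fits with its right neighbour \<open>b\<close> lowered by a period. Lowering
  changes neither the colours at the top of \<open>b\<close> nor $\varphi_i$ and $\varepsilon_i$. Hence the pairs
  $(a, b)$ with a removable $\delta$ are stable under the operators for two factors; these are
  inverse to each other, so the pairs without removable $\delta$ are stable as well. An operator
  on the wall that changes one of two neighbouring columns acts on the pair by the rule for two
  factors. Therefore it preserves reducedness (\<open>removable_delta_move\<close>).

  It remains to recognize the patterns. Except for $A_n^{(1)}$, one period is a walk along the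
  Dynkin diagram from one end to the other and back (\<open>zigzag\<close>), and the Cartan matrix is
  compared with this walk. For $A_n^{(1)}$, levels are counted by content; this makes weakly
  decreasing heights strictly decreasing and all columns alike, so that the same relation
  describes this type.\<close>

section \<open>Cancellation of signs\<close>

definition cancelled :: "(nat \<times> sign) list \<Rightarrow> (nat \<times> sign) list" where
  "cancelled xs = foldr cancel_cons xs []"

abbreviation all_minus :: "(nat \<times> sign) list \<Rightarrow> bool" where
  "all_minus xs \<equiv> \<forall>x\<in>set xs. snd x = Sign_Minus"

abbreviation all_plus :: "(nat \<times> sign) list \<Rightarrow> bool" where
  "all_plus xs \<equiv> \<forall>x\<in>set xs. snd x = Sign_Plus"

lemma cancelled_simps [simp]:
  "cancelled [] = []"
  "cancelled (x # xs) = cancel_cons x (cancelled xs)"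
  by (simp_all add: cancelled_def)

lemma cancelled_append: "cancelled (xs @ ys) = foldr cancel_cons xs (cancelled ys)"
  by (simp add: cancelled_def)

lemma cancel_cons_minus [simp]: "cancel_cons (k, Sign_Minus) xs = (k, Sign_Minus) # xs"
  by simp

lemma cancel_cons_cases:
  obtains (keep) "cancel_cons x ys = x # ys"
  | (cancel) k j zs where "x = (k, Sign_Plus)" "ys = (j, Sign_Minus) # zs" "cancel_cons x ys = zs"
  by (cases "(x, ys)" rule: cancel_cons.cases) auto

lemma cancelled_form: "\<exists>P Q. cancelled xs = P @ Q \<and> all_minus P \<and> all_plus Q"
proof (induction xs)
  case Nil
  then show ?case by auto
next
  case (Cons x xs)
  then obtain P Q where PQ: "cancelled xs = P @ Q" "all_minus P" "all_plus Q" by blast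
  obtain k s where x: "x = (k, s)" by force
  show ?case
  proof (cases s)
    case Sign_Minus
    then have "cancelled (x # xs) = (x # P) @ Q" "all_minus (x # P)" using PQ x by auto
    then show ?thesis using PQ by blast
  next
    case Sign_Plus
    show ?thesis
    proof (cases P)
      case Nil
      have "cancelled (x # xs) = x # Q"
        using PQ Nil x Sign_Plus by (cases Q) (auto simp: cancel_cons.simps split: prod.splits)
      then have "cancelled (x # xs) = [] @ (x # Q)" "all_plus (x # Q)"
        using PQ x Sign_Plus by auto
      then show ?thesis by (metis empty_iff list.set(1))
    next
      case (Cons y P')
      then have "cancelled (x # xs) = P' @ Q" "all_minus P'"
        using PQ x Sign_Plus by (cases y; auto)+
      then show ?thesis using PQ by blast
    qed
  qed
qed

text \<open>A sign that survives can be located in the sequence: what lies to its left cancels to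
  minuses only, what lies to its right to pluses only, so neither side interacts with it.\<close>

lemma surviving_sign:
  assumes "cancelled xs = P @ x # Q" "all_minus P" "all_plus Q"
  shows "\<exists>A B. xs = A @ x # B \<and> cancelled A = P \<and> cancelled B = Q"
  using assms
proof (induction xs arbitrary: P)
  case Nil
  then show ?case by simp
next
  case (Cons y ys)
  show ?case
  proof (cases y "cancelled ys" rule: cancel_cons_cases)
    case keep
    then have eq: "y # cancelled ys = P @ x # Q" using Cons.prems by simp
    show ?thesis
    proof (cases P)
      case Nil
      then have "y # ys = [] @ x # ys" "cancelled [] = P" "cancelled ys = Q" using eq by auto
      then show ?thesis by blast
    next
      case (Cons p P')
      then have "cancelled ys = P' @ x # Q" "all_minus P'" "p = y" using eq Cons.prems by auto
      then obtain A B where AB: "ys = A @ x # B" "cancelled A = P'" "cancelled B = Q"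
        using Cons.IH Cons.prems by blast
      have "cancelled (y # A) = P"
        using Cons.prems(2) Cons \<open>p = y\<close> AB by (cases y) auto
      then show ?thesis using AB by (metis append_Cons)
    qed
  next
    case (cancel k j zs)
    then have "cancelled ys = ((j, Sign_Minus) # P) @ x # Q" using Cons.prems by simp
    then obtain A B where AB: "ys = A @ x # B" "cancelled A = (j, Sign_Minus) # P" "cancelled B = Q"
      using Cons.IH[of "(j, Sign_Minus) # P"] Cons.prems by auto
    then have "cancelled (y # A) = P" using cancel by simp
    then show ?thesis using AB by (metis append_Cons)
  qed
qed

text \<open>If no plus of \<open>A\<close> survives within \<open>A\<close>, then \<open>A\<close> cannot act on what stands to its right.\<close>

lemma foldr_cancel_all_minus:
  "all_minus (cancelled A) \<Longrightarrow> foldr cancel_cons A ys = cancelled A @ ys"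
proof (induction A)
  case Nil
  then show ?case by simp
next
  case (Cons y A)
  show ?case
  proof (cases y "cancelled A" rule: cancel_cons_cases)
    case keep
    then have "snd y = Sign_Minus" "all_minus (cancelled A)" using Cons.prems by auto
    then show ?thesis using Cons.IH keep by (cases y) auto
  next
    case (cancel k j zs)
    then have "all_minus (cancelled A)" using Cons.prems by auto
    then show ?thesis using Cons.IH cancel by auto
  qed
qed

lemma cancelled_at_survivor:
  assumes "all_minus (cancelled A)" "all_plus (cancelled B)"
  shows "cancelled (A @ x # B) = cancelled A @ x # cancelled B"
proof -
  have "cancel_cons x (cancelled B) = x # cancelled B"
    using assms(2) by (cases x "cancelled B" rule: cancel_cons_cases) auto
  then show ?thesis using foldr_cancel_all_minus[OF assms(1)] by (simp add: cancelled_append)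
qed

text \<open>A plus is cancelled only by a minus to its right, so signs put in front of it leave it alone.\<close>

lemma plus_persists:
  "(k, Sign_Plus) \<in> set ys \<Longrightarrow> (k, Sign_Plus) \<in> set (foldr cancel_cons A ys)"
proof (induction A)
  case (Cons a A)
  then show ?case
    by (cases a "foldr cancel_cons A ys" rule: cancel_cons_cases) auto
qed simp

lemma foldr_cancel_minus:
  "foldr cancel_cons (replicate e (k, Sign_Minus)) ys = replicate e (k, Sign_Minus) @ ys"
  by (induction e) (auto simp del: foldr_replicate)

lemma cancelled_replicate_minus_append [simp]:
  "cancelled (replicate e (k, Sign_Minus) @ xs) = replicate e (k, Sign_Minus) @ cancelled xs"
  by (simp add: cancelled_append foldr_cancel_minus del: foldr_replicate)

lemma foldr_cancel_replicate:
  "foldr cancel_cons (replicate c (j, Sign_Plus)) (replicate (c + e) (k, Sign_Minus) @ ys)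
     = replicate e (k, Sign_Minus) @ ys"
proof (induction c)
  case (Suc c)
  have "foldr cancel_cons (replicate (Suc c) (j, Sign_Plus)) (replicate (Suc c + e) (k, Sign_Minus) @ ys)
    = foldr cancel_cons (replicate c (j, Sign_Plus)) (cancel_cons (j, Sign_Plus) (replicate (Suc c + e) (k, Sign_Minus) @ ys))"
    by (simp only: replicate_Suc replicate_append_same[symmetric] foldr_append) simp
  also have "\<dots> = foldr cancel_cons (replicate c (j, Sign_Plus)) (replicate (c + e) (k, Sign_Minus) @ ys)"
    by simp
  finally show ?case using Suc by simp
qed simp

text \<open>A plus cancels one minus only, so a surplus of minuses leaves a minus over.\<close>

lemma all_plusD:
  assumes "all_plus (cancelled (replicate f (j, Sign_Plus) @ replicate e (k, Sign_Minus) @ xs))"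
  shows "e \<le> f"
proof (rule ccontr)
  assume "\<not> e \<le> f"
  then obtain d where d: "e = f + Suc d" by (metis add_Suc_right less_imp_Suc_add not_le)
  show False using assms
    unfolding cancelled_append[of "replicate f _"] cancelled_replicate_minus_append d
      foldr_cancel_replicate by simp
qed

lemma all_minusD:
  assumes "all_minus (cancelled (A @ replicate f (j, Sign_Plus) @ replicate e (k, Sign_Minus)))"
  shows "f \<le> e"
proof (rule ccontr)
  assume "\<not> f \<le> e"
  then obtain d where d: "f = Suc d + e" by (metis add_Suc_right add.commute less_imp_Suc_add not_le)
  have "cancelled (replicate f (j, Sign_Plus) @ replicate e (k, Sign_Minus)) =
      foldr cancel_cons (replicate (Suc d) (j, Sign_Plus)) (foldr cancel_cons (replicate e (j, Sign_Plus))
         (replicate (e + 0) (k, Sign_Minus) @ []))"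
    unfolding d replicate_add cancelled_append
    using cancelled_replicate_minus_append[of e k "[]"] by simp
  also have "\<dots> = foldr cancel_cons (replicate d (j, Sign_Plus)) [(j, Sign_Plus)]"
    unfolding foldr_cancel_replicate by (simp only: replicate_Suc replicate_append_same[symmetric] foldr_append) simp
  finally have "(j, Sign_Plus) \<in> set (cancelled (replicate f (j, Sign_Plus) @ replicate e (k, Sign_Minus)))"
    by (simp add: plus_persists del: foldr_replicate)
  then have "(j, Sign_Plus) \<in> set (cancelled (A @ replicate f (j, Sign_Plus) @ replicate e (k, Sign_Minus)))"
    unfolding cancelled_append[of A] by (rule plus_persists)
  then show False using assms by fastforce
qed

definition balance :: "(nat \<times> sign) list \<Rightarrow> int" where
  "balance xs = (\<Sum>x\<leftarrow>xs. if snd x = Sign_Plus then 1 else - 1)"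

lemma balance_simps [simp]:
  "balance [] = 0" "balance (x # xs) = (if snd x = Sign_Plus then 1 else - 1) + balance xs"
  "balance (xs @ ys) = balance xs + balance ys"
  by (simp_all add: balance_def)

lemma balance_replicate [simp]:
  "balance (replicate e (k, Sign_Minus)) = - int e"
  "balance (replicate e (k, Sign_Plus)) = int e"
  by (induction e) auto

lemma balance_cancelled: "balance (cancelled xs) = balance xs"
proof (induction xs)
  case (Cons x xs)
  then show ?case by (cases x "cancelled xs" rule: cancel_cons_cases) auto
qed simp

lemma balance_filter:
  "balance xs = int (length (filter (\<lambda>x. snd x = Sign_Plus) xs))
     - int (length (filter (\<lambda>x. snd x = Sign_Minus) xs))"
proof (induction xs)
  case (Cons x xs)
  then show ?case by (cases "snd x") auto
qed simp

section \<open>Sequences of columns\<close>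

text \<open>Column \<open>k\<close> contributes \<open>E k\<close> minuses followed by \<open>F k\<close> pluses, each carrying the number of
  its column. Since walls are read from left to right, a sequence starts at the column with the
  largest number.\<close>

definition block :: "(nat \<Rightarrow> nat) \<Rightarrow> (nat \<Rightarrow> nat) \<Rightarrow> nat \<Rightarrow> (nat \<times> sign) list" where
  "block E F k = replicate (E k) (k, Sign_Minus) @ replicate (F k) (k, Sign_Plus)"

definition blocks :: "(nat \<Rightarrow> nat) \<Rightarrow> (nat \<Rightarrow> nat) \<Rightarrow> nat \<Rightarrow> nat \<Rightarrow> (nat \<times> sign) list" where
  "blocks E F k N = concat (map (block E F) (rev [k..<N]))"

lemma blocks_Suc: "k \<le> N \<Longrightarrow> blocks E F k (Suc N) = block E F N @ blocks E F k N"
  by (simp add: blocks_def)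

lemma blocks_empty [simp]: "blocks E F k k = []"
  by (simp add: blocks_def)

lemma blocks_split: "k < N \<Longrightarrow> blocks E F 0 N = blocks E F (Suc k) N @ block E F k @ blocks E F 0 k"
proof -
  assume "k < N"
  then have "[0..<N] = [0..<k] @ k # [Suc k..<N]"
    by (metis le0 less_imp_le_nat upt_add_eq_append upt_conv_Cons le_add_diff_inverse add_0)
  then show ?thesis by (simp add: blocks_def)
qed

lemma blocks_columns: "x \<in> set (blocks E F k N) \<Longrightarrow> k \<le> fst x \<and> fst x < N"
  by (auto simp: blocks_def block_def)

lemma balance_blocks: "balance (blocks E F 0 N) = (\<Sum>k<N. int (F k) - int (E k))"
  by (induction N) (simp_all add: blocks_Suc block_def)

text \<open>The last \<open>c k\<close> pluses of column \<open>k + 1\<close> and the first \<open>c k\<close> minuses of column \<open>k\<close> stand side by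
  side, and striking them out removes only cancelling pairs. At the left end there is no
  column to cancel the \<open>c N\<close> minuses that were struck out there, so they reappear in front.\<close>

lemma cancelled_blocks_struck:
  assumes "\<And>k. E k = B k + c k" "\<And>k. F (Suc k) = A (Suc k) + c k" "F 0 = A 0"
  shows "cancelled (blocks E F 0 (Suc N)) =
    replicate (c N) (N, Sign_Minus) @ cancelled (blocks B A 0 (Suc N))"
proof (induction N)
  case 0
  have "c 0 + B 0 = B 0 + c 0" by simp
  then show ?case using assms(1)[of 0] assms(3)
    by (simp add: blocks_Suc block_def replicate_add[symmetric]
        cancelled_replicate_minus_append[of _ _ "replicate _ _"] flip: append_assoc)
next
  case (Suc N)
  have "cancelled (blocks E F 0 (Suc (Suc N))) = replicate (E (Suc N)) (Suc N, Sign_Minus) @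
     foldr cancel_cons (replicate (A (Suc N)) (Suc N, Sign_Plus))
      (foldr cancel_cons (replicate (c N) (Suc N, Sign_Plus)) (replicate (c N + 0) (N, Sign_Minus) @ cancelled (blocks B A 0 (Suc N))))"
    using Suc assms(2)[of N] 
    by (simp add: blocks_Suc[of _ "Suc N"] block_def replicate_add cancelled_append

        foldr_cancel_minus del: replicate.simps foldr_replicate)
  also have "\<dots> = replicate (c (Suc N)) (Suc N, Sign_Minus) @
     replicate (B (Suc N)) (Suc N, Sign_Minus) @ foldr cancel_cons (replicate (A (Suc N)) (Suc N, Sign_Plus)) (cancelled (blocks B A 0 (Suc N)))"
    unfolding foldr_cancel_replicate by (simp add: assms(1) replicate_add[symmetric] add.commute flip: append_assoc)
  also have "\<dots> = replicate (c (Suc N)) (Suc N, Sign_Minus) @ cancelled (blocks B A 0 (Suc (Suc N)))"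
    by (simp add: blocks_Suc[of _ "Suc N"] block_def cancelled_append foldr_cancel_minus
        del: foldr_replicate)
  finally show ?case .
qed

lemma append_mid_unique:
  assumes "hi @ mi @ lo = A @ x # B" "x \<notin> set hi" "x \<notin> set lo"
  shows "\<exists>A' B'. A = hi @ A' \<and> B = B' @ lo \<and> mi = A' @ x # B'"
  using assms(1,2)
proof (induction hi arbitrary: A)
  case Nil
  then obtain us where "mi = A @ us \<and> us @ lo = x # B \<or> mi @ us = A \<and> lo = us @ x # B"
    by (auto simp: append_eq_append_conv2)
  then have "mi = A @ us" "us @ lo = x # B" using assms(3) by auto
  moreover have "us \<noteq> []" using \<open>us @ lo = x # B\<close> assms(3) by auto
  ultimately show ?case by (cases us) auto
next
  case (Cons h hi)
  then obtain A0 where "A = h # A0" by (cases A) auto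
  then show ?case using Cons.IH[of A0] Cons.prems by auto
qed

lemma replicate2_split_plus:
  assumes "replicate e (k, Sign_Minus) @ replicate f (k, Sign_Plus) = A @ (k, Sign_Plus) # B"
  shows "\<exists>j. A = replicate e (k, Sign_Minus) @ replicate j (k, Sign_Plus) \<and> f = j + Suc (length B)
     \<and> B = replicate (length B) (k, Sign_Plus)"
proof -
  obtain A' B' where 1: "A = replicate e (k, Sign_Minus) @ A'" "B = B' @ []"
      "replicate f (k, Sign_Plus) = A' @ (k, Sign_Plus) # B'"
    using append_mid_unique[of "replicate e (k, Sign_Minus)" "replicate f (k, Sign_Plus)" "[]" A "(k, Sign_Plus)" B] assms
    by auto
  have "\<forall>x\<in>set (A' @ (k, Sign_Plus) # B'). x = (k, Sign_Plus)"
    unfolding 1(3)[symmetric] by simp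
  then have "A' = replicate (length A') (k, Sign_Plus)" "B' = replicate (length B') (k, Sign_Plus)"
    by (auto intro!: replicate_eqI)
  moreover have "f = length A' + Suc (length B')" using arg_cong[OF 1(3), of length] by simp
  ultimately show ?thesis using 1 by auto
qed

lemma replicate2_split_minus:
  assumes "replicate e (k, Sign_Minus) @ replicate f (k, Sign_Plus) = A @ (k, Sign_Minus) # B"
  shows "\<exists>j. B = replicate j (k, Sign_Minus) @ replicate f (k, Sign_Plus) \<and> e = j + Suc (length A)
     \<and> A = replicate (length A) (k, Sign_Minus)"
proof -
  obtain A' B' where 1: "A = [] @ A'" "B = B' @ replicate f (k, Sign_Plus)"
      "replicate e (k, Sign_Minus) = A' @ (k, Sign_Minus) # B'"
    using append_mid_unique[of "[]" "replicate e (k, Sign_Minus)" "replicate f (k, Sign_Plus)" A "(k, Sign_Minus)" B] assms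
    by auto
  have "\<forall>x\<in>set (A' @ (k, Sign_Minus) # B'). x = (k, Sign_Minus)"
    unfolding 1(3)[symmetric] by simp
  then have "A' = replicate (length A') (k, Sign_Minus)" "B' = replicate (length B') (k, Sign_Minus)"
    by (auto intro!: replicate_eqI)
  moreover have "e = length A' + Suc (length B')" using arg_cong[OF 1(3), of length] by simp
  ultimately show ?thesis using 1 by auto
qed

text \<open>What stands to the left and to the right of the sign of column \<open>k\<close> on which an operator acts.
  The operator turns the first plus of the column into its last minus, or back, and changes
  neither of the two parts.\<close>

definition left_part :: "(nat \<Rightarrow> nat) \<Rightarrow> (nat \<Rightarrow> nat) \<Rightarrow> nat \<Rightarrow> nat \<Rightarrow> (nat \<times> sign) list" where
  "left_part E F k N = blocks E F (Suc k) N @ replicate (E k) (k, Sign_Minus)"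

definition right_part :: "(nat \<Rightarrow> nat) \<Rightarrow> (nat \<Rightarrow> nat) \<Rightarrow> nat \<Rightarrow> (nat \<times> sign) list" where
  "right_part E F k = replicate (F k) (k, Sign_Plus) @ blocks E F 0 k"

lemma blocks_at_plus:
  assumes "k < N" "F k = Suc f"
  shows "blocks E F 0 N = left_part E F k N @ (k, Sign_Plus) # right_part E (F(k := f)) k"
proof -
  have "blocks E (F(k := f)) 0 k = blocks E F 0 k"
    by (auto simp: blocks_def block_def intro!: arg_cong[of _ _ concat])
  then show ?thesis using assms
    by (simp add: blocks_split left_part_def right_part_def block_def)
qed

lemma blocks_at_minus:
  assumes "k < N" "E k = Suc e"
  shows "blocks E F 0 N = left_part (E(k := e)) F k N @ (k, Sign_Minus) # right_part E F k"
proof -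
  have "blocks (E(k := e)) F (Suc k) N = blocks E F (Suc k) N"
    by (auto simp: blocks_def block_def intro!: arg_cong[of _ _ concat])
  then show ?thesis using assms
    by (simp add: blocks_split left_part_def right_part_def block_def replicate_append_same)
qed

text \<open>A plus of column \<open>k\<close> directly in front of a surviving one has nothing to cancel with and
  survives as well. Hence the leftmost surviving plus is the first plus of its column, and
  dually for the rightmost surviving minus.\<close>

lemma surviving_plus:
  assumes "cancelled (blocks E F 0 N) = P @ (k, Sign_Plus) # Q" "all_minus P" "all_plus Q"
  shows "k < N \<and> F k > 0 \<and> cancelled (left_part E F k N) = P
     \<and> cancelled (right_part E (F(k := F k - 1)) k) = Q"
proof -
  obtain A B where AB: "blocks E F 0 N = A @ (k, Sign_Plus) # B" "cancelled A = P" "cancelled B = Q"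
    using surviving_sign[OF assms] by blast
  have "(k, Sign_Plus) \<in> set (blocks E F 0 N)" using AB by simp
  from blocks_columns[OF this] have k: "k < N" by simp
  have nin: "(k, Sign_Plus) \<notin> set (blocks E F (Suc k) N)" "(k, Sign_Plus) \<notin> set (blocks E F 0 k)"
    using blocks_columns by fastforce+
  obtain A' B' where 1: "A = blocks E F (Suc k) N @ A'" "B = B' @ blocks E F 0 k"
     "block E F k = A' @ (k, Sign_Plus) # B'"
    using append_mid_unique[OF _ nin] AB(1) blocks_split[OF k] by metis
  obtain j where j: "A' = replicate (E k) (k, Sign_Minus) @ replicate j (k, Sign_Plus)"
     "F k = j + Suc (length B')" "B' = replicate (length B') (k, Sign_Plus)"
    using replicate2_split_plus[OF 1(3)[unfolded block_def]] by blast
  have "j = 0"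
  proof (rule ccontr)
    assume "j \<noteq> 0"
    then obtain j' where "j = Suc j'" by (cases j) auto
    then have "A = (blocks E F (Suc k) N @ replicate (E k) (k, Sign_Minus) @ replicate j' (k, Sign_Plus)) @ [(k, Sign_Plus)]"
      using 1 j by (simp add: replicate_append_same)
    then have "(k, Sign_Plus) \<in> set (cancelled A)"
      by (simp only: cancelled_append) (rule plus_persists, simp)
    then show False using AB assms by fastforce
  qed
  then have "A = left_part E F k N" "F k > 0" using 1 j by (auto simp: left_part_def)
  moreover have "(E, F k - 1) = (E, length B')" using j \<open>j = 0\<close> by simp
  moreover have "B = right_part E (F(k := F k - 1)) k"
  proof -
    have "blocks E (F(k := F k - 1)) 0 k = blocks E F 0 k"
      by (auto simp: blocks_def block_def intro!: arg_cong[of _ _ concat])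
    then show ?thesis using 1 j \<open>j = 0\<close> by (simp add: right_part_def)
  qed
  ultimately show ?thesis using AB k by simp
qed

lemma surviving_minus:
  assumes "cancelled (blocks E F 0 N) = P @ (k, Sign_Minus) # Q" "all_minus P" "all_plus Q"
  shows "k < N \<and> E k > 0 \<and> cancelled (left_part (E(k := E k - 1)) F k N) = P
     \<and> cancelled (right_part E F k) = Q"
proof -
  obtain A B where AB: "blocks E F 0 N = A @ (k, Sign_Minus) # B" "cancelled A = P" "cancelled B = Q"
    using surviving_sign[OF assms] by blast
  have "(k, Sign_Minus) \<in> set (blocks E F 0 N)" using AB by simp
  from blocks_columns[OF this] have k: "k < N" by simp
  have nin: "(k, Sign_Minus) \<notin> set (blocks E F (Suc k) N)" "(k, Sign_Minus) \<notin> set (blocks E F 0 k)"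
    using blocks_columns by fastforce+
  obtain A' B' where 1: "A = blocks E F (Suc k) N @ A'" "B = B' @ blocks E F 0 k"
     "block E F k = A' @ (k, Sign_Minus) # B'"
    using append_mid_unique[OF _ nin] AB(1) blocks_split[OF k] by metis
  obtain j where j: "B' = replicate j (k, Sign_Minus) @ replicate (F k) (k, Sign_Plus)"
     "E k = j + Suc (length A')" "A' = replicate (length A') (k, Sign_Minus)"
    using replicate2_split_minus[OF 1(3)[unfolded block_def]] by blast
  have "j = 0"
  proof (rule ccontr)
    assume "j \<noteq> 0"
    then obtain j' where "j = Suc j'" by (cases j) auto
    then have "(k, Sign_Minus) \<in> set (cancelled B)" using 1 j by simp
    then show False using AB assms by fastforce
  qed
  then have "B = right_part E F k" "E k > 0" using 1 j by (auto simp: right_part_def)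
  moreover have "A = left_part (E(k := E k - 1)) F k N"
  proof -
    have "blocks (E(k := E k - 1)) F (Suc k) N = blocks E F (Suc k) N"
      by (auto simp: blocks_def block_def intro!: arg_cong[of _ _ concat])
    then show ?thesis using 1 j \<open>j = 0\<close> by (simp add: left_part_def)
  qed
  ultimately show ?thesis using AB k by simp
qed

text \<open>On the two columns \<open>k + 1\<close> and \<open>k\<close> alone, the operator acts on column \<open>k\<close> as well: the pluses of
  column \<open>k + 1\<close> are all cancelled by minuses of column \<open>k\<close>. The next lemma is the corresponding
  fact for the pair of column \<open>k\<close> and its right neighbour.\<close>

lemma left_part_all_minus:
  assumes "all_minus (cancelled (left_part E F k N))" "Suc k < N"
  shows "F (Suc k) \<le> E k"
proof -
  have "blocks E F (Suc k) N = concat (map (block E F) (rev [Suc (Suc k)..<N])) @ block E F (Suc k)"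
    using assms(2) by (simp add: blocks_def upt_conv_Cons)
  then show ?thesis using assms(1)
    by (simp only: left_part_def block_def append_assoc)
      (rule all_minusD[of "concat (map (block E F) (rev [Suc (Suc k)..<N])) @ replicate (E (Suc k)) (Suc k, Sign_Minus)" "F (Suc k)" "Suc k" "E k" k],
       simp add: block_def)
qed

lemma right_part_all_plus:
  assumes "all_plus (cancelled (right_part E F (Suc k)))"
  shows "E k \<le> F (Suc k)"
  using assms unfolding right_part_def blocks_Suc[OF le0] block_def append_assoc by (rule all_plusD)

section \<open>States of a column\<close>

fun is_half :: "level \<Rightarrow> bool" where
  "is_half (Half_Height c) = True" | "is_half _ = False"

fun is_split :: "level \<Rightarrow> bool" where
  "is_split (Split b f) = True" | "is_split _ = False"

fun mult :: "nat \<Rightarrow> level \<Rightarrow> nat" where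
  "mult i (Cube c) = of_bool (c = i)"
| "mult i (Half_Height c) = of_bool (c = i)"
| "mult i (Split b f) = of_bool (b = i) + of_bool (f = i)"

fun swapped :: "level \<Rightarrow> level" where
  "swapped (Split b f) = Split f b" | "swapped lv = lv"

fun other :: "part \<Rightarrow> part" where
  "other Back = Front" | "other Front = Back" | "other Whole = Whole"

text \<open>The state \<open>(M, h)\<close> of a column: all levels below \<open>M\<close> are full, and \<open>h\<close> is the half of the split
  level \<open>M\<close> that is filled, or \<open>Whole\<close> if level \<open>M\<close> is empty. Levels are integers, because columns are
  thought of as continued periodically downwards without end. So there are blocks at the top of
  every column that could be taken off, and the ground state is not exceptional.\<close>

type_synonym state = "int \<times> part"

text \<open>How many \<open>i\<close>-blocks can be put on, or taken off, a column that is filled exactly up to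
  level \<open>z\<close>. Half-height levels come in pairs of one colour; both of a pair are counted when the
  pair lies entirely on one side of \<open>z\<close>.\<close>

definition above :: "(int \<Rightarrow> level) \<Rightarrow> nat \<Rightarrow> int \<Rightarrow> nat" where
  "above lv i z = mult i (lv z) * (if is_half (lv z) \<and> is_half (lv (z + 1)) then 2 else 1)"

definition below :: "(int \<Rightarrow> level) \<Rightarrow> nat \<Rightarrow> int \<Rightarrow> nat" where
  "below lv i z =
     mult i (lv (z - 1)) * (if is_half (lv (z - 1)) \<and> is_half (lv (z - 2)) then 2 else 1)"

text \<open>The last four assumptions tie the pattern to the Cartan matrix. Putting on a block of
  colour \<open>j\<close> replaces the levels that meet at the top of the column; they say that the number of
  \<open>i\<close>-blocks that can be put on, minus the number that can be taken off, then changes by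
  $-a_{ij}$. Passing to the left neighbour of a column interchanges front and back.\<close>

locale column_pattern =
  fixes lev :: "nat \<Rightarrow> int \<Rightarrow> level" and period :: int
    and A :: "nat \<Rightarrow> nat \<Rightarrow> int" and n :: nat
  assumes period_pos: "period > 0"
    and periodic: "lev k (z - period) = lev k z"
    and neighbour: "lev (Suc k) z = swapped (lev k z)"
    and split_distinct: "lev k z = Split b f \<Longrightarrow> b \<noteq> f"
    and half_pairs: "lev k z = Half_Height c \<Longrightarrow>
      lev k (z - 1) = Half_Height c \<and> \<not> is_half (lev k (z + 1)) \<or>
      \<not> is_half (lev k (z - 1)) \<and> lev k (z + 1) = Half_Height c"
    and colours: "mult i (lev k z) > 0 \<Longrightarrow> i \<le> n"
    and diagonal: "i \<le> n \<Longrightarrow> A i i = 2"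
    and cartan_cube: "lev k z = Cube c \<Longrightarrow> i \<le> n \<Longrightarrow>
      A i c = 2 * of_bool (c = i) - int (below (lev k) i z) - int (above (lev k) i (z + 1))"
    and cartan_lower: "lev k z = Half_Height c \<Longrightarrow> is_half (lev k (z + 1)) \<Longrightarrow> i \<le> n \<Longrightarrow>
      A i c = 2 * of_bool (c = i) - int (below (lev k) i z)"
    and cartan_upper: "lev k z = Half_Height c \<Longrightarrow> is_half (lev k (z - 1)) \<Longrightarrow> i \<le> n \<Longrightarrow>
      A i c = 2 * of_bool (c = i) - int (above (lev k) i (z + 1))"
    and cartan_split: "lev k z = Split b f \<Longrightarrow> c \<in> {b, f} \<Longrightarrow> i \<le> n \<Longrightarrow>
      A i c = 2 * of_bool (c = i) - int (below (lev k) i z) \<and>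
      A i c = 2 * of_bool (c = i) - int (above (lev k) i (z + 1))"
begin

definition split_at :: "int \<Rightarrow> bool" where "split_at z \<longleftrightarrow> is_split (lev 0 z)"

definition half_at :: "int \<Rightarrow> bool" where "half_at z \<longleftrightarrow> is_half (lev 0 z)"

text \<open>Level \<open>z\<close> is the upper one of a pair of half-height levels, so a column that ends below it has
  half-integral height.\<close>

definition mid :: "int \<Rightarrow> bool" where "mid z \<longleftrightarrow> half_at z \<and> half_at (z - 1)"

lemma is_split_swapped [simp]: "is_split (swapped lv) = is_split lv"
  by (cases lv) auto

lemma is_half_swapped [simp]: "is_half (swapped lv) = is_half lv"
  by (cases lv) auto

lemma is_split_lev [simp]: "is_split (lev k z) = split_at z"
  by (induction k) (simp_all add: split_at_def neighbour)

lemma is_half_lev [simp]: "is_half (lev k z) = half_at z"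
  by (induction k) (simp_all add: half_at_def neighbour)

definition colour_at :: "nat \<Rightarrow> int \<Rightarrow> part \<Rightarrow> nat" where
  "colour_at k z s = level_colour (lev k z) s"

definition parts_at :: "int \<Rightarrow> part set" where
  "parts_at z = (if split_at z then {Back, Front} else {Whole})"

lemma parts_lev [simp]: "parts (lev k z) = parts_at z"
  using is_split_lev[of k z] by (cases "lev k z") (auto simp: parts_at_def)

definition valid :: "state \<Rightarrow> bool" where
  "valid a \<longleftrightarrow> (snd a \<noteq> Whole \<longrightarrow> split_at (fst a))"

definition filled :: "state \<Rightarrow> int \<Rightarrow> part \<Rightarrow> bool" where
  "filled a z s \<longleftrightarrow> z < fst a \<or> z = fst a \<and> snd a \<noteq> Whole \<and> s = snd a"

definition le :: "state \<Rightarrow> state \<Rightarrow> bool" where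
  "le a b \<longleftrightarrow> fst a < fst b \<or> fst a = fst b \<and> (snd a = Whole \<or> snd a = snd b)"

definition full :: "state \<Rightarrow> bool" where
  "full a \<longleftrightarrow> snd a = Whole \<and> \<not> mid (fst a)"

text \<open>The condition on a column \<open>a\<close> and its right neighbour \<open>b\<close> in a proper wall. For nested columns
  that are both full, equal height means equality.\<close>

definition fits :: "state \<Rightarrow> state \<Rightarrow> bool" where
  "fits a b \<longleftrightarrow> le a b \<and> \<not> (a = b \<and> full a)"

inductive add :: "int \<Rightarrow> part \<Rightarrow> state \<Rightarrow> state \<Rightarrow> bool" where
  whole: "\<not> split_at z \<Longrightarrow> add z Whole (z, Whole) (z + 1, Whole)"
| first: "split_at z \<Longrightarrow> s \<noteq> Whole \<Longrightarrow> add z s (z, Whole) (z, s)"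
| second: "split_at z \<Longrightarrow> s \<noteq> Whole \<Longrightarrow> add z s (z, other s) (z + 1, Whole)"

definition step :: "nat \<Rightarrow> nat \<Rightarrow> state \<Rightarrow> state \<Rightarrow> bool" where
  "step k i a a' \<longleftrightarrow> (\<exists>z s. add z s a a' \<and> colour_at k z s = i)"

text \<open>The numbers of pluses and minuses that the column would contribute to the \<open>i\<close>-signature if it
  had no neighbours.\<close>

fun phi :: "nat \<Rightarrow> nat \<Rightarrow> state \<Rightarrow> nat" where
  "phi k i (z, h) = (if h = Whole then above (lev k) i z else of_bool (colour_at k z (other h) = i))"

fun eps :: "nat \<Rightarrow> nat \<Rightarrow> state \<Rightarrow> nat" where
  "eps k i (z, h) = (if h = Whole then below (lev k) i z else of_bool (colour_at k z h = i))"

lemma split_levE: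
  assumes "split_at z"
  obtains b f where "lev k z = Split b f" "b \<noteq> f" "lev (Suc k) z = Split f b"
proof -
  have "is_split (lev k z)" using assms by simp
  then obtain b f where "lev k z = Split b f" by (cases "lev k z") auto
  then show ?thesis using that split_distinct neighbour[of k z] by auto
qed

lemma split_not_half: "split_at z \<Longrightarrow> \<not> half_at z"
  unfolding split_at_def half_at_def by (cases "lev 0 z") auto

lemma nonsplit_levE:
  assumes "\<not> split_at z"
  obtains (cube) c where "lev k z = Cube c" "lev (Suc k) z = Cube c" "\<not> half_at z"
  | (half) c where "lev k z = Half_Height c" "lev (Suc k) z = Half_Height c" "half_at z"
proof -
  have "\<not> is_split (lev k z)" using assms by simp
  then show ?thesis
    using that neighbour[of k z] is_half_lev[of k z] by (cases "lev k z") auto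
qed

lemma step_cases [consumes 1, case_names cube lower upper first second]:
  assumes "step k i a a'"
  obtains (cube) z where "a = (z, Whole)" "a' = (z + 1, Whole)" "lev k z = Cube i" "\<not> half_at z" "\<not> split_at z"
  | (lower) z where "a = (z, Whole)" "a' = (z + 1, Whole)" "lev k z = Half_Height i"
      "lev k (z + 1) = Half_Height i" "half_at z" "half_at (z + 1)" "\<not> half_at (z - 1)" "\<not> half_at (z + 2)" "\<not> split_at z"
  | (upper) z where "a = (z, Whole)" "a' = (z + 1, Whole)" "lev k z = Half_Height i"
      "lev k (z - 1) = Half_Height i" "half_at z" "half_at (z - 1)" "\<not> half_at (z + 1)" "\<not> half_at (z - 2)" "\<not> split_at z"
  | (first) z s b f where "a = (z, Whole)" "a' = (z, s)" "split_at z" "s \<noteq> Whole" "lev k z = Split b f" "b \<noteq> f"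
      "colour_at k z s = i" "\<not> half_at z" "i \<in> {b, f}"
  | (second) z s b f where "a = (z, other s)" "a' = (z + 1, Whole)" "split_at z" "s \<noteq> Whole"
      "lev k z = Split b f" "b \<noteq> f" "colour_at k z s = i" "\<not> half_at z" "i \<in> {b, f}"
proof -
  obtain z s where zs: "add z s a a'" "colour_at k z s = i" using assms by (auto simp: step_def)
  from zs(1) show ?thesis
  proof cases
    case whole
    show ?thesis
    proof (cases rule: nonsplit_levE[OF whole(4), of k])
      case (1 c)
      then show ?thesis using that(1)[of z] whole zs by (simp add: colour_at_def)
    next
      case (2 c)
      then have i: "c = i" using zs by (simp add: colour_at_def)
      from half_pairs[OF 2(1)] show ?thesis
      proof
        assume *: "lev k (z - 1) = Half_Height c \<and> \<not> is_half (lev k (z + 1))"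
        then have "half_at (z - 1)" using is_half_lev[of k "z - 1"] by simp
        moreover have "\<not> half_at (z - 2)" using half_pairs[of k "z - 1" c] * 2 by simp
        ultimately show ?thesis using that(3)[of z] whole 2 i * by simp
      next
        assume *: "\<not> is_half (lev k (z - 1)) \<and> lev k (z + 1) = Half_Height c"
        then have "half_at (z + 1)" using is_half_lev[of k "z + 1"] by simp
        moreover have "\<not> half_at (z + 2)" using half_pairs[of k "z + 1" c] * 2 by (simp add: add.assoc)
        ultimately show ?thesis using that(2)[of z] whole 2 i * by simp
      qed
    qed
  next
    case first
    then have "split_at z" by simp
    then obtain b f where bf: "lev k z = Split b f" "b \<noteq> f" by (rule split_levE[of z k])
    then have "i \<in> {b, f}" using zs by (auto simp: colour_at_def split: if_splits)
    then show ?thesis by (intro that(4)[of z s b f]) (use first bf zs split_not_half in simp_all)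
  next
    case second
    then have "split_at z" by simp
    then obtain b f where bf: "lev k z = Split b f" "b \<noteq> f" by (rule split_levE[of z k])
    then have "i \<in> {b, f}" using zs by (auto simp: colour_at_def split: if_splits)
    then show ?thesis by (intro that(5)[of z s b f]) (use second bf zs split_not_half in simp_all)
  qed
qed

lemma mult_clr: "s \<in> parts_at z \<Longrightarrow> mult (colour_at k z s) (lev k z) > 0"
  using is_split_lev[of k z]
  by (cases "lev k z") (auto simp: colour_at_def parts_at_def simp del: is_split_lev split: if_splits)

lemma colour_at_le: "s \<in> parts_at z \<Longrightarrow> colour_at k z s \<le> n"
  using mult_clr colours by blast

lemma add_pts: "add z s a a' \<Longrightarrow> s \<in> parts_at z"
  by (erule add.cases) (metis insertCI part.exhaust parts_at_def)+

lemma step_le: "step k i a a' \<Longrightarrow> i \<le> n"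
  unfolding step_def using add_pts colour_at_le by blast

lemma part_other: "s \<noteq> Whole \<Longrightarrow> s = Back \<or> s = Front"
  by (cases s) auto

text \<open>A block of colour \<open>i\<close> has no further \<open>i\<close>-block above or below it, except for the other one
  of a pair of half-height blocks: the diagonal entry $a_{ii} = 2$ is used up by the block itself.\<close>

lemma step_phi_eps:
  assumes "step k i a a'"
  shows "phi k i a = Suc (phi k i a')" "eps k i a' = Suc (eps k i a)"
proof -
  have i: "i \<le> n" using step_le[OF assms] .
  note d = diagonal[OF i]
  have "phi k i a = Suc (phi k i a') \<and> eps k i a' = Suc (eps k i a)"
    using assms
  proof (cases rule: step_cases)
    case (cube z)
    have "below (lev k) i z = 0" "above (lev k) i (z + 1) = 0"
      using cartan_cube[OF cube(3) i] d by auto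
    then show ?thesis using cube by (simp add: above_def[of _ _ z] below_def[of _ _ "z + 1"])
  next
    case (lower z)
    have "\<not> half_at (z + 1 + 1)" using lower by (simp add: add.assoc)
    moreover have "below (lev k) i z = 0" using cartan_lower[OF lower(3) _ i] d lower by auto
    ultimately show ?thesis using lower by (simp add: above_def below_def[of _ _ "z + 1"])
  next
    case (upper z)
    have "above (lev k) i (z + 1) = 0" using cartan_upper[OF upper(3) _ i] d upper by auto
    then show ?thesis using upper by (simp add: above_def[of _ _ z] below_def)
  next
    case (first z s b f)
    have "below (lev k) i z = 0" using cartan_split[OF first(5) first(9) i] d by auto
    then show ?thesis using first part_other[OF first(4)]
      by (elim disjE) (auto simp: above_def colour_at_def)
  next
    case (second z s b f)
    have "above (lev k) i (z + 1) = 0" using cartan_split[OF second(5) second(9) i] d by auto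
    then show ?thesis using second part_other[OF second(4)]
      by (elim disjE) (auto simp: below_def colour_at_def)
  qed
  then show "phi k i a = Suc (phi k i a')" "eps k i a' = Suc (eps k i a)" by auto
qed

lemma phi_step:
  assumes "valid a" "phi k i a > 0"
  shows "\<exists>a'. step k i a a' \<and> valid a'"
proof -
  obtain z h where a: "a = (z, h)" by force
  show ?thesis
  proof (cases "split_at z")
    case True
    then obtain b f where bf: "lev k z = Split b f" using split_levE by metis
    show ?thesis
    proof (cases h)
      case Whole
      then have "i = colour_at k z Back \<or> i = colour_at k z Front" using assms bf a
        by (auto simp: above_def colour_at_def split: if_splits)
      then show ?thesis
      proof
        assume "i = colour_at k z Back"
        then have "step k i a (z, Back)" using True a Whole first[of z Back] by (auto simp: step_def)
        then show ?thesis using True by (auto simp: valid_def)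
      next
        assume "i = colour_at k z Front"
        then have "step k i a (z, Front)" using True a Whole first[of z Front] by (auto simp: step_def)
        then show ?thesis using True by (auto simp: valid_def)
      qed
    next
      case Back
      then have "step k i a (z + 1, Whole)" using assms True a second[of z Front]
        by (auto simp: step_def split: if_splits)
      then show ?thesis by (auto simp: valid_def)
    next
      case Front
      then have "step k i a (z + 1, Whole)" using assms True a second[of z Back]
        by (auto simp: step_def split: if_splits)
      then show ?thesis by (auto simp: valid_def)
    qed
  next
    case False
    then have h: "h = Whole" using assms a by (auto simp: valid_def)
    then have "mult i (lev k z) > 0" using assms a by (auto simp: above_def split: if_splits)
    then have "colour_at k z Whole = i"
      by (cases rule: nonsplit_levE[OF False, of k]) (auto simp: colour_at_def split: if_splits)
    then have "step k i a (z + 1, Whole)" using whole[OF False] a h by (auto simp: step_def)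
    then show ?thesis by (auto simp: valid_def)
  qed
qed

lemma eps_step:
  assumes "valid a" "eps k i a > 0"
  shows "\<exists>a'. step k i a' a \<and> valid a'"
proof -
  obtain z h where a: "a = (z, h)" by force
  show ?thesis
  proof (cases "h = Whole")
    case False
    then have "split_at z" using assms a by (auto simp: valid_def)
    then have "step k i (z, Whole) a" using first[of z h] False assms a
      by (auto simp: step_def split: if_splits)
    then show ?thesis by (auto simp: valid_def)
  next
    case True
    then have m: "mult i (lev k (z - 1)) > 0" using assms a by (auto simp: below_def split: if_splits)
    show ?thesis
    proof (cases "split_at (z - 1)")
      case False
      then have "colour_at k (z - 1) Whole = i"
        using m by (cases rule: nonsplit_levE[OF False, of k]) (auto simp: colour_at_def split: if_splits)
      then have "step k i (z - 1, Whole) a" using whole[OF False] a True by (auto simp: step_def)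
      then show ?thesis by (auto simp: valid_def)
    next
      case s: True
      then obtain b f where bf: "lev k (z - 1) = Split b f" using split_levE by metis
      then have "i = colour_at k (z - 1) Back \<or> i = colour_at k (z - 1) Front" using m
        by (auto simp: colour_at_def split: if_splits)
      then show ?thesis
      proof
        assume "i = colour_at k (z - 1) Back"
        then have "step k i (z - 1, Front) a" using s a True second[of "z - 1" Back]
          by (auto simp: step_def)
        then show ?thesis using s by (auto simp: valid_def)
      next
        assume "i = colour_at k (z - 1) Front"
        then have "step k i (z - 1, Back) a" using s a True second[of "z - 1" Front]
          by (auto simp: step_def)
        then show ?thesis using s by (auto simp: valid_def)
      qed
    qed
  qed
qed

lemma step_pos: "step k i a a' \<Longrightarrow> phi k i a > 0 \<and> eps k i a' > 0"
  using step_phi_eps by simp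

lemma step_unique_right: "step k i a a' \<Longrightarrow> step k i a a'' \<Longrightarrow> a' = a''"
  by (elim step_cases) (auto simp: colour_at_def dest!: part_other)

lemma step_unique_left: "step k i a' a \<Longrightarrow> step k i a'' a \<Longrightarrow> a' = a''"
  by (elim step_cases) (auto simp: colour_at_def dest!: part_other)

lemma phi_eps_le_2: "valid a \<Longrightarrow> phi k i a + eps k i a \<le> 2"
proof -
  assume v: "valid a"
  show ?thesis
  proof (cases "phi k i a = 0")
    case True
    obtain z h where a: "a = (z, h)" by force
    have "mult i (lev k (z - 1)) \<le> 1"
      using split_distinct[of k "z - 1"] by (cases "lev k (z - 1)") auto
    moreover have "mult i (lev k (z - 1)) = 0 \<or> mult i (lev k (z - 1)) = 1" using calculation by linarith
    ultimately show ?thesis using True a by (auto simp: below_def)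
  next
    case False
    then obtain a' where s: "step k i a a'" using phi_step v by blast
    note d = diagonal[OF step_le[OF s]] and i = step_le[OF s]
    from s show ?thesis
    proof (cases rule: step_cases)
      case (cube z)
      have "below (lev k) i z = 0" using cartan_cube[OF cube(3) i] d by auto
      then show ?thesis using cube by (simp add: above_def)
    next
      case (lower z)
      have "below (lev k) i z = 0" using cartan_lower[OF lower(3) _ i] d lower by auto
      then show ?thesis using lower by (simp add: above_def)
    next
      case (upper z)
      then show ?thesis by (simp add: above_def below_def)
    next
      case (first z s b f)
      then have "below (lev k) i z = 0" using cartan_split[OF first(5) first(9) i] d by auto
      moreover have "mult i (lev k z) = 1" using first by auto
      ultimately show ?thesis using first(1,8) by (simp add: above_def)
    next
      case (second z s b f)
      then show ?thesis using part_other[OF second(4)] by (elim disjE) (auto simp: colour_at_def)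
    qed
  qed
qed

text \<open>Each of the assumptions on the Cartan matrix is this statement for one kind of level.\<close>

lemma step_weight:
  assumes "step k j a a'" "i \<le> n"
  shows "int (phi k i a) - int (eps k i a) = int (phi k i a') - int (eps k i a') + A i j"
  using assms(1)
proof (cases rule: step_cases)
  case (cube z)
  then show ?thesis using cartan_cube[OF cube(3) assms(2)] by (simp add: above_def[of _ _ z] below_def[of _ _ "z + 1"])
next
  case (lower z)
  have "\<not> half_at (z + 1 + 1)" using lower by (simp add: add.assoc)
  then show ?thesis using cartan_lower[OF lower(3) _ assms(2)] lower 
    by (simp add: above_def below_def[of _ _ "z + 1"])
next
  case (upper z)
  then show ?thesis using cartan_upper[OF upper(3) _ assms(2)] 
    by (simp add: above_def[of _ _ z] below_def)
next
  case (first z s b f)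
  then show ?thesis using part_other[OF first(4)] cartan_split[OF first(5,9) assms(2)]
    by (auto simp: above_def[of _ _ z] colour_at_def)
next
  case (second z s b f)
  then show ?thesis using part_other[OF second(4)] cartan_split[OF second(5,9) assms(2)]
    by (auto simp: below_def[of _ _ "z + 1"] colour_at_def)
qed

lemma le_refl [simp]: "le a a" by (simp add: le_def)

lemma le_trans: "le a b \<Longrightarrow> le b c \<Longrightarrow> le a c"
  by (auto simp: le_def)

lemma le_antisym: "le a b \<Longrightarrow> le b a \<Longrightarrow> a = b"
  by (cases a; cases b) (auto simp: le_def)

lemma fits_le: "fits a b \<Longrightarrow> le a b" by (simp add: fits_def)

lemma le_R: "le a b \<Longrightarrow> fits b c \<Longrightarrow> fits a c"
  using le_trans le_antisym by (metis fits_def)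

lemma fits_le_trans: "fits a b \<Longrightarrow> le b c \<Longrightarrow> fits a c"
  using le_trans le_antisym by (metis fits_def)

lemma add_le: "add z s a a' \<Longrightarrow> le a a'"
  by (induction rule: add.induct) (auto simp: le_def)

lemma step_imp_le: "step k i a a' \<Longrightarrow> le a a'"
  by (auto simp: step_def add_le)

text \<open>The relation between neighbouring columns is stable under the tensor product rule for two
  factors. A block on the left column \<open>a\<close> can violate it in two ways only: the block lies outside
  \<open>b\<close>, or it makes \<open>a\<close> a full column equal to \<open>b\<close>. In both cases \<open>b\<close> has a block of the same colour at
  its top: at a split level the colours of the two columns are interchanged, so the
  missing half of \<open>a\<close> has the colour of the other half of \<open>b\<close>. Therefore the plus of \<open>a\<close> is cancelled
  by a minus of \<open>b\<close>, and the rule does not let the operator act on \<open>a\<close>. Taking a block off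
  the right column is dual.\<close>

lemma fits_step_left:
  assumes "fits a b" "valid b" "step (Suc k) i a a'" "phi (Suc k) i a > eps k i b"
  shows "fits a' b"
proof (rule ccontr)
  assume nR: "\<not> fits a' b"
  obtain y h where b: "b = (y, h)" by force
  note simps = fits_def le_def full_def mid_def b
  from assms(3) show False
  proof (cases rule: step_cases)
    case (cube z)
    then have "lev k z = Cube i" using neighbour[of k z] by (cases "lev k z") auto
    moreover have "y = z + 1 \<and> h = Whole" using nR assms(1,2) cube
      by (auto simp: simps valid_def)
    ultimately show False using assms(4) cube b by (simp add: above_def below_def)
  next
    case (lower z)
    show False using nR assms(1,2) lower by (auto simp: simps valid_def)
  next
    case (upper z)
    then have "lev k z = Half_Height i" "lev k (z - 1) = Half_Height i"
      using neighbour[of k z] neighbour[of k "z - 1"] by (cases "lev k z"; cases "lev k (z - 1)"; simp)+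
    moreover have "(y = z \<or> y = z + 1) \<and> h = Whole" using nR assms(1,2) upper
      by (auto simp: simps valid_def)
    ultimately show False using assms(4) upper b by (auto simp: above_def below_def)
  next
    case (first z s bb f)
    then have l: "lev k z = Split f bb" using neighbour[of k z] by (cases "lev k z") auto
    note \<open>\<not> half_at z\<close>
    then have "y = z \<and> h = other s" using nR assms(1,2) first
      by (cases h; cases s; auto simp: simps valid_def)
    then show False using assms(4) first b l \<open>\<not> half_at z\<close> part_other[OF first(4)]
      by (elim disjE) (auto simp: above_def colour_at_def)
  next
    case (second z s bb f)
    then have l: "lev k z = Split f bb" using neighbour[of k z] by (cases "lev k z") auto
    note \<open>\<not> half_at z\<close>
    have "y = z \<and> h = other s \<or> y = z + 1 \<and> h = Whole" using nR assms(1,2) second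
      by (cases h; cases s; auto simp: simps valid_def)
    then show False using assms(4) second b l \<open>\<not> half_at z\<close> part_other[OF second(4)]
      by (elim disjE) (auto simp: below_def colour_at_def)
  qed
qed

lemma fits_step_right:
  assumes "fits a b" "valid a" "step k i b' b" "eps k i b > phi (Suc k) i a"
  shows "fits a b'"
proof (rule ccontr)
  assume nR: "\<not> fits a b'"
  obtain y h where a: "a = (y, h)" by force
  note simps = fits_def le_def full_def mid_def a
  from assms(3) show False
  proof (cases rule: step_cases)
    case (cube z)
    then have "lev (Suc k) z = Cube i" using neighbour[of k z] by auto
    moreover have "y = z \<and> h = Whole" using nR assms(1,2) cube
      by (auto simp: simps valid_def)
    ultimately show False using assms(4) cube a by (simp add: above_def below_def)
  next
    case (lower z)
    then have "lev (Suc k) z = Half_Height i" "lev (Suc k) (z + 1) = Half_Height i"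
      using neighbour[of k z] neighbour[of k "z + 1"] by auto
    moreover have "(y = z \<or> y = z + 1) \<and> h = Whole" using nR assms(1,2) lower
      by (auto simp: simps valid_def)
    moreover have "\<not> half_at (z + 1 + 1)" using lower by (simp add: add.assoc)
    ultimately show False using assms(4) lower a by (auto simp: above_def below_def)
  next
    case (upper z)
    show False using nR assms(1,2) upper by (auto simp: simps valid_def)
  next
    case (first z s bb f)
    then have l: "lev (Suc k) z = Split f bb" using neighbour[of k z] by auto
    note \<open>\<not> half_at z\<close>
    then have "y = z \<and> (h = Whole \<or> h = s)" using nR assms(1,2) first
      by (cases h; cases s; auto simp: simps valid_def)
    then show False using assms(4) first a l \<open>\<not> half_at z\<close> part_other[OF first(4)]
      by (elim disjE) (auto simp: above_def colour_at_def)
  next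
    case (second z s bb f)
    then have l: "lev (Suc k) z = Split f bb" using neighbour[of k z] by auto
    note \<open>\<not> half_at z\<close>
    then have "\<not> (y = z + 1 \<and> h \<noteq> Whole)" using assms(1,2) second
      by (auto simp: simps)
    then have "y = z \<and> h = s \<or> y = z + 1 \<and> h = Whole" using nR assms(1,2) second
      by (cases h; cases s; auto simp: simps valid_def)
    then have "y = z \<and> h = s" using assms(1) second \<open>\<not> half_at z\<close> by (auto simp: simps)
    then show False using assms(4) second a l \<open>\<not> half_at z\<close> part_other[OF second(4)]
      by (elim disjE) (auto simp: below_def colour_at_def)
  qed
qed

text \<open>In the patterns of the affine types, one period consists of the blocks of one
  $\delta$-column, so this removes a $\delta$ from the top of a column. The pattern around the top
  stays the same.\<close>

definition lower :: "state \<Rightarrow> state" where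
  "lower a = (fst a - period, snd a)"

lemma colour_at_lower [simp]: "colour_at k (z - period) s = colour_at k z s"
  by (simp add: colour_at_def periodic)

lemma split_at_lower [simp]: "split_at (z - period) = split_at z"
  unfolding split_at_def periodic ..

lemma eps_lower [simp]: "eps k i (lower a) = eps k i a"
proof (cases a)
  case (Pair z h)
  have "lev k (z - period - 1) = lev k (z - 1)" "lev k (z - period - 2) = lev k (z - 2)"
    using periodic[of k "z - 1"] periodic[of k "z - 2"] by (simp_all add: algebra_simps)
  then show ?thesis using Pair by (simp add: lower_def below_def del: is_half_lev)
qed

lemma add_lower: "add z s a a' \<Longrightarrow> add (z - period) s (lower a) (lower a')"
proof (induction rule: add.induct)
  case (whole z)
  then show ?case using add.whole[of "z - period"] by (simp add: lower_def algebra_simps)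
next
  case (first z s)
  then show ?case using add.first[of "z - period"] by (simp add: lower_def)
next
  case (second z s)
  then show ?case using add.second[of "z - period" s] by (simp add: lower_def algebra_simps)
qed

lemma step_lower: "step k i a a' \<Longrightarrow> step k i (lower a) (lower a')"
  by (metis step_def add_lower colour_at_lower)

lemma valid_lower [simp]: "valid (lower a) = valid a"
  by (simp add: valid_def lower_def)

lemma lower_le: "le (lower a) a"
  using period_pos by (simp add: le_def lower_def)

lemma add_valid: "add z s a a' \<Longrightarrow> valid a \<and> valid a'"
  by (induction rule: add.induct) (auto simp: valid_def)

lemma step_valid: "step k i a a' \<Longrightarrow> valid a \<and> valid a'"
  by (auto simp: step_def dest: add_valid)

section \<open>Blocked signs of neighbouring columns\<close>

text \<open>The length, at most 2, of the string of blocks of colour \<open>i\<close> that can be put on, or taken off,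
  one after the other such that all intermediate states satisfy \<open>Q\<close>. With the condition imposed by the
  neighbour for \<open>Q\<close>, these are the numbers of signs of a column of a wall.\<close>

definition pcount :: "nat \<Rightarrow> nat \<Rightarrow> (state \<Rightarrow> bool) \<Rightarrow> state \<Rightarrow> nat" where
  "pcount k i Q a =
     (if \<exists>a'. step k i a a' \<and> Q a' then
        (if \<exists>a' a''. step k i a a' \<and> Q a' \<and> step k i a' a'' \<and> Q a'' then 2 else 1) else 0)"

definition mcount :: "nat \<Rightarrow> nat \<Rightarrow> (state \<Rightarrow> bool) \<Rightarrow> state \<Rightarrow> nat" where
  "mcount k i Q a =
     (if \<exists>a'. step k i a' a \<and> Q a' then
        (if \<exists>a' a''. step k i a' a \<and> Q a' \<and> step k i a'' a' \<and> Q a'' then 2 else 1) else 0)"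

lemma phi_cases:
  assumes "valid a"
  obtains (0) "phi k i a = 0" "\<And>Q. pcount k i Q a = 0"
  | (1) a1 where "phi k i a = 1" "step k i a a1" "phi k i a1 = 0" "\<And>Q. pcount k i Q a = of_bool (Q a1)"
  | (2) a1 a2 where "phi k i a = 2" "step k i a a1" "step k i a1 a2" "phi k i a1 = 1" "phi k i a2 = 0"
      "\<And>Q. pcount k i Q a = (if Q a1 then if Q a2 then 2 else 1 else 0)"
proof -
  have "phi k i a \<le> 2" using phi_eps_le_2[OF assms, of k i] by simp
  then consider "phi k i a = 0" | "phi k i a = 1" | "phi k i a = 2" by linarith
  then show ?thesis
  proof cases
    case 1
    then have "\<not> step k i a a'" for a' using step_pos[of k i a a'] 1 by auto
    then have "pcount k i Q a = 0" for Q by (simp add: pcount_def)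
    then show ?thesis by (rule that(1)[OF 1])
  next
    case 2
    then obtain a1 where a1: "step k i a a1" using phi_step[OF assms, of k i] by auto
    have p1: "phi k i a1 = 0" using step_phi_eps[OF a1] 2 by simp
    have "pcount k i Q a = of_bool (Q a1)" for Q
    proof -
      have "(\<exists>a'. step k i a a' \<and> Q a') = Q a1" using step_unique_right[OF a1] a1 by blast
      moreover have "\<not> (\<exists>a' a''. step k i a a' \<and> Q a' \<and> step k i a' a'' \<and> Q a'')"
        using step_unique_right[OF a1] step_pos[of k i a1] p1 by (metis less_irrefl)
      ultimately show ?thesis by (simp only: pcount_def if_False of_bool_def)
    qed
    then show ?thesis by (rule that(2)[OF 2 a1 p1])
  next
    case 3
    then obtain a1 where a1: "step k i a a1" "valid a1" using phi_step[OF assms, of k i] by auto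
    have p1: "phi k i a1 = 1" using step_phi_eps[OF a1(1)] 3 by simp
    then obtain a2 where a2: "step k i a1 a2" "valid a2" using phi_step[OF a1(2), of k i] by auto
    have p2: "phi k i a2 = 0" using step_phi_eps[OF a2(1)] p1 by simp
    have "pcount k i Q a = (if Q a1 then if Q a2 then 2 else 1 else 0)" for Q
    proof -
      have "(\<exists>a'. step k i a a' \<and> Q a') = Q a1" using step_unique_right[OF a1(1)] a1 by blast
      moreover have "(\<exists>a' a''. step k i a a' \<and> Q a' \<and> step k i a' a'' \<and> Q a'') = (Q a1 \<and> Q a2)"
        using step_unique_right[OF a1(1)] step_unique_right[OF a2(1)] a1 a2 by blast
      ultimately show ?thesis by (simp add: pcount_def)
    qed
    then show ?thesis by (rule that(3)[OF 3 a1(1) a2(1) p1 p2])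
  qed
qed

lemma eps_cases:
  assumes "valid a"
  obtains (0) "eps k i a = 0" "\<And>Q. mcount k i Q a = 0"
  | (1) a1 where "eps k i a = 1" "step k i a1 a" "eps k i a1 = 0" "\<And>Q. mcount k i Q a = of_bool (Q a1)"
  | (2) a1 a2 where "eps k i a = 2" "step k i a1 a" "step k i a2 a1" "eps k i a1 = 1" "eps k i a2 = 0"
      "\<And>Q. mcount k i Q a = (if Q a1 then if Q a2 then 2 else 1 else 0)"
proof -
  have "eps k i a \<le> 2" using phi_eps_le_2[OF assms, of k i] by simp
  then consider "eps k i a = 0" | "eps k i a = 1" | "eps k i a = 2" by linarith
  then show ?thesis
  proof cases
    case 1
    then have "\<not> step k i a' a" for a' using step_pos[of k i a' a] 1 by auto
    then have "mcount k i Q a = 0" for Q by (simp add: mcount_def)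
    then show ?thesis by (rule that(1)[OF 1])
  next
    case 2
    then obtain a1 where a1: "step k i a1 a" using eps_step[OF assms, of k i] by auto
    have p1: "eps k i a1 = 0" using step_phi_eps[OF a1] 2 by simp
    have "mcount k i Q a = of_bool (Q a1)" for Q
    proof -
      have "(\<exists>a'. step k i a' a \<and> Q a') = Q a1" using step_unique_left[OF a1] a1 by blast
      moreover have "\<not> (\<exists>a' a''. step k i a' a \<and> Q a' \<and> step k i a'' a' \<and> Q a'')"
        using step_unique_left[OF a1] step_pos[of k i _ a1] p1 by (metis less_irrefl)
      ultimately show ?thesis by (simp only: mcount_def if_False of_bool_def)
    qed
    then show ?thesis by (rule that(2)[OF 2 a1 p1])
  next
    case 3
    then obtain a1 where a1: "step k i a1 a" "valid a1" using eps_step[OF assms, of k i] by auto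
    have p1: "eps k i a1 = 1" using step_phi_eps[OF a1(1)] 3 by simp
    then obtain a2 where a2: "step k i a2 a1" "valid a2" using eps_step[OF a1(2), of k i] by auto
    have p2: "eps k i a2 = 0" using step_phi_eps[OF a2(1)] p1 by simp
    have "mcount k i Q a = (if Q a1 then if Q a2 then 2 else 1 else 0)" for Q
    proof -
      have "(\<exists>a'. step k i a' a \<and> Q a') = Q a1" using step_unique_left[OF a1(1)] a1 by blast
      moreover have "(\<exists>a' a''. step k i a' a \<and> Q a' \<and> step k i a'' a' \<and> Q a'') = (Q a1 \<and> Q a2)"
        using step_unique_left[OF a1(1)] step_unique_left[OF a2(1)] a1 a2 by blast
      ultimately show ?thesis by (simp add: mcount_def)
    qed
    then show ?thesis by (rule that(3)[OF 3 a1(1) a2(1) p1 p2])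
  qed
qed

text \<open>In a wall the neighbour may block some of the signs. Equally many pluses of the left column
  and minuses of the right one are blocked. Write $f$ and $e$ for adding and removing an
  $i$-block. If $\varphi_i(a) = \varepsilon_i(b)$, then the tensor product rule leads from the pair
  $(a, e b)$ to $(f a, e b)$ and from there to $(f a, b)$. As both rules preserve the relation
  \<open>fits\<close>, $e$ may be applied to $b$ if and only if $f$ may be applied to $a$. If
  $\varphi_i(a) \neq \varepsilon_i(b)$, then the rule never blocks the surplus on the larger side.\<close>

lemma blocked_pairs:
  assumes "fits a b" "valid a" "valid b"
  shows "pcount (Suc k) i (\<lambda>x. fits x b) a \<le> phi (Suc k) i a"
    and "phi (Suc k) i a + mcount k i (fits a) b = eps k i b + pcount (Suc k) i (\<lambda>x. fits x b) a"
proof -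
  have L: "fits a' y" if "fits x y" "valid y" "step (Suc k) i x a'" "phi (Suc k) i x > eps k i y" for x y a'
    using fits_step_left that by blast
  have Rr: "fits x b'" if "fits x y" "valid x" "step k i b' y" "eps k i y > phi (Suc k) i x" for x y b'
    using fits_step_right that by blast
  have mr: "fits x y \<Longrightarrow> step k i y y' \<Longrightarrow> fits x y'" for x y y'
    using fits_le_trans step_imp_le by blast
  have ml: "fits x' y \<Longrightarrow> step (Suc k) i x x' \<Longrightarrow> fits x y" for x x' y
    using le_R step_imp_le by blast
  have "pcount (Suc k) i (\<lambda>x. fits x b) a \<le> phi (Suc k) i a \<and>
    phi (Suc k) i a + mcount k i (fits a) b = eps k i b + pcount (Suc k) i (\<lambda>x. fits x b) a"
  proof (cases rule: phi_cases[OF assms(2), of "Suc k" i])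
    case p: 1
    note pq = p(1) p(2)[of "\<lambda>x. fits x b"]
    show ?thesis
    proof (cases rule: eps_cases[OF assms(3), of k i])
      case 1 show ?thesis using pq 1(1) 1(2)[of "fits a"] by simp
    next
      case (2 b1) show ?thesis using pq 2(1) 2(4)[of "fits a"] Rr[OF assms(1,2) 2(2)] by simp
    next
      case (3 b1 b2)
      then have "fits a b1" using pq 3(1) Rr[OF assms(1,2) 3(2)] by simp
      then have "fits a b2" using 3(1-5) pq Rr[OF _ assms(2) 3(3)] by simp
      then show ?thesis using pq 3(1) 3(6)[of "fits a"] \<open>fits a b1\<close> by simp
    qed
  next
    case p: (2 a1)
    note pq = p(1) p(4)[of "\<lambda>x. fits x b"]
    note va1 = step_valid[OF p(2), THEN conjunct2]
    show ?thesis
    proof (cases rule: eps_cases[OF assms(3), of k i])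
      case 1 show ?thesis using pq 1(1) 1(2)[of "fits a"] L[OF assms(1,3) p(2)] by simp
    next
      case (2 b1)
      note vb1 = step_valid[OF 2(2), THEN conjunct1]
      have lt: "eps k i b1 < phi (Suc k) i a" "phi (Suc k) i a1 < eps k i b"
        using p(1-3) 2(1-3) by simp_all
      have "fits a1 b = fits a b1"
        using L[of a b1 a1] Rr[of a1 b b1] vb1 va1 p(2) 2(2) lt ml[of a1 b1 a] mr[of a1 b1 b] by argo
      then show ?thesis using pq 2(1) 2(4)[of "fits a"] by (cases "fits a b1") auto
    next
      case (3 b1 b2)
      note vb1 = step_valid[OF 3(2), THEN conjunct1] and vb2 = step_valid[OF 3(3), THEN conjunct1]
      have 1: "fits a b1" using Rr[OF assms(1,2) 3(2)] p(1) 3(1) by simp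
      have lt: "eps k i b2 < phi (Suc k) i a" "phi (Suc k) i a1 < eps k i b" "phi (Suc k) i a1 < eps k i b1"
        using p(1-3) 3(1-5) by simp_all
      have "fits a1 b = fits a b2"
        using L[of a b2 a1] Rr[of a1 b b1] Rr[of a1 b1 b2] vb2 va1 p(2) 3(2,3) lt
          ml[of a1 b2 a] mr[of a1 b1 b] mr[of a1 b2 b1] by argo
      then show ?thesis using pq 3(1) 3(6)[of "fits a"] 1 by (cases "fits a b2") auto
    qed
  next
    case p: (3 a1 a2)
    note pq = p(1) p(6)[of "\<lambda>x. fits x b"]
    note va1 = step_valid[OF p(2), THEN conjunct2] and va2 = step_valid[OF p(3), THEN conjunct2]
    show ?thesis
    proof (cases rule: eps_cases[OF assms(3), of k i])
      case 1
      then have "fits a1 b" using L[OF assms(1,3) p(2)] p(1) 1(1) by simp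
      then show ?thesis using L[OF _ assms(3) p(3)] pq p(4) 1(1) 1(2)[of "fits a"] by simp
    next
      case (2 b1)
      note vb1 = step_valid[OF 2(2), THEN conjunct1]
      have 1: "fits a1 b" using L[OF assms(1,3) p(2)] p(1) 2(1) by simp
      have lt: "eps k i b1 < phi (Suc k) i a" "eps k i b1 < phi (Suc k) i a1" "phi (Suc k) i a2 < eps k i b"
        using p(1-5) 2(1-3) by simp_all
      have "fits a2 b = fits a b1"
        using L[of a b1 a1] L[of a1 b1 a2] Rr[of a2 b b1] vb1 va2 p(2,3) 2(2) lt
          ml[of a1 b1 a] ml[of a2 b1 a1] mr[of a2 b1 b] by argo
      then show ?thesis using pq 2(1) 2(4)[of "fits a"] 1 by (cases "fits a b1") auto
    next
      case (3 b1 b2)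
      note vb1 = step_valid[OF 3(2), THEN conjunct1] and vb2 = step_valid[OF 3(3), THEN conjunct1]
      have lt: "eps k i b1 < phi (Suc k) i a" "phi (Suc k) i a1 < eps k i b"
        using p(1-5) 3(1-5) by simp_all
      have 1: "fits a1 b = fits a b1"
        using L[of a b1 a1] Rr[of a1 b b1] vb1 va1 p(2) 3(2) lt ml[of a1 b1 a] mr[of a1 b1 b] by argo
      have lt: "eps k i b2 < phi (Suc k) i a" "eps k i b2 < phi (Suc k) i a1" "phi (Suc k) i a2 < eps k i b" "phi (Suc k) i a2 < eps k i b1"
        using p(1-5) 3(1-5) by simp_all
      have "fits a2 b = fits a b2"
        using L[of a b2 a1] L[of a1 b2 a2] Rr[of a2 b b1] Rr[of a2 b1 b2] vb2 va2 p(2,3) 3(2,3) lt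
          ml[of a1 b2 a] ml[of a2 b2 a1] mr[of a2 b1 b] mr[of a2 b2 b1] by argo
      moreover have "fits a b2 \<Longrightarrow> fits a b1" using mr[OF _ 3(3)] by blast
      ultimately show ?thesis using pq 3(1) 3(6)[of "fits a"] 1 by (cases "fits a b1"; cases "fits a b2") auto
    qed
  qed
  then show "pcount (Suc k) i (\<lambda>x. fits x b) a \<le> phi (Suc k) i a"
    and "phi (Suc k) i a + mcount k i (fits a) b = eps k i b + pcount (Suc k) i (\<lambda>x. fits x b) a"
    by auto
qed

end

section \<open>Walls as sequences of column states\<close>

context column_pattern
begin

lemma half_lev: "lev k z = Half_Height c \<Longrightarrow> half_at z"
  by (metis is_half_lev is_half.simps(1))

lemma parts_at_nonempty: "\<exists>s. s \<in> parts_at z"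
  by (auto simp: parts_at_def)

lemma le_iff_filled:
  assumes "valid a" "valid b" "lo \<le> fst a" "lo \<le> fst b"
  shows "le a b \<longleftrightarrow> (\<forall>z\<ge>lo. \<forall>s\<in>parts_at z. filled a z s \<longrightarrow> filled b z s)"
proof
  assume "le a b"
  then show "\<forall>z\<ge>lo. \<forall>s\<in>parts_at z. filled a z s \<longrightarrow> filled b z s"
    by (auto simp: le_def filled_def)
next
  assume r: "\<forall>z\<ge>lo. \<forall>s\<in>parts_at z. filled a z s \<longrightarrow> filled b z s"
  show "le a b"
  proof (rule ccontr)
    assume "\<not> le a b"
    then consider "fst b < fst a" | "fst a = fst b" "snd a \<noteq> Whole" "snd a \<noteq> snd b"
      unfolding le_def by linarith
    then show False
    proof cases
      case 1
      then have *: "\<forall>s\<in>parts_at (fst b). filled b (fst b) s" using r assms(4) by (auto simp: filled_def)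
      show False
      proof (cases "split_at (fst b)")
        case True
        then show False using * by (auto simp: parts_at_def filled_def)
      next
        case False
        then show False using * assms(2) by (auto simp: parts_at_def filled_def valid_def)
      qed
    next
      case 2
      then have "split_at (fst a)" using assms(1) by (auto simp: valid_def)
      then have "snd a \<in> parts_at (fst a)" using 2(2) by (cases "snd a") (auto simp: parts_at_def)
      moreover have "filled a (fst a) (snd a)" using 2 by (auto simp: filled_def)
      ultimately have "filled b (fst a) (snd a)" using r assms(3) by auto
      then show False using 2 by (auto simp: filled_def)
    qed
  qed
qed

lemma filled_eqI:
  assumes "valid a" "valid b" "lo \<le> fst a" "lo \<le> fst b"
    and "\<And>z s. lo \<le> z \<Longrightarrow> s \<in> parts_at z \<Longrightarrow> filled a z s = filled b z s"
  shows "a = b"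
  using assms le_iff_filled[of a b lo] le_iff_filled[of b a lo] le_antisym by blast

lemma add_filled:
  assumes "add z s a a'"
  shows "s \<in> parts_at z" "\<not> filled a z s" "fst a = z"
    and "s' \<in> parts_at z' \<Longrightarrow> filled a' z' s' \<longleftrightarrow> filled a z' s' \<or> z' = z \<and> s' = s"
proof -
  show "s \<in> parts_at z" using assms by (rule add_pts)
  from assms show "\<not> filled a z s" "fst a = z"
    by (cases; cases s; auto simp: filled_def)+
  show "filled a' z' s' \<longleftrightarrow> filled a z' s' \<or> z' = z \<and> s' = s" if "s' \<in> parts_at z'"
    using assms
  proof cases
    case whole
    then show ?thesis using that by (auto simp: filled_def parts_at_def)
  next
    case first
    then show ?thesis using that by (auto simp: filled_def)
  next
    case second
    then show ?thesis using that by (cases "z' = z"; cases s; cases s'; auto simp: filled_def parts_at_def)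
  qed
qed

text \<open>Two states that differ in one position differ by adding a block. Only levels from \<open>lo\<close> on are compared, since a wall records nothing below its base.\<close>

lemma add_from_filled:
  assumes "valid a" "valid b" "lo \<le> fst a" "lo \<le> fst b" "lo \<le> z" "s \<in> parts_at z" "\<not> filled a z s"
    and b: "\<And>z' s'. lo \<le> z' \<Longrightarrow> s' \<in> parts_at z' \<Longrightarrow> filled b z' s' \<longleftrightarrow> filled a z' s' \<or> z' = z \<and> s' = s"
  shows "add z s a b"
proof -
  have z: "z = fst a"
  proof (rule ccontr)
    assume "z \<noteq> fst a"
    then have "z > fst a" using assms(7) by (auto simp: filled_def)
    moreover have "filled b z s" using b assms by blast
    ultimately have "fst b > fst a" by (auto simp: filled_def)
    then have "filled b (fst a) s'" for s' by (simp add: filled_def)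
    then have fa: "filled a (fst a) s'" if "s' \<in> parts_at (fst a)" for s'
      using b[of "fst a" s'] that \<open>z \<noteq> fst a\<close> assms(3) by blast
    have "snd a \<noteq> Whole \<and> s' = snd a" if "s' \<in> parts_at (fst a)" for s'
      using fa[OF that] by (simp add: filled_def)
    from this[of Back] this[of Front] this[of Whole] show False
      using assms(1) by (cases "split_at (fst a)") (auto simp: parts_at_def valid_def)
  qed
  have "\<exists>a'. add z s a a'"
  proof (cases "split_at z")
    case False
    then have "snd a = Whole" "s = Whole" using assms(1,6) z by (auto simp: valid_def parts_at_def)
    then show ?thesis using whole[OF False] z by (metis prod.collapse)
  next
    case True
    then have s: "s \<noteq> Whole" using assms(6) by (auto simp: parts_at_def)
    show ?thesis
    proof (cases "snd a = Whole")
      case w: True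
      then show ?thesis using first[OF True s] z by (metis prod.collapse)
    next
      case False
      then have "snd a = other s" using assms(7) z s by (cases s; cases "snd a") (auto simp: filled_def)
      then show ?thesis using second[OF True s] z by (metis prod.collapse)
    qed
  qed
  then obtain a' where a': "add z s a a'" by blast
  have "fst a \<le> fst a'" using add_le[OF a'] by (auto simp: le_def)
  then have "b = a'"
    using filled_eqI[of b a' lo] b add_filled(4)[OF a'] add_valid[OF a'] assms by auto
  then show ?thesis using a' by simp
qed

lemma remove_above:
  assumes "valid a" "valid b" "le a b" "a \<noteq> b"
  shows "\<exists>b' z s. add z s b' b \<and> le a b'"
proof -
  obtain M h where b: "b = (M, h)" by force
  show ?thesis
  proof (cases "h = Whole")
    case False
    then have "split_at M" using assms b by (auto simp: valid_def)
    then have "add M h (M, Whole) b" using first False b by blast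
    moreover have "le a (M, Whole)" using assms b by (cases a) (auto simp: le_def)
    ultimately show ?thesis by blast
  next
    case True
    then have M: "fst a < M" using assms b by (cases a) (auto simp: le_def)
    show ?thesis
    proof (cases "split_at (M - 1)")
      case False
      then have "add (M - 1) Whole (M - 1, Whole) b" using whole[of "M - 1"] True b by simp
      moreover have "fst a < M - 1 \<or> fst a = M - 1" using M by linarith
      then have "le a (M - 1, Whole)" using assms(1) False by (auto simp: le_def valid_def)
      ultimately show ?thesis by blast
    next
      case s: True
      define s where "s = (if snd a = Front then Back else Front)"
      have "add (M - 1) s (M - 1, other s) b"
        using second[OF s, of s] True b by (simp add: s_def)
      moreover have "le a (M - 1, other s)" using M by (cases "snd a") (auto simp: le_def s_def)
      ultimately show ?thesis by blast
    qed
  qed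
qed

end

text \<open>Level \<open>z\<close> of column \<open>k\<close> is the level with index \<open>z + off k\<close> above the base. The shift is needed
  for $A_n^{(1)}$ only: with \<open>off k = k\<close> all columns carry the same pattern, and weakly decreasing
  heights become strictly decreasing states, which for columns of cubes is the relation
  \<open>fits\<close>. So this type follows the same rule as the others, where no two full columns of the
  same height are allowed.

  The ground state of column \<open>k\<close> is the least state that can stand to the right of the ground state
  of column \<open>k + 1\<close>. This keeps the blocks of the ground-state wall in place when columns are
  lowered.\<close>

locale wall_pattern = column_pattern lev period "cartan t n" n
  for t :: affine_type and n :: nat and lev :: "nat \<Rightarrow> int \<Rightarrow> level" and period :: int +
  fixes l :: nat and off :: "nat \<Rightarrow> nat" and g :: "nat \<Rightarrow> state"
  assumes level_at: "level_at t n l k m = lev k (int m - int (off k))"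
    and ground_wall: "Place k m s \<in> ground_wall t n l \<longleftrightarrow>
      s \<in> parts_at (int m - int (off k)) \<and> filled (g k) (int m - int (off k)) s"
    and g_valid: "valid (g k)"
    and g_off: "- int (off k) \<le> fst (g k)"
    and g_next: "valid b \<Longrightarrow> fits (g (Suc k)) b \<longleftrightarrow> le (g k) b"
    and g_phi: "i \<le> n \<Longrightarrow> phi (Suc k) i (g (Suc k)) = eps k i (g k)"
    and g_phi_0: "i \<le> n \<Longrightarrow> phi 0 i (g 0) = of_bool (i = l)"
    and off_cases: "t = A1 \<and> (\<forall>k. off k = k) \<and> (\<forall>z. \<not> split_at z \<and> \<not> half_at z)
      \<or> t \<noteq> A1 \<and> (\<forall>k. off k = 0) \<and> \<not> mid 0"
    and colour_count: "j \<le> n \<Longrightarrow> (\<Sum>z\<in>{0..<period}. mult j (lev k z)) = delta_coeff t n j"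
    and l_le: "l \<le> n"
begin

definition wall :: "(nat \<Rightarrow> state) \<Rightarrow> wall" where
  "wall x = {p. part p \<in> parts_at (int (height_index p) - int (off (column p))) \<and>
     filled (x (column p)) (int (height_index p) - int (off (column p))) (part p)}"

lemma Place_wall: "Place k m s \<in> wall x \<longleftrightarrow>
    s \<in> parts_at (int m - int (off k)) \<and> filled (x k) (int m - int (off k)) s"
  by (simp add: wall_def)

text \<open>No condition relates neighbouring columns here, so columns can be treated one at a time.\<close>

definition pre :: "(nat \<Rightarrow> state) \<Rightarrow> bool" where
  "pre x \<longleftrightarrow> (\<forall>k. valid (x k) \<and> le (g k) (x k)) \<and> finite {k. x k \<noteq> g k}"

definition adapted :: "(nat \<Rightarrow> state) \<Rightarrow> bool" where
  "adapted x \<longleftrightarrow> pre x \<and> (\<forall>k. fits (x (Suc k)) (x k))"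

lemma wall_ground: "wall g = ground_wall t n l"
proof -
  have "p \<in> wall g \<longleftrightarrow> p \<in> ground_wall t n l" for p
    by (cases p) (simp add: Place_wall ground_wall)
  then show ?thesis by blast
qed

lemma le_off: "le (g k) a \<Longrightarrow> - int (off k) \<le> fst a"
  using g_off[of k] by (auto simp: le_def)

lemma pre_off: "pre x \<Longrightarrow> - int (off k) \<le> fst (x k)"
  by (simp add: pre_def le_off)

lemma place_at:
  assumes "- int (off k) \<le> z"
  shows "Place k (nat (z + int (off k))) s \<in> wall x \<longleftrightarrow> s \<in> parts_at z \<and> filled (x k) z s"
  using assms by (simp add: Place_wall)

text \<open>Only column \<open>k\<close> of the two sequences is involved; in this form the columns of two different walls
  can be compared directly.\<close>

lemma column_le_iff:
  assumes "valid a" "valid b" "- int (off k) \<le> fst a" "- int (off k) \<le> fst b" "x k = a" "y k = b"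
  shows "le a b \<longleftrightarrow> (\<forall>m s. Place k m s \<in> wall x \<longrightarrow> Place k m s \<in> wall y)"
proof -
  have "(\<forall>m s. Place k m s \<in> wall x \<longrightarrow> Place k m s \<in> wall y) \<longleftrightarrow>
     (\<forall>z\<ge>- int (off k). \<forall>s\<in>parts_at z. filled a z s \<longrightarrow> filled b z s)" (is "?l = ?r")
  proof
    assume ?l
    then show ?r using place_at[of k] assms(5,6) by metis
  next
    assume ?r
    then show ?l using assms(5,6) by (auto simp: Place_wall)
  qed
  then show ?thesis using le_iff_filled[OF assms(1-4)] by simp
qed

lemma column_eq:
  assumes "pre x" "pre y" "\<And>m s. Place k m s \<in> wall x \<longleftrightarrow> Place k m s \<in> wall y"
  shows "x k = y k"
proof -
  have "valid (x k)" "valid (y k)" using assms by (auto simp: pre_def)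
  note v = this pre_off[OF assms(1), of k] pre_off[OF assms(2), of k]
  have "le (x k) (y k)" using column_le_iff[OF v, of x y] assms(3) by simp
  moreover have "le (y k) (x k)" using column_le_iff[OF v(2,1,4,3), of y x] assms(3) by simp
  ultimately show ?thesis by (rule le_antisym)
qed

lemma ground_subset: "pre x \<Longrightarrow> ground_wall t n l \<subseteq> wall x"
proof
  fix p assume x: "pre x" and p: "p \<in> ground_wall t n l"
  obtain k m s where [simp]: "p = Place k m s" by (cases p)
  have "le (g k) (x k)" using x by (simp add: pre_def)
  then show "p \<in> wall x" using p by (auto simp: Place_wall ground_wall le_def filled_def)
qed

lemma finite_pts: "finite (parts_at z)"
  by (simp add: parts_at_def)

lemma column_finite: "finite {p \<in> wall x. column p = k}"
proof (rule finite_subset)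
  let ?B = "nat (fst (x k) + int (off k))"
  show "{p \<in> wall x. column p = k} \<subseteq> (\<lambda>(m, s). Place k m s) ` ({..?B} \<times> {Whole, Back, Front})"
  proof
    fix p assume "p \<in> {p \<in> wall x. column p = k}"
    then obtain m s where p: "p = Place k m s" "Place k m s \<in> wall x" by (cases p) auto
    then have "m \<le> ?B" by (auto simp: Place_wall filled_def)
    then show "p \<in> (\<lambda>(m, s). Place k m s) ` ({..?B} \<times> {Whole, Back, Front})"
      using p by (cases s) auto
  qed
qed auto

lemma added_finite: "pre x \<Longrightarrow> finite (wall x - ground_wall t n l)"
proof -
  assume x: "pre x"
  have "wall x - ground_wall t n l \<subseteq> (\<Union>k\<in>{k. x k \<noteq> g k}. {p \<in> wall x. column p = k})"
  proof
    fix p assume p: "p \<in> wall x - ground_wall t n l"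
    then have "x (column p) \<noteq> g (column p)"
      by (cases p) (auto simp: Place_wall ground_wall)
    then show "p \<in> (\<Union>k\<in>{k. x k \<noteq> g k}. {p \<in> wall x. column p = k})" using p by auto
  qed
  then show ?thesis using x column_finite by (auto simp: pre_def intro: finite_subset)
qed

lemma level_height_at: "level_height (level_at t n l (Suc k) m) = level_height (level_at t n l k m)"
proof (cases "t = A1")
  case True
  then have "\<not> is_half (level_at t n l k m)" for k m
    unfolding level_at is_half_lev using off_cases by blast
  then have "level_height (level_at t n l k m) = 1" for k m
    by (cases "level_at t n l k m") (auto, metis is_half.simps(1))
  then show ?thesis by simp
next
  case False
  then show ?thesis using off_cases neighbour[of k "int m"] unfolding level_at
    by (cases "lev k (int m)") auto
qed

lemma level_height_at_0: "level_height (level_at t n l k m) = level_height (level_at t n l 0 m)"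
  by (induction k) (simp_all add: level_height_at)

definition height :: "nat \<Rightarrow> rat" where
  "height m = (\<Sum>m'<m. level_height (level_at t n l 0 m'))"

lemma level_height_pos: "level_height lv > 0"
  by (cases lv) auto

lemma height_strict: "m < m' \<Longrightarrow> height m < height m'"
proof -
  assume "m < m'"
  have "height m < height (Suc m + d)" for d
    by (induction d) (use level_height_pos in \<open>auto simp: height_def intro: add_pos_pos less_trans\<close>)
  then show ?thesis using \<open>m < m'\<close> by (metis Suc_leI le_add_diff_inverse)
qed

lemma height_inj: "height m = height m' \<longleftrightarrow> m = m'"
  using height_strict by (metis less_irrefl nat_neq_iff)

text \<open>Half-height levels come in pairs, so the height is a half-integer exactly in the middle of a
  pair. The induction also needs that doubled heights are integers.\<close>

lemma height_int:
  assumes "t \<noteq> A1"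
  shows "height m \<in> \<int> \<longleftrightarrow> \<not> mid (int m)"
proof -
  have off: "off k = 0" for k using off_cases assms by blast
  have lv: "level_at t n l 0 m = lev 0 (int m)" for m using level_at off by simp
  have half_notint: "x + 1 / 2 \<notin> \<int> \<longleftrightarrow> x \<in> \<int> \<or> x + 1 / 2 \<notin> \<int> \<and> x \<notin> \<int>" for x :: rat
  proof -
    have "x + 1 / 2 \<notin> \<int>" if "x \<in> \<int>"
    proof
      assume "x + 1 / 2 \<in> \<int>"
      then have "(x + 1 / 2) - x \<in> \<int>" using that by (rule Ints_diff)
      then have "(1 / 2 :: rat) \<in> \<int>" by simp
      then obtain u :: int where "(1 / 2 :: rat) = of_int u" by (elim Ints_cases)
      then have "(of_int (2 * u) :: rat) = of_int 1" by simp
      then have "2 * u = 1" by (simp only: of_int_eq_iff)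
      then show False by presburger
    qed
    then show ?thesis by blast
  qed
  have "(height m \<in> \<int> \<longleftrightarrow> \<not> mid (int m)) \<and> height m * 2 \<in> \<int>"
  proof (induction m)
    case 0
    then show ?case using off_cases assms by (simp add: height_def)
  next
    case (Suc m)
    have h: "height (Suc m) = height m + level_height (lev 0 (int m))" by (simp add: height_def lv)
    show ?case
    proof (cases "half_at (int m)")
      case False
      then have "level_height (lev 0 (int m)) = 1"
        using is_half_lev[of 0 "int m"] by (cases "lev 0 (int m)") auto
      moreover have "\<not> mid (int m)" "\<not> mid (int (Suc m))" using False by (auto simp: mid_def)
      ultimately show ?thesis using Suc h by (auto simp: distrib_right)
    next
      case True
      then obtain c where c: "lev 0 (int m) = Half_Height c"
        using is_half_lev[of 0 "int m"] by (cases "lev 0 (int m)") auto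
      have mm: "mid (int (Suc m)) \<longleftrightarrow> \<not> mid (int m)"
        using half_pairs[OF c] True half_lev[of 0 "int m - 1" c] half_lev[of 0 "int m + 1" c]
        by (auto simp: mid_def add.commute)
      have h2: "height (Suc m) = height m + 1 / 2" using h c by simp
      have d: "height (Suc m) * 2 \<in> \<int>" using h2 Suc by (simp add: distrib_right)
      show ?thesis
      proof (cases "mid (int m)")
        case False
        then have "height m \<in> \<int>" using Suc by blast
        then have "height (Suc m) \<notin> \<int>" using h2 half_notint by metis
        then show ?thesis using mm False d by blast
      next
        case m: True
        then have "height m \<notin> \<int>" "height m * 2 \<in> \<int>" using Suc by auto
        then obtain u :: int where u: "height m * 2 = of_int u" by (auto elim: Ints_cases)
        have "odd u"
        proof
          assume "even u"
          then obtain v where "u = 2 * v" by (elim evenE)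
          then have "height m = of_int v" using u by simp
          then show False using \<open>height m \<notin> \<int>\<close> by simp
        qed
        then obtain v where "u = 2 * v + 1" by (elim oddE)
        then have "height (Suc m) = of_int (v + 1)" using u h2 by simp
        then show ?thesis using mm m d by (metis Ints_of_int)
      qed
    qed
  qed
  then show ?thesis by blast
qed

definition top_index :: "nat \<Rightarrow> state \<Rightarrow> nat" where
  "top_index k a = nat (fst a + int (off k)) + of_bool (snd a \<noteq> Whole)"

lemma occupied_wall:
  assumes "pre x"
  shows "occupied (wall x) k = {..<top_index k (x k)}"
proof -
  have v: "valid (x k)" and o: "- int (off k) \<le> fst (x k)"
    using assms pre_off by (auto simp: pre_def)
  have *: "(\<exists>s\<in>parts_at z. filled (x k) z s) \<longleftrightarrow> z < fst (x k) \<or> z = fst (x k) \<and> snd (x k) \<noteq> Whole" for z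
  proof (cases "z = fst (x k) \<and> snd (x k) \<noteq> Whole")
    case True
    then have "snd (x k) \<in> parts_at z" using v by (cases "snd (x k)") (auto simp: valid_def parts_at_def)
    then show ?thesis using True by (auto simp: filled_def)
  next
    case False
    then show ?thesis using parts_at_nonempty[of z] by (auto simp: filled_def)
  qed
  have "m \<in> occupied (wall x) k \<longleftrightarrow> m \<in> {..<top_index k (x k)}" for m
  proof -
    have "m \<in> occupied (wall x) k \<longleftrightarrow> (\<exists>s\<in>parts_at (int m - int (off k)). filled (x k) (int m - int (off k)) s)"
      by (auto simp: occupied_def Place_wall)
    also have "\<dots> \<longleftrightarrow> m < top_index k (x k)" unfolding * using o
      by (auto simp: top_index_def)
    finally show ?thesis by simp
  qed
  then show ?thesis by blast
qed

lemma column_height_wall: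
  assumes "pre x"
  shows "column_height t n l (wall x) k = height (top_index k (x k))"
  unfolding column_height_def occupied_wall[OF assms] height_def
  by (rule sum.cong) (simp_all add: level_height_at_0[of k])

lemma level_filled_wall:
  "level_filled t n l (wall x) k m \<longleftrightarrow>
     (\<forall>s\<in>parts_at (int m - int (off k)). filled (x k) (int m - int (off k)) s)"
  by (auto simp: level_filled_def level_at Place_wall)

lemma full_column_wall:
  assumes "pre x" "t \<noteq> A1"
  shows "full_column t n l (wall x) k \<longleftrightarrow> full (x k)"
proof -
  have v: "valid (x k)" and o: "0 \<le> fst (x k)" and off: "off k = 0"
    using assms pre_off[OF assms(1), of k] off_cases by (auto simp: pre_def)
  show ?thesis
  proof (cases "snd (x k) = Whole")
    case True
    then have "top_index k (x k) = nat (fst (x k))" by (simp add: top_index_def off)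
    moreover have "\<forall>m\<in>occupied (wall x) k. level_filled t n l (wall x) k m"
      unfolding occupied_wall[OF assms(1)] level_filled_wall using calculation o
      by (auto simp: filled_def off)
    ultimately show ?thesis using True o height_int[OF assms(2), of "nat (fst (x k))"]
      by (simp add: full_column_def column_height_wall[OF assms(1)] full_def)
  next
    case False
    then have "nat (fst (x k)) \<in> occupied (wall x) k"
      unfolding occupied_wall[OF assms(1)] by (simp add: top_index_def off)
    moreover have "\<not> level_filled t n l (wall x) k (nat (fst (x k)))"
      unfolding level_filled_wall using False v o by (auto simp: filled_def off parts_at_def valid_def)
    ultimately show ?thesis using False by (auto simp: full_column_def full_def)
  qed
qed

lemma fits_A1:
  assumes "t = A1" "valid a" "valid b"
  shows "fits a b \<longleftrightarrow> fst a < fst b"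
proof -
  have "\<not> split_at z" "\<not> half_at z" for z using off_cases assms by blast+
  then have "snd a = Whole" "snd b = Whole" "\<not> mid z" for z
    using assms by (auto simp: valid_def mid_def)
  then show ?thesis by (cases a; cases b) (auto simp: fits_def le_def full_def)
qed

lemma no_free_space_iff:
  assumes "pre x"
  shows "(\<forall>m s. Place (Suc k) m s \<in> wall x \<longrightarrow> Place k m s \<in> wall x) \<longleftrightarrow>
    (if t = A1 then fits (x (Suc k)) (x k) else le (x (Suc k)) (x k))"
proof (cases "t = A1")
  case True
  have off: "off k = k" for k using off_cases True by blast
  have ns: "\<not> split_at z" for z using off_cases True by blast
  have v: "valid (x k)" for k using assms by (simp add: pre_def)
  have w: "snd (x k) = Whole" for k using v[of k] ns by (auto simp: valid_def)
  have P: "Place k m s \<in> wall x \<longleftrightarrow> s = Whole \<and> int m < fst (x k) + int k" for k m s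
    using w[of k] ns by (auto simp: Place_wall off parts_at_def filled_def)
  have "0 \<le> fst (x (Suc k)) + int (Suc k)" using pre_off[OF assms, of "Suc k"] off by simp
  have "(\<forall>m s. Place (Suc k) m s \<in> wall x \<longrightarrow> Place k m s \<in> wall x) \<longleftrightarrow>
     (\<forall>m. int m < fst (x (Suc k)) + int (Suc k) \<longrightarrow> int m < fst (x k) + int k)"
    unfolding P by blast
  also have "\<dots> \<longleftrightarrow> fst (x (Suc k)) < fst (x k)"
  proof
    assume a: "\<forall>m. int m < fst (x (Suc k)) + int (Suc k) \<longrightarrow> int m < fst (x k) + int k"
    show "fst (x (Suc k)) < fst (x k)"
    proof (cases "fst (x (Suc k)) + int (Suc k) = 0")
      case True
      then show ?thesis using pre_off[OF assms, of k] off by simp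
    next
      case False
      then show ?thesis using a[rule_format, of "nat (fst (x (Suc k)) + int k)"]
          \<open>0 \<le> fst (x (Suc k)) + int (Suc k)\<close> by auto
    qed
  qed auto
  finally show ?thesis using True fits_A1[OF True v v] by simp
next
  case False
  have off: "off k = 0" for k using off_cases False by blast
  have v: "valid (x k)" for k using assms by (simp add: pre_def)
  have "le (x (Suc k)) (x k) \<longleftrightarrow> (\<forall>m s. Place (Suc k) m s \<in> wall x \<longrightarrow> Place (Suc k) m s \<in> wall (\<lambda>_. x k))"
    using column_le_iff[of "x (Suc k)" "x k" "Suc k" x "\<lambda>_. x k"] v pre_off[OF assms, of k]
      pre_off[OF assms, of "Suc k"] off by simp
  also have "\<dots> \<longleftrightarrow> (\<forall>m s. Place (Suc k) m s \<in> wall x \<longrightarrow> Place k m s \<in> wall x)"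
    by (simp add: Place_wall off)
  finally show ?thesis using False by simp
qed

lemma adapted_le: "adapted x \<Longrightarrow> j \<le> k \<Longrightarrow> le (x k) (x j)"
proof (induction k)
  case (Suc k)
  then show ?case
    using fits_le[of "x (Suc k)" "x k"] le_trans le_Suc_eq by (metis adapted_def le_refl)
qed simp

text \<open>Properness, where it is a condition, compares arbitrary columns, and \<open>fits\<close> compares neighbours
  only. Two full columns of equal height are equal states; the columns between them, being nested, are then equal as well,
  and the first two neighbours among them contradict \<open>fits\<close>.\<close>

lemma wall_proper:
  assumes "adapted x"
  shows "wall x \<in> proper_walls t n l"
proof -
  have x: "pre x" and Rx: "fits (x (Suc k)) (x k)" for k using assms by (auto simp: adapted_def)
  have free_space: "\<forall>m s. Place (Suc k) m s \<in> wall x \<longrightarrow> Place k m s \<in> wall x" for k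
    using no_free_space_iff[OF x, of k] Rx[of k] fits_le by (auto split: if_splits)
  have "column_height t n l (wall x) (Suc k) \<le> column_height t n l (wall x) k" for k
  proof -
    have "occupied (wall x) (Suc k) \<subseteq> occupied (wall x) k" using free_space by (auto simp: occupied_def)
    then have "top_index (Suc k) (x (Suc k)) \<le> top_index k (x k)"
      unfolding occupied_wall[OF x] by auto
    then show ?thesis unfolding column_height_wall[OF x]
      using height_strict by (metis le_less nat_less_le order_refl)
  qed
  moreover have "wall x \<subseteq> places t n l" by (auto simp: wall_def places_def level_at)
  moreover have "level_filled t n l (wall x) k m" if "Place k (Suc m) s \<in> wall x" for k m s
    using that unfolding level_filled_wall Place_wall by (auto simp: filled_def)
  ultimately have "young_wall t n l (wall x)"
    using ground_subset[OF x] added_finite[OF x] free_space by (auto simp: young_wall_def)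
  moreover have "proper t n l (wall x)"
  proof (cases "t = A1")
    case False
    have off: "off k = 0" for k using off_cases False by blast
    have "False" if "j < k" "full (x j)" "full (x k)"
        "height (top_index j (x j)) = height (top_index k (x k))" for j k
    proof -
      have "top_index j (x j) = top_index k (x k)" using that height_inj by blast
      then have "fst (x j) = fst (x k)"
        using that pre_off[OF x, of j] pre_off[OF x, of k] by (auto simp: top_index_def off full_def)
      then have "x j = x k" using that by (auto simp: full_def intro: prod_eqI)
      moreover have "le (x k) (x (Suc j))" "le (x (Suc j)) (x j)"
        using adapted_le[OF assms] that by auto
      ultimately have "x (Suc j) = x j" using le_antisym by metis
      then show False using Rx[of j] that by (auto simp: fits_def)
    qed
    then show ?thesis unfolding proper_def full_column_wall[OF x False] column_height_wall[OF x]
      by (metis linorder_neqE_nat)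
  qed (simp add: proper_def)
  ultimately show ?thesis by (simp add: proper_walls_def)
qed

text \<open>The state is read off at the first level that is not full: nothing can be stacked above it.\<close>

lemma column_state:
  assumes "young_wall t n l Y"
  shows "\<exists>a. valid a \<and> - int (off k) \<le> fst a \<and>
    (\<forall>m s. Place k m s \<in> Y \<longleftrightarrow> s \<in> parts_at (int m - int (off k)) \<and> filled a (int m - int (off k)) s)"
proof -
  have pl: "Y \<subseteq> places t n l" and fin: "finite (Y - ground_wall t n l)"
    and sup: "\<And>k m s. Place k (Suc m) s \<in> Y \<Longrightarrow> level_filled t n l Y k m"
    using assms unfolding young_wall_def by blast+
  have parts_at: "s \<in> parts_at (int m - int (off k))" if "Place k m s \<in> Y" for m s
    using that pl by (auto simp: places_def level_at)
  let ?z = "\<lambda>m. int m - int (off k)"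
  have "finite {p \<in> Y. column p = k}"
  proof (rule finite_subset)
    show "{p \<in> Y. column p = k} \<subseteq> (Y - ground_wall t n l) \<union> {p \<in> wall g. column p = k}"
      by (auto simp: wall_ground)
  qed (use fin column_finite in auto)
  then have "finite (height_index ` {p \<in> Y. column p = k})" by simp
  then obtain m0 where m0: "m0 \<notin> height_index ` {p \<in> Y. column p = k}"
    using ex_new_if_finite[OF infinite_UNIV_nat] by blast
  define F where "F = level_filled t n l Y k"
  have "\<not> F m0"
  proof
    assume "F m0"
    moreover obtain s where "s \<in> parts_at (?z m0)" using parts_at_nonempty by blast
    ultimately have "Place k m0 s \<in> Y" by (auto simp: F_def level_filled_def level_at)
    then show False using m0 by force
  qed
  define M where "M = (LEAST m. \<not> F m)"
  have M: "\<not> F M" using \<open>\<not> F m0\<close> unfolding M_def by (rule LeastI)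
  have below: "F m" if "m < M" for m using that not_less_Least unfolding M_def by blast
  have above: "Place k m s \<notin> Y" if "M < m" for m s
  proof -
    have "m = Suc M + d \<Longrightarrow> Place k m s \<notin> Y" for d s
    proof (induction d arbitrary: m s)
      case 0
      then show ?case using sup M by (auto simp: F_def)
    next
      case (Suc d)
      show ?case
      proof
        assume "Place k m s \<in> Y"
        then have "F (Suc M + d)" using sup[of k "Suc M + d"] Suc.prems by (simp add: F_def)
        moreover obtain s where "s \<in> parts_at (?z (Suc M + d))" using parts_at_nonempty by blast
        ultimately have "Place k (Suc M + d) s \<in> Y" by (auto simp: F_def level_filled_def level_at)
        then show False using Suc.IH by blast
      qed
    qed
    then show ?thesis using that by (metis Suc_leI le_add_diff_inverse)
  qed
  define h where "h = (if Place k M Back \<in> Y then Back else if Place k M Front \<in> Y then Front else Whole)"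
  define a where "a = (?z M, h)"
  have at: "Place k M s \<in> Y \<longleftrightarrow> h \<noteq> Whole \<and> s = h" for s
  proof (cases "split_at (?z M)")
    case True
    then have "\<not> (Place k M Back \<in> Y \<and> Place k M Front \<in> Y)"
      using M by (auto simp: F_def level_filled_def level_at parts_at_def)
    moreover have "Place k M Whole \<notin> Y" using parts_at[of M Whole] True by (auto simp: parts_at_def)
    ultimately show ?thesis by (cases s) (auto simp: h_def)
  next
    case False
    then have "Place k M Whole \<notin> Y" using M by (auto simp: F_def level_filled_def level_at parts_at_def)
    moreover have "Place k M Back \<notin> Y" "Place k M Front \<notin> Y"
      using parts_at[of M] False by (auto simp: parts_at_def)
    ultimately show ?thesis by (cases s) (auto simp: h_def)
  qed
  have "valid a"
  proof -
    have "split_at (?z M)" if "h \<noteq> Whole"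
      using at[of h] that parts_at[of M h] by (auto simp: parts_at_def split: if_splits)
    then show ?thesis by (auto simp: valid_def a_def)
  qed
  moreover have "- int (off k) \<le> fst a" by (simp add: a_def)
  moreover have "Place k m s \<in> Y \<longleftrightarrow> s \<in> parts_at (?z m) \<and> filled a (?z m) s" for m s
  proof (cases m M rule: linorder_cases)
    case less
    then have "F m" by (rule below)
    then have "Place k m s \<in> Y \<longleftrightarrow> s \<in> parts_at (?z m)"
      using parts_at[of m s] by (auto simp: F_def level_filled_def level_at)
    then show ?thesis using less by (auto simp: filled_def a_def)
  next
    case equal
    then show ?thesis using at[of s] parts_at[of m s] by (auto simp: filled_def a_def)
  next
    case greater
    then show ?thesis using above[OF greater, of s] by (auto simp: filled_def a_def)
  qed
  ultimately show ?thesis by blast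
qed

lemma proper_wallE:
  assumes "Y \<in> proper_walls t n l"
  obtains x where "adapted x" "Y = wall x"
proof -
  have Y: "young_wall t n l Y" "proper t n l Y" using assms by (auto simp: proper_walls_def)
  obtain x where x: "\<And>k. valid (x k)" "\<And>k. - int (off k) \<le> fst (x k)"
     "\<And>k m s. Place k m s \<in> Y \<longleftrightarrow> s \<in> parts_at (int m - int (off k)) \<and> filled (x k) (int m - int (off k)) s"
  proof -
    have "\<forall>k. \<exists>a. valid a \<and> - int (off k) \<le> fst a \<and>
      (\<forall>m s. Place k m s \<in> Y \<longleftrightarrow> s \<in> parts_at (int m - int (off k)) \<and> filled a (int m - int (off k)) s)"
      using column_state[OF Y(1)] by blast
    from choice[OF this] show ?thesis using that by blast
  qed
  have "p \<in> Y \<longleftrightarrow> p \<in> wall x" for p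
    by (cases p) (simp add: x(3) Place_wall)
  then have Yx: "Y = wall x" by blast
  have gr: "ground_wall t n l \<subseteq> wall x" and fin: "finite (wall x - ground_wall t n l)"
    using Y(1) Yx by (auto simp: young_wall_def)
  have le: "le (g k) (x k)" for k
    using column_le_iff[OF g_valid x(1) g_off x(2), of g k x] gr wall_ground by auto
  have "{k. x k \<noteq> g k} \<subseteq> column ` (wall x - ground_wall t n l)"
  proof
    fix k assume k: "k \<in> {k. x k \<noteq> g k}"
    have "\<not> le (x k) (g k)" using le k le_antisym by blast
    then obtain m s where "Place k m s \<in> wall x" "Place k m s \<notin> wall g"
      using column_le_iff[OF x(1) g_valid x(2) g_off, of x k g] by blast
    then show "k \<in> column ` (wall x - ground_wall t n l)"
      unfolding wall_ground by force
  qed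
  then have pre: "pre x" using x le fin by (auto simp: pre_def intro: finite_subset)
  have "fits (x (Suc k)) (x k)" for k
  proof -
    have "\<forall>m s. Place (Suc k) m s \<in> wall x \<longrightarrow> Place k m s \<in> wall x"
      using Y(1) unfolding Yx young_wall_def by blast
    then have *: "if t = A1 then fits (x (Suc k)) (x k) else le (x (Suc k)) (x k)"
      using no_free_space_iff[OF pre, of k] by (rule iffD1[rotated])
    show ?thesis
    proof (cases "t = A1")
      case False
      have "\<not> (x (Suc k) = x k \<and> full (x (Suc k)))"
      proof
        assume e: "x (Suc k) = x k \<and> full (x (Suc k))"
        then have "full (x (Suc k))" "full (x k)" by metis+
        then have "full_column t n l Y (Suc k)" "full_column t n l Y k"
          unfolding Yx full_column_wall[OF pre False] .
        moreover have "column_height t n l Y (Suc k) = column_height t n l Y k"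
          unfolding Yx column_height_wall[OF pre] using e off_cases False
          by (auto simp: top_index_def)
        ultimately show False using Y(2) False unfolding proper_def by (metis n_not_Suc_n)
      qed
      then show ?thesis using * False by (auto simp: fits_def)
    qed (use * in simp)
  qed
  then have "adapted x" using pre by (simp add: adapted_def)
  then show ?thesis using that Yx by blast
qed

end

context wall_pattern
begin

section \<open>Admissible slots and removable blocks\<close>

lemma colour_clr: "colour t n l (Place k m s) = colour_at k (int m - int (off k)) s"
  by (simp add: colour_def colour_at_def level_at)

lemma adapted_pre: "adapted x \<Longrightarrow> pre x"
  by (simp add: adapted_def)

lemma pre_upd: "pre x \<Longrightarrow> valid a \<Longrightarrow> le (g k) a \<Longrightarrow> pre (x(k := a))"
proof -
  assume a: "pre x" "valid a" "le (g k) a"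
  have "{j. (x(k := a)) j \<noteq> g j} \<subseteq> insert k {j. x j \<noteq> g j}" by auto
  then have "finite {j. (x(k := a)) j \<noteq> g j}" using a(1) finite_subset unfolding pre_def by blast
  then show "pre (x(k := a))" using a unfolding pre_def by simp
qed

definition right_ok :: "(nat \<Rightarrow> state) \<Rightarrow> nat \<Rightarrow> state \<Rightarrow> bool" where
  "right_ok x k a \<longleftrightarrow> (case k of 0 \<Rightarrow> True | Suc j \<Rightarrow> fits a (x j))"

text \<open>A raised column still fits with its left neighbour, so only the right neighbour can
  block the step; for a lowered column it is only the left one.\<close>

lemma adapted_raise:
  assumes "adapted x" "step k i (x k) a"
  shows "adapted (x(k := a)) \<longleftrightarrow> right_ok x k a"
proof -
  have le: "le (x k) a" using assms step_imp_le by blast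
  have "pre (x(k := a))"
    using assms step_valid[OF assms(2)] le_trans[OF _ le] by (intro pre_upd) (auto simp: adapted_def pre_def)
  moreover have "fits (x (Suc k)) a" using assms(1) fits_le_trans[OF _ le] by (auto simp: adapted_def)
  ultimately show ?thesis using assms(1)
    by (auto simp: adapted_def right_ok_def split: nat.splits)
qed

lemma lower_bound:
  assumes "pre x" "valid a" "fits (x (Suc k)) a"
  shows "le (g k) a"
  using assms le_R g_next by (metis pre_def)

lemma adapted_shrink:
  assumes "adapted x" "valid a" "le a (x k)"
  shows "adapted (x(k := a)) \<longleftrightarrow> fits (x (Suc k)) a"
proof
  assume "adapted (x(k := a))"
  then have "fits ((x(k := a)) (Suc k)) ((x(k := a)) k)" by (auto simp only: adapted_def)
  then show "fits (x (Suc k)) a" by simp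
next
  assume r: "fits (x (Suc k)) a"
  have "pre (x(k := a))"
    using assms lower_bound[of x a k] r by (intro pre_upd) (auto simp: adapted_def)
  moreover have "fits a (x j)" if "k = Suc j" for j
    using assms le_R that by (auto simp: adapted_def)
  ultimately show "adapted (x(k := a))" using assms r by (auto simp: adapted_def)
qed

lemma wall_upd_add:
  assumes "pre x" "add z s (x k) a"
  defines "p \<equiv> Place k (nat (z + int (off k))) s"
  shows "p \<notin> wall x" "wall (x(k := a)) = insert p (wall x)" "colour t n l p = colour_at k z s"
proof -
  have z: "- int (off k) \<le> z" using pre_off[OF assms(1), of k] add_filled(3)[OF assms(2)] by simp
  show "p \<notin> wall x" using add_filled(2)[OF assms(2)] place_at[OF z] by (simp add: p_def)
  show "colour t n l p = colour_at k z s" using z by (simp add: p_def colour_clr)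
  have "q \<in> wall (x(k := a)) \<longleftrightarrow> q \<in> insert p (wall x)" for q
  proof (cases q)
    case (Place j m s')
    show ?thesis
    proof (cases "j = k")
      case False
      then show ?thesis using Place by (simp add: Place_wall p_def)
    next
      case True
      have "q = p \<longleftrightarrow> int m - int (off k) = z \<and> s' = s" using z Place True by (auto simp: p_def)
      then show ?thesis using Place True add_filled(1,4)[OF assms(2)]
        by (auto simp: Place_wall)
    qed
  qed
  then show "wall (x(k := a)) = insert p (wall x)" by blast
qed

lemma wall_insert:
  assumes "pre x" "pre y" "p \<notin> wall x" "wall y = insert p (wall x)"
  shows "add (int (height_index p) - int (off (column p))) (part p) (x (column p)) (y (column p))"
    and "y = x(column p := y (column p))"
proof -
  obtain k m s where p: "p = Place k m s" by (cases p)
  have same: "Place j m' s' \<in> wall y \<longleftrightarrow> Place j m' s' \<in> wall x \<or> j = k \<and> m' = m \<and> s' = s" for j m' s'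
    using assms(4) p by auto
  have "y j = x j" if "j \<noteq> k" for j
    using column_eq[OF assms(2,1), of j] same that by blast
  then show "y = x(column p := y (column p))" using p by auto
  let ?z = "int m - int (off k)"
  have s: "s \<in> parts_at ?z" "\<not> filled (x k) ?z s"
    using same[of k m s] assms(3) p Place_wall by auto
  have "add ?z s (x k) (y k)"
  proof (rule add_from_filled[where lo = "- int (off k)"])
    fix z s' assume z: "- int (off k) \<le> z" "s' \<in> parts_at z"
    show "filled (y k) z s' \<longleftrightarrow> filled (x k) z s' \<or> z = ?z \<and> s' = s"
      using same[of k "nat (z + int (off k))" s'] place_at[OF z(1)] z by auto
  qed (use assms(1,2) pre_off s in \<open>auto simp: pre_def\<close>)
  then show "add (int (height_index p) - int (off (column p))) (part p) (x (column p)) (y (column p))"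
    using p by simp
qed

lemma admissible_slotE:
  assumes "adapted x" "admissible_slot t n l i (wall x) p"
  obtains a where "step (column p) i (x (column p)) a" "right_ok x (column p) a"
    "insert p (wall x) = wall (x(column p := a))" "adapted (x(column p := a))"
proof -
  have p: "p \<notin> wall x" "colour t n l p = i" "insert p (wall x) \<in> proper_walls t n l"
    using assms(2) by (auto simp: admissible_slot_def)
  obtain y where y: "adapted y" "insert p (wall x) = wall y" using p(3) by (rule proper_wallE)
  note w = wall_insert[OF adapted_pre[OF assms(1)] adapted_pre[OF y(1)] p(1) y(2)[symmetric]]
  have "step (column p) i (x (column p)) (y (column p))"
    using w(1) p(2) by (cases p) (auto simp: step_def colour_clr)
  then show ?thesis using that[of "y (column p)"] w(2) y adapted_raise[OF assms(1)] by metis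
qed

lemma removable_blockE:
  assumes "adapted x" "removable_block t n l i (wall x) p"
  obtains a where "step (column p) i a (x (column p))" "fits (x (Suc (column p))) a"
    "wall x - {p} = wall (x(column p := a))" "adapted (x(column p := a))"
proof -
  have p: "p \<in> wall x" "colour t n l p = i" "wall x - {p} \<in> proper_walls t n l"
    using assms(2) by (auto simp: removable_block_def)
  obtain y where y: "adapted y" "wall x - {p} = wall y" using p(3) by (rule proper_wallE)
  have "p \<notin> wall y" "wall x = insert p (wall y)" using y(2) p(1) by auto
  note w = wall_insert[OF adapted_pre[OF y(1)] adapted_pre[OF assms(1)] this]
  have st: "step (column p) i (y (column p)) (x (column p))"
    using w(1) p(2) by (cases p) (auto simp: step_def colour_clr)
  have yx: "y = x(column p := y (column p))"
    by (subst w(2)) (simp del: fun_upd_apply add: fun_upd_upd)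
  then have ad: "adapted (x(column p := y (column p)))" using y(1) by simp
  have "fits (x (Suc (column p))) (y (column p))"
    using adapted_shrink[OF assms(1) _ step_imp_le[OF st]] step_valid[OF st] ad by blast
  moreover have "wall x - {p} = wall (x(column p := y (column p)))" using y(2) yx by metis
  ultimately show ?thesis using that st ad by blast
qed

lemma step_slot:
  assumes "adapted x" "step k i (x k) a" "adapted (x(k := a))"
  obtains p where "column p = k" "admissible_slot t n l i (wall x) p"
    "removable_block t n l i (wall (x(k := a))) p" "insert p (wall x) = wall (x(k := a))" "p \<notin> wall x"
proof -
  obtain z s where zs: "add z s (x k) a" "colour_at k z s = i" using assms(2) by (auto simp: step_def)
  let ?p = "Place k (nat (z + int (off k))) s"
  note w = wall_upd_add[OF adapted_pre[OF assms(1)] zs(1)]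
  have "wall (x(k := a)) - {?p} = wall x" using w by auto
  then have "removable_block t n l i (wall (x(k := a))) ?p"
    unfolding removable_block_def using w(2,3) zs(2) wall_proper[OF assms(1)] by auto
  moreover have "admissible_slot t n l i (wall x) ?p"
    unfolding admissible_slot_def w(2)[symmetric] using w(1,3) zs(2) wall_proper[OF assms(3)] by blast
  moreover have "column ?p = k" by simp
  moreover have "insert ?p (wall x) = wall (x(k := a))" by (rule w(2)[symmetric])
  ultimately show ?thesis using w(1) that by blast
qed

lemma slot_unique:
  assumes "adapted x" "admissible_slot t n l i (wall x) p" "admissible_slot t n l i (wall x) q"
    "column p = column q"
  shows "p = q"
proof -
  obtain a where a: "step (column p) i (x (column p)) a" "insert p (wall x) = wall (x(column p := a))"
    using admissible_slotE[OF assms(1,2)] by metis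
  obtain b where b: "step (column q) i (x (column q)) b" "insert q (wall x) = wall (x(column q := b))"
    using admissible_slotE[OF assms(1,3)] by metis
  have "a = b" using step_unique_right a(1) b(1) assms(4) by metis
  then have "insert p (wall x) = insert q (wall x)" using a b assms(4) by simp
  then show ?thesis using assms(2,3) by (auto simp: admissible_slot_def)
qed

lemma block_unique:
  assumes "adapted x" "removable_block t n l i (wall x) p" "removable_block t n l i (wall x) q"
    "column p = column q"
  shows "p = q"
proof -
  obtain a where a: "step (column p) i a (x (column p))" "wall x - {p} = wall (x(column p := a))"
    using removable_blockE[OF assms(1,2)] by metis
  obtain b where b: "step (column q) i b (x (column q))" "wall x - {q} = wall (x(column q := b))"
    using removable_blockE[OF assms(1,3)] by metis
  have "a = b" using step_unique_left a(1) b(1) assms(4) by metis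
  then have "wall x - {p} = wall x - {q}" using a b assms(4) by simp
  then show ?thesis using assms(2,3) by (auto simp: removable_block_def)
qed

lemma raise_wall:
  assumes "adapted x" "step k i (x k) a" "adapted (x(k := a))"
  shows "insert (THE p. column p = k \<and> admissible_slot t n l i (wall x) p) (wall x) = wall (x(k := a))"
    and "wall (x(k := a)) - {THE p. column p = k \<and> removable_block t n l i (wall (x(k := a))) p} = wall x"
proof -
  obtain p where p: "column p = k" "admissible_slot t n l i (wall x) p"
    "removable_block t n l i (wall (x(k := a))) p" "insert p (wall x) = wall (x(k := a))" "p \<notin> wall x"
    using step_slot[OF assms] by blast
  have "(THE q. column q = k \<and> admissible_slot t n l i (wall x) q) = p"
    using p slot_unique[OF assms(1)] by (intro the_equality) auto
  then show "insert (THE p. column p = k \<and> admissible_slot t n l i (wall x) p) (wall x) = wall (x(k := a))"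
    using p by simp
  have "(THE q. column q = k \<and> removable_block t n l i (wall (x(k := a))) q) = p"
    using p block_unique[OF assms(3)] by (intro the_equality) auto
  moreover have "wall (x(k := a)) - {p} = wall x" using p by auto
  ultimately show "wall (x(k := a)) - {THE p. column p = k \<and> removable_block t n l i (wall (x(k := a))) p} = wall x"
    by simp
qed

lemma admissible_iff:
  assumes "adapted x"
  shows "admissible t n l i (wall x) k \<longleftrightarrow> (\<exists>a. step k i (x k) a \<and> right_ok x k a)"
proof
  assume "admissible t n l i (wall x) k"
  then show "\<exists>a. step k i (x k) a \<and> right_ok x k a"
    using admissible_slotE[OF assms] unfolding admissible_def by metis
next
  assume "\<exists>a. step k i (x k) a \<and> right_ok x k a"
  then show "admissible t n l i (wall x) k"
    using step_slot[OF assms] adapted_raise[OF assms] unfolding admissible_def by metis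
qed

lemma removable_iff:
  assumes "adapted x"
  shows "removable t n l i (wall x) k \<longleftrightarrow> (\<exists>a. step k i a (x k) \<and> fits (x (Suc k)) a)"
proof
  assume "removable t n l i (wall x) k"
  then show "\<exists>a. step k i a (x k) \<and> fits (x (Suc k)) a"
    using removable_blockE[OF assms] unfolding removable_def by metis
next
  assume "\<exists>a. step k i a (x k) \<and> fits (x (Suc k)) a"
  then obtain a where a: "step k i a (x k)" "fits (x (Suc k)) a" by blast
  have ad: "adapted (x(k := a))"
    using a adapted_shrink[OF assms] step_valid step_imp_le by blast
  have "(x(k := a))(k := x k) = x" by simp
  then obtain p where "column p = k" "removable_block t n l i (wall x) p"
    using step_slot[OF ad, of k i "x k"] a(1) assms by auto
  then show "removable t n l i (wall x) k" unfolding removable_def by blast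
qed

lemma twice_admissible_iff:
  assumes "adapted x"
  shows "twice_admissible t n l i (wall x) k \<longleftrightarrow>
    (\<exists>a b. step k i (x k) a \<and> right_ok x k a \<and> step k i a b \<and> right_ok x k b)"
proof -
  have ro: "right_ok (x(k := a)) k b = right_ok x k b" for a b
    by (auto simp: right_ok_def split: nat.splits)
  show ?thesis
  proof
    assume "twice_admissible t n l i (wall x) k"
    then obtain p where p: "column p = k" "admissible_slot t n l i (wall x) p"
      "admissible t n l i (insert p (wall x)) k" by (auto simp: twice_admissible_def)
    then obtain a where a: "step k i (x k) a" "right_ok x k a"
      "insert p (wall x) = wall (x(k := a))" "adapted (x(k := a))"
      using admissible_slotE[OF assms p(2)] by metis
    then obtain b where "step k i a b" "right_ok x k b"
      using p(3) admissible_iff[OF a(4), of i k] ro by auto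
    then show "\<exists>a b. step k i (x k) a \<and> right_ok x k a \<and> step k i a b \<and> right_ok x k b"
      using a by blast
  next
    assume "\<exists>a b. step k i (x k) a \<and> right_ok x k a \<and> step k i a b \<and> right_ok x k b"
    then obtain a b where ab: "step k i (x k) a" "right_ok x k a" "step k i a b" "right_ok x k b" by blast
    have ad: "adapted (x(k := a))" using ab adapted_raise[OF assms] by blast
    obtain p where "column p = k" "admissible_slot t n l i (wall x) p" "insert p (wall x) = wall (x(k := a))"
      using step_slot[OF assms ab(1) ad] by metis
    moreover have "admissible t n l i (wall (x(k := a))) k"
      using admissible_iff[OF ad, of i k] ab(3,4) ro[of a b] by (metis fun_upd_same)
    ultimately show "twice_admissible t n l i (wall x) k" unfolding twice_admissible_def by metis
  qed
qed

lemma twice_removable_iff: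
  assumes "adapted x"
  shows "twice_removable t n l i (wall x) k \<longleftrightarrow>
    (\<exists>a b. step k i a (x k) \<and> fits (x (Suc k)) a \<and> step k i b a \<and> fits (x (Suc k)) b)"
proof
  assume "twice_removable t n l i (wall x) k"
  then obtain p where p: "column p = k" "removable_block t n l i (wall x) p"
    "removable t n l i (wall x - {p}) k" by (auto simp: twice_removable_def)
  then obtain a where a: "step k i a (x k)" "fits (x (Suc k)) a"
    "wall x - {p} = wall (x(k := a))" "adapted (x(k := a))"
    using removable_blockE[OF assms p(2)] by metis
  then obtain b where "step k i b a" "fits (x (Suc k)) b"
    using p(3) removable_iff[OF a(4), of i k] by auto
  then show "\<exists>a b. step k i a (x k) \<and> fits (x (Suc k)) a \<and> step k i b a \<and> fits (x (Suc k)) b"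
    using a by blast
next
  assume "\<exists>a b. step k i a (x k) \<and> fits (x (Suc k)) a \<and> step k i b a \<and> fits (x (Suc k)) b"
  then obtain a b where ab: "step k i a (x k)" "fits (x (Suc k)) a" "step k i b a" "fits (x (Suc k)) b" by blast
  have ad: "adapted (x(k := a))"
    using ab adapted_shrink[OF assms] step_valid step_imp_le by blast
  have xx: "(x(k := a))(k := x k) = x" by simp
  obtain p where p: "column p = k" "removable_block t n l i (wall x) p"
    "insert p (wall (x(k := a))) = wall x" "p \<notin> wall (x(k := a))"
    using step_slot[OF ad, of k i "x k"] ab(1) assms unfolding xx by (metis fun_upd_same)
  then have "wall x - {p} = wall (x(k := a))" by auto
  moreover have "removable t n l i (wall (x(k := a))) k"
    using removable_iff[OF ad, of i k] ab(3,4) by (metis fun_upd_apply n_not_Suc_n)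
  ultimately show "twice_removable t n l i (wall x) k" using p unfolding twice_removable_def by metis
qed

section \<open>Signatures\<close>

definition minuses :: "nat \<Rightarrow> (nat \<Rightarrow> state) \<Rightarrow> nat \<Rightarrow> nat" where "minuses i x k = eps k i (x k)"
definition pluses :: "nat \<Rightarrow> (nat \<Rightarrow> state) \<Rightarrow> nat \<Rightarrow> nat" where "pluses i x k = phi k i (x k)"
text \<open>The signs that actually occur in a wall, after those blocked by the neighbours are left out.\<close>

definition free_minus :: "nat \<Rightarrow> (nat \<Rightarrow> state) \<Rightarrow> nat \<Rightarrow> nat" where
  "free_minus i x k = mcount k i (fits (x (Suc k))) (x k)"
definition free_plus :: "nat \<Rightarrow> (nat \<Rightarrow> state) \<Rightarrow> nat \<Rightarrow> nat" where
  "free_plus i x k = pcount k i (right_ok x k) (x k)"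

lemma adapted_valid: "adapted x \<Longrightarrow> valid (x k)"
  by (simp add: adapted_def pre_def)

lemma adapted_R: "adapted x \<Longrightarrow> fits (x (Suc k)) (x k)"
  by (simp add: adapted_def)

lemma free_signs:
  assumes "adapted x"
  shows "minuses i x k = free_minus i x k + (pluses i x (Suc k) - free_plus i x (Suc k))"
    and "pluses i x (Suc k) = free_plus i x (Suc k) + (pluses i x (Suc k) - free_plus i x (Suc k))"
    and "pluses i x 0 = free_plus i x 0"
proof -
  note b = blocked_pairs[OF adapted_R[OF assms, of k] adapted_valid[OF assms] adapted_valid[OF assms], of k i]
  have "right_ok x (Suc k) = (\<lambda>a. fits a (x k))" by (rule ext) (simp add: right_ok_def)
  then show "minuses i x k = free_minus i x k + (pluses i x (Suc k) - free_plus i x (Suc k))"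
    "pluses i x (Suc k) = free_plus i x (Suc k) + (pluses i x (Suc k) - free_plus i x (Suc k))"
    using b by (simp_all add: minuses_def pluses_def free_minus_def free_plus_def)
  have "right_ok x 0 a" for a by (simp add: right_ok_def)
  then show "pluses i x 0 = free_plus i x 0"
    by (cases rule: phi_cases[OF adapted_valid[OF assms, of 0], of 0 i])
      (simp_all add: pluses_def free_plus_def)
qed

lemma column_signs_eq:
  assumes "adapted x"
  shows "map (Pair k) (column_signs t n l i (wall x) k) = block (free_minus i x) (free_plus i x) k"
proof -
  have "pluses i x k + minuses i x k \<le> 2" using phi_eps_le_2[OF adapted_valid[OF assms]] by (simp add: pluses_def minuses_def)
  moreover have "free_minus i x k \<le> minuses i x k" using free_signs(1)[OF assms, of i k] by simp
  moreover have "free_plus i x k \<le> pluses i x k"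
    using free_signs(2)[OF assms, of i "k - 1"] free_signs(3)[OF assms, of i] by (cases k) auto
  ultimately have le: "free_plus i x k + free_minus i x k \<le> 2" by linarith
  have ta: "twice_admissible t n l i (wall x) k \<Longrightarrow> admissible t n l i (wall x) k"
    unfolding twice_admissible_iff[OF assms] admissible_iff[OF assms] by blast
  have tr: "twice_removable t n l i (wall x) k \<Longrightarrow> removable t n l i (wall x) k"
    unfolding twice_removable_iff[OF assms] removable_iff[OF assms] by blast
  have p: "free_plus i x k = (if admissible t n l i (wall x) k then
      if twice_admissible t n l i (wall x) k then 2 else 1 else 0)"
    unfolding twice_admissible_iff[OF assms] admissible_iff[OF assms] free_plus_def pcount_def ..
  have m: "free_minus i x k = (if removable t n l i (wall x) k then
      if twice_removable t n l i (wall x) k then 2 else 1 else 0)"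
    unfolding twice_removable_iff[OF assms] removable_iff[OF assms] free_minus_def mcount_def ..
  show ?thesis using le ta tr unfolding block_def p m column_signs_def once_removable_def once_admissible_def
    by (cases "admissible t n l i (wall x) k"; cases "removable t n l i (wall x) k";
        cases "twice_admissible t n l i (wall x) k"; cases "twice_removable t n l i (wall x) k")
      (simp_all add: numeral_2_eq_2)
qed

definition ground_from :: "(nat \<Rightarrow> state) \<Rightarrow> nat \<Rightarrow> bool" where
  "ground_from x K \<longleftrightarrow> (\<forall>k\<ge>K. x k = g k)"

lemma ground_from_exists: "pre x \<Longrightarrow> \<exists>K. ground_from x K"
proof -
  assume "pre x"
  then obtain K where "\<forall>k\<in>{k. x k \<noteq> g k}. k < K"
    unfolding pre_def using finite_nat_set_iff_bounded by blast
  then show ?thesis unfolding ground_from_def by (intro exI[of _ K]) (auto simp: not_less[symmetric])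
qed

text \<open>Far to the left nothing can be removed, because the left neighbour is the ground state. All
  pluses are blocked too: a ground column has as many of them as its right neighbour has minuses, and
  these are blocked.\<close>

lemma ground_signs:
  assumes "adapted x" "ground_from x K" "i \<le> n" "K \<le> k"
  shows "free_minus i x k = 0" "free_plus i x (Suc k) = 0"
proof -
  have x: "x k = g k" "x (Suc k) = g (Suc k)" using assms by (auto simp: ground_from_def)
  have "\<not> (step k i a (g k) \<and> fits (g (Suc k)) a)" for a
  proof
    assume a: "step k i a (g k) \<and> fits (g (Suc k)) a"
    then have "le (g k) a" "le a (g k)" using g_next step_valid step_imp_le by blast+
    then have "a = g k" using le_antisym by blast
    then show False using a step_phi_eps(1)[of k i a "g k"] by simp
  qed
  then show "free_minus i x k = 0" by (auto simp: free_minus_def mcount_def x)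
  then show "free_plus i x (Suc k) = 0"
    using free_signs(1,2)[OF assms(1), of i k] g_phi[OF assms(3), of k] by (simp add: minuses_def pluses_def x)
qed

lemma concat_replicate_Nil: "(\<And>y. y \<in> set ys \<Longrightarrow> f y = []) \<Longrightarrow> concat (map f ys) = []"
  by (induction ys) auto

lemma sign_sequence_eq:
  assumes "adapted x" "ground_from x K" "i \<le> n" "K < N"
  shows "sign_sequence t n l i (wall x) = blocks (free_minus i x) (free_plus i x) 0 N"
proof -
  let ?s = "column_signs t n l i (wall x)"
  let ?b = "block (free_minus i x) (free_plus i x)"
  have sb: "map (Pair k) (?s k) = ?b k" for k by (rule column_signs_eq[OF assms(1)])
  have "?s k = []" if Nk: "N \<le> k" for k
  proof -
    obtain k' where k: "k = Suc k'" "K \<le> k'" using Nk assms(4) by (cases k) auto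
    have "free_minus i x k = 0" "free_plus i x k = 0"
      using ground_signs[OF assms(1-3)] k by auto
    then have "?b k = []" by (simp add: block_def)
    then show ?thesis using sb[of k] by simp
  qed
  then have N: "\<forall>k\<ge>N. ?s k = []" by blast
  define N0 where "N0 = (LEAST N. \<forall>k\<ge>N. ?s k = [])"
  have N0: "\<forall>k\<ge>N0. ?s k = []" unfolding N0_def using N by (rule LeastI)
  have "N0 \<le> N" unfolding N0_def using N by (rule Least_le)
  then have "rev [0..<N] = rev [N0..<N] @ rev [0..<N0]"
    by (metis le0 le_add_diff_inverse rev_append upt_add_eq_append)
  moreover have "concat (map ?b (rev [N0..<N])) = []"
    using N0 by (intro concat_replicate_Nil) (auto simp: sb[symmetric])
  ultimately show ?thesis
    by (simp add: sign_sequence_def blocks_def sb Let_def flip: N0_def)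
qed

text \<open>The signature of a wall can be computed from the columns without regard to their neighbours,
  because blocked signs form cancelling pairs. The finite sequence stops at a ground column \<open>N\<close>,
  whose minuses are blocked by the column to its left and hence appear in addition.\<close>

lemma signature_eq:
  assumes "adapted x" "ground_from x K" "i \<le> n" "K \<le> N"
  shows "cancelled (blocks (minuses i x) (pluses i x) 0 (Suc N)) =
    replicate (minuses i x N) (N, Sign_Minus) @ signature t n l i (wall x)"
proof -
  have "signature t n l i (wall x) = cancelled (blocks (free_minus i x) (free_plus i x) 0 (Suc N))"
    using sign_sequence_eq[OF assms(1-3), of "Suc N"] assms(4) by (simp add: signature_def cancelled_def)
  moreover have "minuses i x N = pluses i x (Suc N) - free_plus i x (Suc N)"
    using free_signs(1)[OF assms(1), of i N] ground_signs(1)[OF assms] by simp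
  ultimately show ?thesis
    using cancelled_blocks_struck[of "minuses i x" "free_minus i x" "\<lambda>k. pluses i x (Suc k) - free_plus i x (Suc k)"
       "pluses i x" "free_plus i x" N] free_signs[OF assms(1), of i] by simp
qed

end

context wall_pattern
begin

section \<open>Kashiwara operators on sequences\<close>

text \<open>One arrow of the crystal, from \<open>x\<close> to \<open>x'\<close>. The last two conditions say that the sign of column \<open>k\<close> that
  changes from plus to minus survives the cancellation. They read the same from both ends of
  the arrow, so the two operators are inverse to each other by construction.\<close>

definition move :: "nat \<Rightarrow> nat \<Rightarrow> (nat \<Rightarrow> state) \<Rightarrow> (nat \<Rightarrow> state) \<Rightarrow> bool" where
  "move i k x x' \<longleftrightarrow> adapted x \<and> adapted x' \<and> x' = x(k := x' k) \<and> step k i (x k) (x' k) \<and>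
     (\<exists>K>k. \<forall>N\<ge>K. all_minus (cancelled (left_part (minuses i x) (pluses i x) k N))) \<and>
     all_plus (cancelled (right_part (minuses i x) (pluses i x') k))"

lemma blocks_cong:
  "(\<And>j. k \<le> j \<Longrightarrow> E1 j = E2 j \<and> F1 j = F2 j) \<Longrightarrow> blocks E1 F1 k N = blocks E2 F2 k N"
  "(\<And>j. j < N \<Longrightarrow> E1 j = E2 j \<and> F1 j = F2 j) \<Longrightarrow> blocks E1 F1 k N = blocks E2 F2 k N"
  by (auto simp: blocks_def block_def intro!: arg_cong[of _ _ concat] map_cong)

lemma left_part_cong:
  assumes "E1 k = E2 k" "\<And>j. k < j \<Longrightarrow> E1 j = E2 j \<and> F1 j = F2 j"
  shows "left_part E1 F1 k N = left_part E2 F2 k N"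
  unfolding left_part_def using blocks_cong(1)[of "Suc k" E1 E2 F1 F2 N] assms by simp

lemma right_part_cong:
  assumes "F1 k = F2 k" "\<And>j. j < k \<Longrightarrow> E1 j = E2 j \<and> F1 j = F2 j"
  shows "right_part E1 F1 k = right_part E2 F2 k"
  unfolding right_part_def using blocks_cong(2)[of k E1 E2 F1 F2 0] assms by simp

lemma move_blocks:
  assumes "move i k x x'" "k < N"
  shows "blocks (minuses i x) (pluses i x) 0 N =
      left_part (minuses i x) (pluses i x) k N @ (k, Sign_Plus) # right_part (minuses i x) (pluses i x') k"
    and "blocks (minuses i x') (pluses i x') 0 N =
      left_part (minuses i x) (pluses i x) k N @ (k, Sign_Minus) # right_part (minuses i x) (pluses i x') k"
proof -
  have s: "step k i (x k) (x' k)" and x': "x' = x(k := x' k)" using assms by (auto simp: move_def)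
  have o: "x' j = x j" if "j \<noteq> k" for j using x' that by (metis fun_upd_other)
  have Fk: "pluses i x k = Suc (pluses i x' k)" and Ek: "minuses i x' k = Suc (minuses i x k)"
    using step_phi_eps[OF s] by (simp_all add: minuses_def pluses_def)
  have "right_part (minuses i x) ((pluses i x)(k := pluses i x' k)) k = right_part (minuses i x) (pluses i x') k"
    by (rule right_part_cong) (simp_all add: pluses_def o)
  then show "blocks (minuses i x) (pluses i x) 0 N =
      left_part (minuses i x) (pluses i x) k N @ (k, Sign_Plus) # right_part (minuses i x) (pluses i x') k"
    using blocks_at_plus[of k N "pluses i x" "pluses i x' k" "minuses i x"] assms Fk by simp
  have "left_part ((minuses i x')(k := minuses i x k)) (pluses i x') k N = left_part (minuses i x) (pluses i x) k N"
    by (rule left_part_cong) (simp_all add: pluses_def minuses_def o)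
  moreover have "right_part (minuses i x') (pluses i x') k = right_part (minuses i x) (pluses i x') k"
    by (rule right_part_cong) (simp_all add: minuses_def o)
  ultimately show "blocks (minuses i x') (pluses i x') 0 N =
      left_part (minuses i x) (pluses i x) k N @ (k, Sign_Minus) # right_part (minuses i x) (pluses i x') k"
    using blocks_at_minus[of k N "minuses i x'" "minuses i x k" "pluses i x'"] assms Ek by simp
qed

text \<open>An arrow of the wall is an arrow for each pair of neighbouring columns, by the rule for two
  factors.\<close>

lemma move_neighbours:
  assumes "move i k x x'"
  shows "phi (Suc k) i (x (Suc k)) \<le> eps k i (x k)"
    and "k = Suc j \<Longrightarrow> eps j i (x j) < phi k i (x k)"
proof -
  obtain K where K: "K > k" "\<forall>N\<ge>K. all_minus (cancelled (left_part (minuses i x) (pluses i x) k N))"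
    using assms by (auto simp: move_def)
  have "K \<le> Suc K" by simp
  with K(2) have "all_minus (cancelled (left_part (minuses i x) (pluses i x) k (Suc K)))" by blast
  from left_part_all_minus[OF this] show "phi (Suc k) i (x (Suc k)) \<le> eps k i (x k)"
    using K(1) by (simp add: minuses_def pluses_def)
  assume k: "k = Suc j"
  have "all_plus (cancelled (right_part (minuses i x) (pluses i x') (Suc j)))" using assms k by (simp add: move_def)
  from right_part_all_plus[OF this] have "eps j i (x j) \<le> phi k i (x' k)"
    using k by (simp add: minuses_def pluses_def)
  then show "eps j i (x j) < phi k i (x k)"
    using step_phi_eps(1)[of k i "x k" "x' k"] assms by (simp add: move_def)
qed

lemma ground_from_mono: "ground_from x K \<Longrightarrow> K \<le> K' \<Longrightarrow> ground_from x K'"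
  by (auto simp: ground_from_def)

lemma signature_form:
  obtains P Q where "signature t n l i Y = P @ Q" "all_minus P" "all_plus Q"
    "minus_columns t n l i Y = map fst P" "plus_columns t n l i Y = map fst Q"
proof -
  obtain P Q where PQ: "signature t n l i Y = P @ Q" "all_minus P" "all_plus Q"
    using cancelled_form[of "sign_sequence t n l i Y"] by (auto simp: signature_def cancelled_def)
  have "filter (\<lambda>x. snd x = Sign_Minus) (P @ Q) = P" "filter (\<lambda>x. snd x = Sign_Plus) (P @ Q) = Q"
    using PQ(2,3) by (auto simp: filter_id_conv filter_empty_conv)
  then show ?thesis using that[OF PQ] by (simp add: minus_columns_def plus_columns_def PQ(1))
qed

lemma f_op_move:
  assumes "adapted x" "i \<le> n" "f_op t n l i (wall x) = Some Y"
  shows "\<exists>k x'. move i k x x' \<and> Y = wall x'"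
proof -
  obtain P Q where PQ: "signature t n l i (wall x) = P @ Q" "all_minus P" "all_plus Q"
    "plus_columns t n l i (wall x) = map fst Q" using signature_form by metis
  have "Q \<noteq> []" using assms(3) PQ by (auto simp: f_op_def)
  then obtain q Q' where Q: "Q = q # Q'" by (cases Q) auto
  obtain k where q: "q = (k, Sign_Plus)" using PQ(3) Q by (cases q) auto
  obtain K where K: "ground_from x K" using ground_from_exists adapted_pre assms(1) by blast
  let ?E = "minuses i x" and ?F = "pluses i x"
  have around: "k < Suc N \<and> ?F k > 0 \<and> all_minus (cancelled (left_part ?E ?F k (Suc N)))
      \<and> all_plus (cancelled (right_part ?E (?F(k := ?F k - 1)) k))" if "K \<le> N" for N
  proof -
    have "cancelled (blocks ?E ?F 0 (Suc N)) = (replicate (?E N) (N, Sign_Minus) @ P) @ (k, Sign_Plus) # Q'"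
      using signature_eq[OF assms(1) K assms(2) that] PQ(1) Q q by simp
    note c = this
    have m: "all_minus (replicate (?E N) (N, Sign_Minus) @ P)" "all_plus Q'"
      using PQ(2,3) Q by auto
    have s: "k < Suc N" "?F k > 0" "cancelled (left_part ?E ?F k (Suc N)) = replicate (?E N) (N, Sign_Minus) @ P"
      "cancelled (right_part ?E (?F(k := ?F k - 1)) k) = Q'"
      using surviving_plus[OF c m] by blast+
    show ?thesis unfolding s(3,4) using s(1,2) m by blast
  qed
  have "?F k > 0" using around[of K] by simp
  then obtain a where a: "step k i (x k) a"
    using phi_step[OF adapted_valid[OF assms(1)], of k i k] by (auto simp: pluses_def)
  define x' where "x' = x(k := a)"
  have F': "pluses i x' k = ?F k - 1" using step_phi_eps(1)[OF a] by (simp add: pluses_def x'_def)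
  have rp: "all_plus (cancelled (right_part ?E (pluses i x') k))"
  proof -
    have "right_part ?E (pluses i x') k = right_part ?E (?F(k := ?F k - 1)) k"
      by (rule right_part_cong) (simp_all add: F', simp_all add: pluses_def x'_def)
    then show ?thesis using around[of K] by simp
  qed
  have "right_ok x k a"
  proof (cases k)
    case (Suc j)
    have "?E j \<le> pluses i x' k" using right_part_all_plus[of ?E "pluses i x'" j] rp Suc by simp
    then have "eps j i (x j) < phi (Suc j) i (x (Suc j))"
      using F' \<open>?F k > 0\<close> Suc by (simp add: minuses_def pluses_def)
    then show ?thesis using fits_step_left[of "x (Suc j)" "x j" j i a] adapted_R[OF assms(1), of j]
        adapted_valid[OF assms(1), of j] a Suc by (simp add: right_ok_def)
  qed (simp add: right_ok_def)
  then have ad: "adapted x'" using adapted_raise[OF assms(1) a] by (simp add: x'_def)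
  have "move i k x x'" unfolding move_def
  proof (intro conjI)
    show "\<exists>L>k. \<forall>N\<ge>L. all_minus (cancelled (left_part ?E ?F k N))"
    proof (intro exI[of _ "Suc (max K k)"] conjI allI impI)
      fix N assume "Suc (max K k) \<le> N"
      then obtain N' where "N = Suc N'" "K \<le> N'" by (cases N) auto
      then show "all_minus (cancelled (left_part ?E ?F k N))" using around by blast
    qed auto
  qed (use assms(1) ad a rp in \<open>simp_all add: x'_def\<close>)
  moreover have "hd (plus_columns t n l i (wall x)) = k" "plus_columns t n l i (wall x) \<noteq> []"
    using PQ(4) Q q by auto
  then have "Y = wall x'"
    using assms(3) raise_wall(1)[OF assms(1) a] ad by (simp add: f_op_def x'_def Let_def)
  ultimately show ?thesis by blast
qed

lemma e_op_move:
  assumes "adapted x'" "i \<le> n" "e_op t n l i (wall x') = Some Y"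
  shows "\<exists>k x. move i k x x' \<and> Y = wall x"
proof -
  obtain P Q where PQ: "signature t n l i (wall x') = P @ Q" "all_minus P" "all_plus Q"
    "minus_columns t n l i (wall x') = map fst P" using signature_form by metis
  have "P \<noteq> []" using assms(3) PQ by (auto simp: e_op_def)
  then obtain q P' where P: "P = P' @ [q]" by (cases P rule: rev_cases) auto
  obtain k where q: "q = (k, Sign_Minus)" using PQ(2) P by (cases q) auto
  obtain K where K: "ground_from x' K" using ground_from_exists adapted_pre assms(1) by blast
  let ?E = "minuses i x'" and ?F = "pluses i x'"
  have around: "k < Suc N \<and> ?E k > 0 \<and> all_minus (cancelled (left_part (?E(k := ?E k - 1)) ?F k (Suc N)))
      \<and> all_plus (cancelled (right_part ?E ?F k))" if "K \<le> N" for N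
  proof -
    have "cancelled (blocks ?E ?F 0 (Suc N)) = (replicate (?E N) (N, Sign_Minus) @ P') @ (k, Sign_Minus) # Q"
      using signature_eq[OF assms(1) K assms(2) that] PQ(1) P q by simp
    note c = this
    have m: "all_minus (replicate (?E N) (N, Sign_Minus) @ P')" "all_plus Q"
      using PQ(2,3) P by auto
    have s: "k < Suc N" "?E k > 0" "cancelled (left_part (?E(k := ?E k - 1)) ?F k (Suc N)) = replicate (?E N) (N, Sign_Minus) @ P'"
      "cancelled (right_part ?E ?F k) = Q"
      using surviving_minus[OF c m] by blast+
    show ?thesis unfolding s(3,4) using s(1,2) m by blast
  qed
  have "?E k > 0" using around[of K] by simp
  then obtain a where a: "step k i a (x' k)"
    using eps_step[OF adapted_valid[OF assms(1)], of k i k] by (auto simp: minuses_def)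
  define x where "x = x'(k := a)"
  have E': "minuses i x k = ?E k - 1" using step_phi_eps(2)[OF a] by (simp add: minuses_def x_def)
  have lp: "all_minus (cancelled (left_part (minuses i x) (pluses i x) k (Suc N)))" if "K \<le> N" for N
  proof -
    have "left_part (minuses i x) (pluses i x) k (Suc N) = left_part (?E(k := ?E k - 1)) ?F k (Suc N)"
      by (rule left_part_cong) (simp_all add: E', simp_all add: pluses_def minuses_def x_def)
    then show ?thesis using around[OF that] by simp
  qed
  have rp: "all_plus (cancelled (right_part (minuses i x) ?F k))"
  proof -
    have "right_part (minuses i x) ?F k = right_part ?E ?F k"
      by (rule right_part_cong) (simp_all add: minuses_def x_def)
    then show ?thesis using around[of K] by simp
  qed
  have "pluses i x (Suc k) \<le> minuses i x k" using left_part_all_minus[OF lp[of "max K (Suc k)"]] by simp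
  then have "phi (Suc k) i (x' (Suc k)) < eps k i (x' k)"
    using E' \<open>?E k > 0\<close> by (simp add: minuses_def pluses_def x_def)
  then have "fits (x' (Suc k)) a"
    using fits_step_right[of "x' (Suc k)" "x' k" k i a] adapted_R[OF assms(1)] adapted_valid[OF assms(1)] a
    by blast
  then have ad: "adapted x"
    using adapted_shrink[OF assms(1)] step_valid[OF a] step_imp_le[OF a] by (simp add: x_def)
  have xx': "x(k := x' k) = x'" and xk: "x k = a" by (simp_all add: x_def)
  have "move i k x x'" unfolding move_def
  proof (intro conjI)
    show "\<exists>L>k. \<forall>N\<ge>L. all_minus (cancelled (left_part (minuses i x) (pluses i x) k N))"
    proof (intro exI[of _ "Suc (max K k)"] conjI allI impI)
      fix N assume "Suc (max K k) \<le> N"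
      then obtain N' where "N = Suc N'" "K \<le> N'" by (cases N) auto
      then show "all_minus (cancelled (left_part (minuses i x) (pluses i x) k N))" using lp by blast
    qed auto
  qed (use assms(1) ad a rp in \<open>simp_all add: xx' xk\<close>)
  moreover have "last (minus_columns t n l i (wall x')) = k" "minus_columns t n l i (wall x') \<noteq> []"
    using PQ(4) P q by auto
  then have "Y = wall x"
    using assms(3) raise_wall(2)[of x k i "x' k"] ad a assms(1) unfolding xx' xk
    by (simp add: e_op_def Let_def)
  ultimately show ?thesis by blast
qed

lemma move_op:
  assumes "move i k x x'" "i \<le> n"
  shows "f_op t n l i (wall x) = Some (wall x')" "e_op t n l i (wall x') = Some (wall x)"
    "length (minus_columns t n l i (wall x')) = Suc (length (minus_columns t n l i (wall x)))"
    "length (plus_columns t n l i (wall x)) = Suc (length (plus_columns t n l i (wall x')))"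
proof -
  have ad: "adapted x" "adapted x'" and s: "step k i (x k) (x' k)" and x': "x(k := x' k) = x'"
    and rp: "all_plus (cancelled (right_part (minuses i x) (pluses i x') k))"
    using assms(1) by (auto simp: move_def)
  obtain K0 where K0: "K0 > k" "\<forall>N\<ge>K0. all_minus (cancelled (left_part (minuses i x) (pluses i x) k N))"
    using assms(1) by (auto simp: move_def)
  obtain K1 K2 where K12: "ground_from x K1" "ground_from x' K2"
    using ground_from_exists adapted_pre ad by metis
  define N where "N = max K0 (max K1 K2)"
  define L where "L = cancelled (left_part (minuses i x) (pluses i x) k (Suc N))"
  define Q where "Q = cancelled (right_part (minuses i x) (pluses i x') k)"
  have kN: "k < Suc N" "k \<noteq> N" using K0(1) by (auto simp: N_def)
  have "K0 \<le> Suc N" by (simp add: N_def)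
  then have L: "all_minus L" using K0(2) unfolding L_def by blast
  have Q: "all_plus Q" using rp by (simp add: Q_def)
  have EN: "minuses i x' N = minuses i x N" using x' kN(2) unfolding minuses_def by (metis fun_upd_other)
  have c1: "L @ (k, Sign_Plus) # Q = replicate (minuses i x N) (N, Sign_Minus) @ signature t n l i (wall x)"
    using cancelled_at_survivor[OF L[unfolded L_def] rp] move_blocks(1)[OF assms(1) kN(1)]
      signature_eq[OF ad(1) K12(1) assms(2), of N] by (simp add: L_def Q_def N_def)
  have c2: "L @ (k, Sign_Minus) # Q = replicate (minuses i x N) (N, Sign_Minus) @ signature t n l i (wall x')"
    using cancelled_at_survivor[OF L[unfolded L_def] rp] move_blocks(2)[OF assms(1) kN(1)]
      signature_eq[OF ad(2) K12(2) assms(2), of N] EN by (simp add: L_def Q_def N_def)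
  have fL: "filter (\<lambda>x. snd x = Sign_Minus) L = L" "filter (\<lambda>x. snd x = Sign_Plus) L = []"
    using L by (auto simp: filter_id_conv filter_empty_conv)
  have fQ: "filter (\<lambda>x. snd x = Sign_Minus) Q = []" "filter (\<lambda>x. snd x = Sign_Plus) Q = Q"
    using Q by (auto simp: filter_id_conv filter_empty_conv)
  have fr: "filter (\<lambda>x. snd x = Sign_Minus) (replicate e (N, Sign_Minus)) = replicate e (N, Sign_Minus)"
    "filter (\<lambda>x. snd x = Sign_Plus) (replicate e (N, Sign_Minus)) = []" for e
    by (auto simp: filter_id_conv filter_empty_conv)
  have p1: "plus_columns t n l i (wall x) = k # map fst Q"
    using arg_cong[OF c1, of "\<lambda>xs. map fst (filter (\<lambda>x. snd x = Sign_Plus) xs)"]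
    by (simp add: plus_columns_def fL fQ fr)
  have p2: "plus_columns t n l i (wall x') = map fst Q"
    using arg_cong[OF c2, of "\<lambda>xs. map fst (filter (\<lambda>x. snd x = Sign_Plus) xs)"]
    by (simp add: plus_columns_def fL fQ fr)
  have m1: "map fst L = replicate (minuses i x N) N @ minus_columns t n l i (wall x)"
    using arg_cong[OF c1, of "\<lambda>xs. map fst (filter (\<lambda>x. snd x = Sign_Minus) xs)"]
    by (simp add: minus_columns_def fL fQ fr)
  have m2: "map fst L @ [k] = replicate (minuses i x N) N @ minus_columns t n l i (wall x')"
    using arg_cong[OF c2, of "\<lambda>xs. map fst (filter (\<lambda>x. snd x = Sign_Minus) xs)"]
    by (simp add: minus_columns_def fL fQ fr)
  have m3: "minus_columns t n l i (wall x') = minus_columns t n l i (wall x) @ [k]"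
    using m2 unfolding m1 by simp
  show "length (minus_columns t n l i (wall x')) = Suc (length (minus_columns t n l i (wall x)))"
    by (simp add: m3)
  show "length (plus_columns t n l i (wall x)) = Suc (length (plus_columns t n l i (wall x')))"
    by (simp add: p1 p2)
  note r = raise_wall[OF ad(1) s, unfolded x', OF ad(2)]
  show "f_op t n l i (wall x) = Some (wall x')" using r(1) by (simp add: f_op_def p1)
  show "e_op t n l i (wall x') = Some (wall x)" using r(2) by (simp add: e_op_def m3)
qed

section \<open>Weights\<close>

definition added :: "(nat \<Rightarrow> state) \<Rightarrow> nat \<Rightarrow> nat" where
  "added x j = card {p \<in> wall x - ground_wall t n l. colour t n l p = j}"

lemma add_colour_le: "add z s a b \<Longrightarrow> colour_at k z s \<le> n"
  using add_pts colour_at_le by blast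

lemma added_upd:
  assumes "pre x" "add z s (x k) a"
  shows "added (x(k := a)) j = added x j + of_bool (colour_at k z s = j)"
proof -
  let ?p = "Place k (nat (z + int (off k))) s"
  note w = wall_upd_add[OF assms]
  have "?p \<notin> ground_wall t n l" using w(1) ground_subset[OF assms(1)] by blast
  then have "{p \<in> wall (x(k := a)) - ground_wall t n l. colour t n l p = j} =
     (if colour_at k z s = j then insert ?p {p \<in> wall x - ground_wall t n l. colour t n l p = j}
      else {p \<in> wall x - ground_wall t n l. colour t n l p = j})"
    unfolding w(2) using w(3) by auto
  moreover have "finite {p \<in> wall x - ground_wall t n l. colour t n l p = j}"
    using added_finite[OF assms(1)] by (rule rev_finite_subset) blast
  ultimately show ?thesis using w(1) by (simp add: added_def)
qed

text \<open>By \<open>step_weight\<close> the weight changes correctly with each block. For the ground-state wall the sum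
  telescopes to \<open>phi\<close> of the rightmost column, because neighbouring ground states satisfy
  $\varphi_i(g_{k+1}) = \varepsilon_i(g_k)$. The induction takes away one block at a time, from
  any column, so its statement is about sequences that need not be adapted.\<close>

lemma weight_sum:
  assumes "pre x" "ground_from x (Suc N)" "i \<le> n"
  shows "(\<Sum>k\<le>N. int (phi k i (x k)) - int (eps k i (x k))) + int (eps N i (g N)) =
    of_bool (i = l) - (\<Sum>j\<in>{0..n}. int (added x j) * cartan t n i j)"
  using assms(1,2)
proof (induction "card (wall x - ground_wall t n l)" arbitrary: x rule: less_induct)
  case less
  show ?case
  proof (cases "x = g")
    case True
    have "(\<Sum>k\<le>M. int (phi k i (g k)) - int (eps k i (g k))) + int (eps M i (g M)) = of_bool (i = l)" for M
    proof (induction M)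
      case 0
      then show ?case using g_phi_0[OF assms(3)] by simp
    next
      case (Suc M)
      then show ?case using g_phi[OF assms(3), of M] by simp
    qed
    moreover have "added g j = 0" for j by (simp add: added_def wall_ground)
    ultimately show ?thesis using True by simp
  next
    case False
    then obtain k where k: "x k \<noteq> g k" by blast
    have v: "valid (x k)" "le (g k) (x k)" using less.prems(1) by (auto simp: pre_def)
    \<comment> \<open>Any column that is not in its ground state may lose a block here.\<close>
    obtain b z s where b: "add z s b (x k)" "le (g k) b"
      using remove_above[OF g_valid v(1) v(2)] k by metis
    define y where "y = x(k := b)"
    have y: "pre y" unfolding y_def using less.prems(1) b add_valid by (intro pre_upd) auto
    have kN: "k \<le> N" using k less.prems(2) unfolding ground_from_def by (metis not_less_eq_eq)
    have yN: "ground_from y (Suc N)" using less.prems(2) kN by (auto simp: ground_from_def y_def)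
    have yx: "y(k := x k) = x" and yk: "y k = b" by (simp_all add: y_def)
    note w = wall_upd_add[OF y, of z s k "x k", unfolded yx yk, OF b(1)]
    have "wall y - ground_wall t n l \<subset> wall x - ground_wall t n l"
      using w(1,2) ground_subset[OF y] by blast
    then have "card (wall y - ground_wall t n l) < card (wall x - ground_wall t n l)"
      using psubset_card_mono added_finite less.prems(1) by metis
    note IH = less.hyps[OF this y yN]
    let ?j = "colour_at k z s"
    have st: "step k ?j b (x k)" using b by (auto simp: step_def)
    have jn: "?j \<le> n" using b(1) by (rule add_colour_le)
    have "(\<Sum>m\<le>N. int (phi m i (y m)) - int (eps m i (y m))) =
       (\<Sum>m\<le>N. (int (phi m i (x m)) - int (eps m i (x m))) + (if m = k then cartan t n i ?j else 0))"
      by (rule sum.cong) (use step_weight[OF st assms(3)] in \<open>auto simp: y_def\<close>)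
    also have "\<dots> = (\<Sum>m\<le>N. int (phi m i (x m)) - int (eps m i (x m))) + cartan t n i ?j"
      using kN by (simp add: sum.distrib sum.delta)
    finally have 1: "(\<Sum>m\<le>N. int (phi m i (y m)) - int (eps m i (y m))) =
      (\<Sum>m\<le>N. int (phi m i (x m)) - int (eps m i (x m))) + cartan t n i ?j" .
    have "added x j = added y j + of_bool (?j = j)" for j
      using added_upd[OF y, of z s k "x k" j, unfolded yx yk, OF b(1)] .
    then have "(\<Sum>j\<in>{0..n}. int (added x j) * cartan t n i j) =
      (\<Sum>j\<in>{0..n}. int (added y j) * cartan t n i j + (if j = ?j then cartan t n i j else 0))"
      by (intro sum.cong) (auto simp: distrib_right)
    also have "\<dots> = (\<Sum>j\<in>{0..n}. int (added y j) * cartan t n i j) + cartan t n i ?j"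
      using jn by (simp add: sum.distrib sum.delta)
    finally show ?thesis using 1 IH by simp
  qed
qed

lemma phi_minus_eps:
  assumes "adapted x" "i \<le> n"
  shows "int (length (plus_columns t n l i (wall x))) - int (length (minus_columns t n l i (wall x)))
    = wall_wt t n l (wall x) (Coroot i)"
proof -
  obtain K where K: "ground_from x K" using ground_from_exists adapted_pre assms(1) by blast
  have "balance (cancelled (blocks (minuses i x) (pluses i x) 0 (Suc K))) =
     balance (signature t n l i (wall x)) - int (minuses i x K)"
    using signature_eq[OF assms(1) K assms(2) order_refl] by simp
  moreover have "minuses i x K = eps K i (g K)" using K by (simp add: minuses_def ground_from_def)
  moreover have "balance (signature t n l i (wall x)) =
     int (length (plus_columns t n l i (wall x))) - int (length (minus_columns t n l i (wall x)))"
    by (simp add: balance_filter plus_columns_def minus_columns_def)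
  ultimately have "int (length (plus_columns t n l i (wall x))) - int (length (minus_columns t n l i (wall x)))
    = (\<Sum>k<Suc K. int (phi k i (x k)) - int (eps k i (x k))) + int (eps K i (g K))"
    by (simp only: balance_cancelled balance_blocks minuses_def pluses_def)
  also have "\<dots> = of_bool (i = l) - (\<Sum>j\<in>{0..n}. int (added x j) * cartan t n i j)"
    using weight_sum[OF adapted_pre[OF assms(1)] ground_from_mono[OF K] assms(2), of K]
    by (simp add: lessThan_Suc_atMost)
  finally show ?thesis by (simp add: wall_wt_def added_def of_bool_def)
qed

lemma wt_move:
  assumes "move i k x x'" "i \<le> n"
  shows "wall_wt t n l (wall x') = (\<lambda>c. wall_wt t n l (wall x) c - simple_root (cartan t n) i c)"
proof
  fix c
  have x: "pre x" "x(k := x' k) = x'" using assms(1) by (auto simp: move_def adapted_def)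
  obtain z s where zs: "add z s (x k) (x' k)" "colour_at k z s = i"
    using assms(1) by (auto simp: move_def step_def)
  have "added x' j = added x j + of_bool (i = j)" for j
    using added_upd[OF x(1) zs(1), of j] x(2) zs(2) by simp
  then have "(\<Sum>j\<in>{0..n}. int (added x' j) * simple_root (cartan t n) j c) =
     (\<Sum>j\<in>{0..n}. int (added x j) * simple_root (cartan t n) j c + (if j = i then simple_root (cartan t n) j c else 0))"
    by (intro sum.cong) (auto simp: distrib_right)
  also have "\<dots> = (\<Sum>j\<in>{0..n}. int (added x j) * simple_root (cartan t n) j c) + simple_root (cartan t n) i c"
    using assms(2) by (simp add: sum.distrib sum.delta)
  finally show "wall_wt t n l (wall x') c = wall_wt t n l (wall x) c - simple_root (cartan t n) i c"
    by (simp add: wall_wt_def added_def)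
qed

lemma wt_lattice: "wall_wt t n l Y \<in> weight_lattice n"
  using l_le by (auto simp: weight_lattice_def wall_wt_def cartan_def)

section \<open>Removable null roots\<close>

definition diff :: "state \<Rightarrow> state \<Rightarrow> (int \<times> part) set" where
  "diff a b = {(z, s). s \<in> parts_at z \<and> filled b z s \<and> \<not> filled a z s}"

definition coloured :: "nat \<Rightarrow> nat \<Rightarrow> (int \<times> part) set \<Rightarrow> (int \<times> part) set" where
  "coloured k j D = {(z, s) \<in> D. colour_at k z s = j}"

lemma diff_finite: "finite (diff a b)"
  by (rule finite_subset[of _ "{fst a..fst b} \<times> {Whole, Back, Front}"])
    (auto simp: diff_def filled_def, (metis part.exhaust)+)

lemma coloured_finite: "finite (coloured k j (diff a b))"
  by (rule finite_subset[OF _ diff_finite[of a b]]) (auto simp: coloured_def)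

lemma card_parts: "card {s \<in> parts_at z. colour_at k z s = j} = mult j (lev k z)"
proof (cases "split_at z")
  case True
  then obtain b f where bf: "lev k z = Split b f" "b \<noteq> f" by (rule split_levE[of z k])
  then have "{s \<in> parts_at z. colour_at k z s = j} = (if b = j then {Back} else if f = j then {Front} else {})"
    using True by (auto simp: parts_at_def colour_at_def split: if_splits)
  then show ?thesis using bf by auto
next
  case False
  then show ?thesis
  proof (cases rule: nonsplit_levE[OF False, of k])
    case (1 c)
    then have "{s \<in> parts_at z. colour_at k z s = j} = (if c = j then {Whole} else {})"
      using False by (auto simp: parts_at_def colour_at_def)
    then show ?thesis using 1 by auto
  next
    case (2 c)
    then have "{s \<in> parts_at z. colour_at k z s = j} = (if c = j then {Whole} else {})"
      using False by (auto simp: parts_at_def colour_at_def)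
    then show ?thesis using 2 by auto
  qed
qed

lemma sum_period: "(\<Sum>z\<in>{M - period..<M}. mult j (lev k z)) = (\<Sum>z\<in>{0..<period}. mult j (lev k z))"
proof -
  let ?f = "\<lambda>z. mult j (lev k z)"
  have shift: "(\<Sum>z\<in>{M + 1 - period..<M + 1}. ?f z) = (\<Sum>z\<in>{M - period..<M}. ?f z)" for M
  proof -
    have "{M - period..<M + 1} = insert M {M - period..<M}"
      "{M - period..<M + 1} = insert (M - period) {M + 1 - period..<M + 1}"
      using period_pos by auto
    then have "sum ?f (insert M {M - period..<M}) = sum ?f (insert (M - period) {M + 1 - period..<M + 1})"
      by metis
    moreover have "sum ?f (insert M {M - period..<M}) = ?f M + sum ?f {M - period..<M}"
      by (rule sum.insert) auto
    moreover have "sum ?f (insert (M - period) {M + 1 - period..<M + 1}) =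
        ?f (M - period) + sum ?f {M + 1 - period..<M + 1}"
      by (rule sum.insert) auto
    ultimately have "?f M + sum ?f {M - period..<M} = ?f (M - period) + sum ?f {M + 1 - period..<M + 1}"
      by metis
    then show ?thesis by (simp add: periodic)
  qed
  have "(\<Sum>z\<in>{M - period..<M}. ?f z) = (\<Sum>z\<in>{period - period..<period}. ?f z)"
  proof (induction M rule: int_induct[where k = period])
    case (step1 M)
    then show ?case using shift[of M] by simp
  next
    case (step2 M)
    then show ?case using shift[of "M - 1"] by simp
  qed simp
  then show ?thesis by simp
qed

lemma count_period_whole:
  assumes "j \<le> n"
  shows "card (coloured k j (diff (lower (M, Whole)) (M, Whole))) = delta_coeff t n j"
proof -
  have "coloured k j (diff (lower (M, Whole)) (M, Whole)) =
     (SIGMA z:{M - period..<M}. {s \<in> parts_at z. colour_at k z s = j})"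
    by (auto simp: coloured_def diff_def filled_def lower_def)
  moreover have "card (SIGMA z:{M - period..<M}. {s \<in> parts_at z. colour_at k z s = j}) =
     (\<Sum>z\<in>{M - period..<M}. card {s \<in> parts_at z. colour_at k z s = j})"
    by (rule card_SigmaI) (auto simp: finite_pts)
  ultimately show ?thesis using colour_count[OF assms, of k] by (simp only: card_parts sum_period)
qed

text \<open>If the column ends in a half-filled level, then the interval of one period is cut at both
  ends; the half that is missing at the bottom has the colour of the one that is added at
  the top.\<close>

lemma count_period:
  assumes "valid a" "j \<le> n"
  shows "card (coloured k j (diff (lower a) a)) = delta_coeff t n j"
proof -
  obtain M h where a: "a = (M, h)" by force
  show ?thesis
  proof (cases "h = Whole")
    case True
    then show ?thesis using count_period_whole[OF assms(2)] a by simp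
  next
    case False
    have M: "split_at M" using assms(1) a False by (auto simp: valid_def)
    then have h: "h \<in> parts_at M" "h \<in> parts_at (M - period)"
      using part_other[OF False] by (auto simp: parts_at_def)
    let ?C = "coloured k j (diff (lower (M, Whole)) (M, Whole))"
    have D: "diff (lower a) a = insert (M, h) (diff (lower (M, Whole)) (M, Whole) - {(M - period, h)})"
      using False a h period_pos by (auto simp: diff_def filled_def lower_def)
    have in1: "(M - period, h) \<in> diff (lower (M, Whole)) (M, Whole)"
      using h period_pos by (auto simp: diff_def filled_def lower_def)
    have nin: "(M, h) \<notin> diff (lower (M, Whole)) (M, Whole)" by (auto simp: diff_def filled_def)
    have "coloured k j (diff (lower a) a) =
      (if colour_at k M h = j then insert (M, h) (?C - {(M - period, h)}) else ?C)"
      unfolding D using in1 colour_at_lower[of k M h] by (auto simp: coloured_def)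
    moreover have "card (insert (M, h) (?C - {(M - period, h)})) = card ?C" if "colour_at k M h = j"
    proof -
      have "(M - period, h) \<in> ?C" using in1 that by (simp add: coloured_def)
      then have "Suc (card (?C - {(M - period, h)})) = card ?C"
        by (rule card_Suc_Diff1[OF coloured_finite])
      moreover have "(M, h) \<notin> ?C - {(M - period, h)}" using nin by (simp add: coloured_def)
      then have "card (insert (M, h) (?C - {(M - period, h)})) = Suc (card (?C - {(M - period, h)}))"
        by (intro card_insert_disjoint finite_Diff coloured_finite)
      ultimately show ?thesis by (simp only:)
    qed
    ultimately show ?thesis using count_period_whole[OF assms(2)] by simp
  qed
qed

text \<open>A $\delta$-column is given by its numbers of blocks of each colour. States below \<open>c\<close> are nested, and then
  more blocks are missing in the smaller one, unless they fill different halves of the same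
  level, which are of different colours.\<close>

lemma same_counts_eq:
  assumes "valid a" "valid b" "valid c" "le a c" "le b c"
    and cnt: "\<And>j. j \<le> n \<Longrightarrow> card (coloured k j (diff a c)) = card (coloured k j (diff b c))"
  shows "a = b"
proof -
  have sub: "x = y" if xy: "valid x" "valid y" "le x y" "le y c"
    "\<And>j. j \<le> n \<Longrightarrow> card (coloured k j (diff x c)) = card (coloured k j (diff y c))" for x y
  proof (rule ccontr)
    assume "x \<noteq> y"
    then obtain y' z s where y': "add z s y' y" "le x y'" using remove_above[OF xy(1-3)] by metis
    have zs: "(z, s) \<in> diff x c" "(z, s) \<notin> diff y c"
    proof -
      have "filled y z s" "s \<in> parts_at z" using add_filled(1,4)[OF y'(1)] by blast+
      then show "(z, s) \<notin> diff y c" by (simp add: diff_def)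
      have "filled c z s" using \<open>filled y z s\<close> \<open>le y c\<close> by (auto simp: filled_def le_def)
      moreover have "\<not> filled x z s" using add_filled(2)[OF y'(1)] y'(2)
        by (auto simp: filled_def le_def)
      ultimately show "(z, s) \<in> diff x c" using \<open>s \<in> parts_at z\<close> by (simp add: diff_def)
    qed
    have "filled x z s \<Longrightarrow> filled y z s" for z s using \<open>le x y\<close> by (auto simp: filled_def le_def)
    then have "diff y c \<subseteq> diff x c" by (auto simp: diff_def)
    then have "coloured k (colour_at k z s) (diff y c) \<subset> coloured k (colour_at k z s) (diff x c)"
      using zs by (auto simp: coloured_def)
    then have "card (coloured k (colour_at k z s) (diff y c)) < card (coloured k (colour_at k z s) (diff x c))"
      by (rule psubset_card_mono[OF coloured_finite])
    then show False using xy(5)[OF add_colour_le[OF y'(1)], of k] by simp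
  qed
  consider "le a b" | "le b a" | "fst a = fst b" "snd a \<noteq> Whole" "snd b = other (snd a)"
  proof -
    have "le a b \<or> le b a \<or> fst a = fst b \<and> snd a \<noteq> Whole \<and> snd b = other (snd a)"
      by (cases "snd a"; cases "snd b") (auto simp: le_def)
    then show ?thesis using that by blast
  qed
  then show ?thesis
  proof cases
    case 1
    then show ?thesis using sub[of a b] assms by blast
  next
    case 2
    then show ?thesis using sub[of b a] assms by metis
  next
    case 3
    obtain z h where a: "a = (z, h)" by force
    then have b: "b = (z, other h)" and h: "h \<noteq> Whole" "other h \<noteq> h" "other h \<noteq> Whole"
      using 3 by (cases b; cases h; simp)+
    have sz: "split_at z" using assms(1) a h by (simp add: valid_def)
    have c: "fst c > z" using assms(4,5) a b h by (auto simp: le_def)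
    have parts_at: "h \<in> parts_at z" "other h \<in> parts_at z" using sz h by (cases h; simp add: parts_at_def)+
    let ?j = "colour_at k z h"
    obtain u v where uv: "lev k z = Split u v" "u \<noteq> v" using sz by (rule split_levE[of z k])
    then have jj: "colour_at k z (other h) \<noteq> ?j" using h by (cases h) (simp_all add: colour_at_def)
    have "coloured k ?j (diff b c) = insert (z, h) (coloured k ?j (diff a c))"
      using a b h c parts_at jj by (auto simp: coloured_def diff_def filled_def)
    moreover have "(z, h) \<notin> coloured k ?j (diff a c)"
      using a h by (auto simp: coloured_def diff_def filled_def)
    ultimately have "card (coloured k ?j (diff b c)) = Suc (card (coloured k ?j (diff a c)))"
      using coloured_finite by simp
    then show ?thesis using cnt[OF colour_at_le[OF parts_at(1)], of k] by simp
  qed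
qed

lemma card_removed:
  assumes "pre x" "le (g k) a" "valid a" "le a (x k)"
  shows "card {p \<in> wall x - wall (x(k := a)). colour t n l p = j} = card (coloured k j (diff a (x k)))"
proof (rule bij_betw_same_card[symmetric])
  let ?f = "\<lambda>(z, s). Place k (nat (z + int (off k))) s"
  have lo: "- int (off k) \<le> z" if "(z, s) \<in> diff a (x k)" for z s
    using that le_off[OF assms(2)] by (auto simp: diff_def filled_def)
  show "bij_betw ?f (coloured k j (diff a (x k))) {p \<in> wall x - wall (x(k := a)). colour t n l p = j}"
    unfolding bij_betw_def
  proof
    show "inj_on ?f (coloured k j (diff a (x k)))"
    proof (rule inj_onI)
      fix u v assume uv: "u \<in> coloured k j (diff a (x k))" "v \<in> coloured k j (diff a (x k))" "?f u = ?f v"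
      obtain z s z' s' where [simp]: "u = (z, s)" "v = (z', s')" by (cases u; cases v)
      have "- int (off k) \<le> z" "- int (off k) \<le> z'" using uv(1,2) lo by (auto simp: coloured_def)
      then show "u = v" using uv(3) by (auto simp: nat_eq_iff2)
    qed
    show "?f ` coloured k j (diff a (x k)) = {p \<in> wall x - wall (x(k := a)). colour t n l p = j}"
    proof (intro equalityI subsetI)
      fix p assume "p \<in> ?f ` coloured k j (diff a (x k))"
      then obtain z s where p: "p = Place k (nat (z + int (off k))) s" "(z, s) \<in> diff a (x k)" "colour_at k z s = j"
        by (auto simp: coloured_def)
      then show "p \<in> {p \<in> wall x - wall (x(k := a)). colour t n l p = j}"
        using lo[OF p(2)] by (auto simp: place_at colour_clr diff_def)
    next
      fix p assume p: "p \<in> {p \<in> wall x - wall (x(k := a)). colour t n l p = j}"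
      obtain k' m s where [simp]: "p = Place k' m s" by (cases p)
      have "k' = k" using p by (auto simp: Place_wall split: if_splits)
      then have "(int m - int (off k), s) \<in> coloured k j (diff a (x k))"
        using p by (auto simp: Place_wall coloured_def diff_def colour_clr)
      moreover have "p = ?f (int m - int (off k), s)" using \<open>k' = k\<close> by simp
      ultimately show "p \<in> ?f ` coloured k j (diff a (x k))" by blast
    qed
  qed
qed

text \<open>Removing a $\delta$ from a column means lowering it by one period, as the colours of the
  removed blocks determine the state that remains.\<close>

lemma removable_delta_iff:
  assumes "adapted x"
  shows "removable_delta t n l (wall x) k \<longleftrightarrow> fits (x (Suc k)) (lower (x k))"
proof
  note v = adapted_valid[OF assms, of k] and x = adapted_pre[OF assms]
  assume "removable_delta t n l (wall x) k"
  then obtain D where D: "delta_column t n l (wall x) k D" "wall x - D \<in> proper_walls t n l"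
    by (auto simp: removable_delta_def)
  obtain y where y: "adapted y" "wall x - D = wall y" using D(2) by (rule proper_wallE)
  have Dsub: "D \<subseteq> wall x" "\<And>p. p \<in> D \<Longrightarrow> column p = k"
    and cnt: "\<And>j. j \<le> n \<Longrightarrow> card {p \<in> D. colour t n l p = j} = delta_coeff t n j"
    using D(1) by (auto simp: delta_column_def)
  have same: "y j = x j" if "j \<noteq> k" for j
  proof (rule column_eq[OF adapted_pre[OF y(1)] x])
    fix m s
    have "Place j m s \<notin> D" using Dsub(2)[of "Place j m s"] that by auto
    then show "Place j m s \<in> wall y \<longleftrightarrow> Place j m s \<in> wall x" using y(2) by blast
  qed
  have yx: "y = x(k := y k)" using same by auto
  have le: "le (y k) (x k)"
    using column_le_iff[of "y k" "x k" k y x] adapted_valid[OF y(1)] v pre_off[OF x] pre_off[OF adapted_pre[OF y(1)]]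
      y(2) by blast
  have gy: "le (g k) (y k)" using y(1) by (simp add: adapted_def pre_def)
  have "wall x - wall y = D" using y(2) Dsub(1) by blast
  then have "card (coloured k j (diff (y k) (x k))) = delta_coeff t n j" if "j \<le> n" for j
    using card_removed[OF x gy adapted_valid[OF y(1)] le, of j] cnt[OF that] yx by metis
  then have "y k = lower (x k)"
    by (intro same_counts_eq[of _ _ "x k" k]) (use v adapted_valid[OF y(1)] le lower_le count_period in auto)
  moreover have "fits (y (Suc k)) (y k)" using y(1) by (rule adapted_R)
  ultimately show "fits (x (Suc k)) (lower (x k))" using same[of "Suc k"] by simp
next
  note v = adapted_valid[OF assms, of k] and x = adapted_pre[OF assms]
  assume r: "fits (x (Suc k)) (lower (x k))"
  let ?a = "lower (x k)"
  have va: "valid ?a" using v by simp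
  have ad: "adapted (x(k := ?a))" using adapted_shrink[OF assms va lower_le] r by blast
  define D where "D = wall x - wall (x(k := ?a))"
  have "delta_column t n l (wall x) k D"
    unfolding delta_column_def
  proof (intro conjI ballI impI)
    show "D \<subseteq> wall x" by (auto simp: D_def)
    show col: "column p = k" if "p \<in> D" for p
      using that by (cases p) (auto simp: D_def Place_wall split: if_splits)
    show "card {p \<in> D. colour t n l p = j} = delta_coeff t n j" if "j \<in> {0..n}" for j
      unfolding D_def using card_removed[OF x lower_bound[OF x va r] va lower_le, of j]
        count_period[OF v] that by simp
    fix p q r' assume pqr: "p \<in> D" "q \<in> D" "r' \<in> wall x"
      "column r' = k \<and> height_index p < height_index r' \<and> height_index r' < height_index q"
    obtain m s where p: "p = Place k m s" using col[OF pqr(1)] by (cases p) auto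
    obtain m' s' where r': "r' = Place k m' s'" using pqr(4) by (cases r') auto
    have "\<not> filled ?a (int m - int (off k)) s" using pqr(1) p by (auto simp: D_def Place_wall)
    then have "\<not> filled ?a (int m' - int (off k)) s'"
      using pqr(4) p r' by (auto simp: filled_def)
    then show "r' \<in> D" using pqr(3) r' by (auto simp: D_def Place_wall)
  qed
  moreover have "wall x - D = wall (x(k := ?a))"
  proof -
    have "wall (x(k := ?a)) \<subseteq> wall x"
    proof
      fix p assume p: "p \<in> wall (x(k := ?a))"
      have "filled ?a z s \<Longrightarrow> filled (x k) z s" for z s
        using lower_le[of "x k"] by (auto simp: filled_def le_def)
      then show "p \<in> wall x" using p by (cases p) (auto simp: Place_wall split: if_splits)
    qed
    then show ?thesis by (auto simp: D_def)
  qed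
  ultimately show "removable_delta t n l (wall x) k"
    using wall_proper[OF ad] unfolding removable_delta_def by metis
qed

text \<open>The pairs in which the right column can lose a $\delta$ are stable under both rules for
  neighbouring columns, since lowering a column does not change its signs. The rules for adding and
  removing blocks are inverse to each other, so the pairs that cannot lose a $\delta$
  are stable, too. At column \<open>k\<close> itself one of the two directions is the rule and the other is
  monotonicity.\<close>

lemma removable_delta_move:
  assumes "move i k x x'"
  shows "fits (x' (Suc j)) (lower (x' j)) \<longleftrightarrow> fits (x (Suc j)) (lower (x j))"
proof -
  have ad: "adapted x" "adapted x'" and s: "step k i (x k) (x' k)" and x': "x' = x(k := x' k)"
    using assms by (auto simp: move_def)
  have o: "x' j = x j" if "j \<noteq> k" for j using x' that by (metis fun_upd_other)
  have sl: "step k i (lower (x k)) (lower (x' k))" using s by (rule step_lower)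
  consider "j = k" | "Suc j = k" | "j \<noteq> k" "Suc j \<noteq> k" by blast
  then show ?thesis
  proof cases
    case 1
    have "fits (x (Suc k)) (lower (x' k)) \<Longrightarrow> fits (x (Suc k)) (lower (x k))"
      using fits_step_right[OF _ adapted_valid[OF ad(1)] sl] step_phi_eps(2)[OF s] move_neighbours(1)[OF assms]
      by simp
    moreover have "fits (x (Suc k)) (lower (x k)) \<Longrightarrow> fits (x (Suc k)) (lower (x' k))"
      using fits_le_trans step_imp_le[OF sl] by blast
    ultimately show ?thesis using 1 o[of "Suc k"] by auto
  next
    case 2
    have "fits (x k) (lower (x j)) \<Longrightarrow> fits (x' k) (lower (x j))"
      using fits_step_left[of "x k" "lower (x j)" j i "x' k"] adapted_valid[OF ad(1)] s 2
        move_neighbours(2)[OF assms, of j] by auto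
    moreover have "fits (x' k) (lower (x j)) \<Longrightarrow> fits (x k) (lower (x j))"
      using le_R step_imp_le[OF s] by blast
    ultimately show ?thesis using 2 o[of j] by auto
  next
    case 3
    then show ?thesis using o by simp
  qed
qed

lemma reduced_iff:
  assumes "adapted x"
  shows "wall x \<in> reduced_walls t n l \<longleftrightarrow> (\<forall>k. \<not> fits (x (Suc k)) (lower (x k)))"
  using wall_proper[OF assms] removable_delta_iff[OF assms] by (simp add: reduced_walls_def)

lemma reduced_move:
  assumes "move i k x x'"
  shows "wall x' \<in> reduced_walls t n l \<longleftrightarrow> wall x \<in> reduced_walls t n l"
proof -
  have "adapted x" "adapted x'" using assms by (auto simp: move_def)
  then show ?thesis using reduced_iff removable_delta_move[OF assms] by simp
qed

theorem crystal_of_reduced_walls: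
  "(\<forall>i\<in>{0..n}. \<forall>Y\<in>reduced_walls t n l.
      e_op t n l i Y \<in> insert None (Some ` reduced_walls t n l) \<and>
      f_op t n l i Y \<in> insert None (Some ` reduced_walls t n l)) \<and>
   affine_crystal n (cartan t n) (reduced_walls t n l)
     (wall_wt t n l) (wall_eps t n l) (wall_phi t n l) (e_op t n l) (f_op t n l)"
proof -
  let ?B = "reduced_walls t n l"
  have red: "\<exists>x. adapted x \<and> Y = wall x" if "Y \<in> ?B" for Y
  proof -
    have "Y \<in> proper_walls t n l" using that by (simp add: reduced_walls_def)
    then show ?thesis by (rule proper_wallE) blast
  qed
  have f: "\<exists>k x x'. move i k x x' \<and> Y = wall x \<and> Y' = wall x' \<and> Y' \<in> ?B"
    if Y: "Y \<in> ?B" "i \<le> n" "f_op t n l i Y = Some Y'" for i Y Y'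
  proof -
    obtain x where x: "adapted x" "Y = wall x" using red[OF Y(1)] by blast
    then obtain k x' where "move i k x x'" "Y' = wall x'" using f_op_move[OF x(1) Y(2)] Y(3) x(2) by blast
    then show ?thesis using x Y(1) reduced_move by blast
  qed
  have e: "\<exists>k x x'. move i k x x' \<and> Y' = wall x \<and> Y = wall x' \<and> Y' \<in> ?B"
    if Y: "Y \<in> ?B" "i \<le> n" "e_op t n l i Y = Some Y'" for i Y Y'
  proof -
    obtain x' where x: "adapted x'" "Y = wall x'" using red[OF Y(1)] by blast
    then obtain k x where "move i k x x'" "Y' = wall x" using e_op_move[OF x(1) Y(2)] Y(3) x(2) by blast
    then show ?thesis using x Y(1) reduced_move by blast
  qed
  have ecl: "e_op t n l i Y \<in> insert None (Some ` ?B)" if "Y \<in> ?B" "i \<le> n" for i Y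
    using e[OF that] by (cases "e_op t n l i Y") auto
  have fcl: "f_op t n l i Y \<in> insert None (Some ` ?B)" if "Y \<in> ?B" "i \<le> n" for i Y
    using f[OF that] by (cases "f_op t n l i Y") auto
  have 1: "wall_phi t n l i Y = wall_eps t n l i Y + Fin (wall_wt t n l Y (Coroot i))"
    if Y: "Y \<in> ?B" "i \<le> n" for i Y
  proof -
    obtain x where x: "adapted x" "Y = wall x" using red[OF Y(1)] by blast
    then show ?thesis using phi_minus_eps[OF x(1) Y(2)] by (simp add: wall_phi_def wall_eps_def)
  qed
  have mv: "wall_eps t n l i (wall x) = wall_eps t n l i (wall x') - 1 \<and>
     wall_phi t n l i (wall x) = wall_phi t n l i (wall x') + 1 \<and>
     wall_eps t n l i (wall x') = wall_eps t n l i (wall x) + 1 \<and>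
     wall_phi t n l i (wall x') = wall_phi t n l i (wall x) - 1" if "move i k x x'" "i \<le> n" for i k x x'
    using move_op(3,4)[OF that] by (simp add: wall_eps_def wall_phi_def one_extended_def)
  have 2: "wall_wt t n l Y' = (\<lambda>c. wall_wt t n l Y c + simple_root (cartan t n) i c) \<and>
     wall_eps t n l i Y' = wall_eps t n l i Y - 1 \<and> wall_phi t n l i Y' = wall_phi t n l i Y + 1 \<and>
     f_op t n l i Y' = Some Y"
    if Y: "Y \<in> ?B" "i \<le> n" "e_op t n l i Y = Some Y'" for i Y Y'
  proof -
    obtain k x x' where m: "move i k x x'" "Y' = wall x" "Y = wall x'" using e[OF Y] by blast
    have "wall_wt t n l (wall x) = (\<lambda>c. wall_wt t n l (wall x') c + simple_root (cartan t n) i c)"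
      unfolding wt_move[OF m(1) Y(2)] by simp
    then show ?thesis unfolding m(2,3) using mv[OF m(1) Y(2)] move_op(1)[OF m(1) Y(2)] by blast
  qed
  have 3: "wall_wt t n l Y' = (\<lambda>c. wall_wt t n l Y c - simple_root (cartan t n) i c) \<and>
     wall_eps t n l i Y' = wall_eps t n l i Y + 1 \<and> wall_phi t n l i Y' = wall_phi t n l i Y - 1 \<and>
     e_op t n l i Y' = Some Y"
    if Y: "Y \<in> ?B" "i \<le> n" "f_op t n l i Y = Some Y'" for i Y Y'
  proof -
    obtain k x x' where m: "move i k x x'" "Y = wall x" "Y' = wall x'" using f[OF Y] by blast
    show ?thesis unfolding m(2,3)
      using mv[OF m(1) Y(2)] wt_move[OF m(1) Y(2)] move_op(2)[OF m(1) Y(2)] by blast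
  qed
  have "affine_crystal n (cartan t n) ?B
     (wall_wt t n l) (wall_eps t n l) (wall_phi t n l) (e_op t n l) (f_op t n l)"
    unfolding affine_crystal_def
  proof (intro conjI ballI impI)
    fix i Y assume i: "i \<in> {0..n}" and Y: "Y \<in> ?B"
    have i': "i \<le> n" using i by simp
    show "wall_eps t n l i Y \<noteq> \<infinity>" "wall_phi t n l i Y \<noteq> \<infinity>"
      by (simp_all add: wall_eps_def wall_phi_def)
    show "wall_phi t n l i Y = wall_eps t n l i Y + Fin (wall_wt t n l Y (Coroot i))"
      by (rule 1[OF Y i'])
    show "e_op t n l i Y \<in> insert None (Some ` ?B)" "f_op t n l i Y \<in> insert None (Some ` ?B)"
      using ecl[OF Y i'] fcl[OF Y i'] by blast+
    show "e_op t n l i Y = None" "f_op t n l i Y = None" if "wall_eps t n l i Y = -\<infinity>"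
      using that by (simp_all add: wall_eps_def)
    fix Y' assume Y': "Y' \<in> ?B"
    show "wall_wt t n l Y' = (\<lambda>c. wall_wt t n l Y c + simple_root (cartan t n) i c)"
      "wall_eps t n l i Y' = wall_eps t n l i Y - 1" "wall_phi t n l i Y' = wall_phi t n l i Y + 1"
      if "e_op t n l i Y = Some Y'" using 2[OF Y i' that] by blast+
    show "wall_wt t n l Y' = (\<lambda>c. wall_wt t n l Y c - simple_root (cartan t n) i c)"
      "wall_eps t n l i Y' = wall_eps t n l i Y + 1" "wall_phi t n l i Y' = wall_phi t n l i Y - 1"
      if "f_op t n l i Y = Some Y'" using 3[OF Y i' that] by blast+
    show "(f_op t n l i Y = Some Y') = (e_op t n l i Y' = Some Y)"
      using 2[OF Y' i', of Y] 3[OF Y i', of Y'] by blast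
  qed (rule wt_lattice)
  then show ?thesis using ecl fcl by simp
qed

end

section \<open>Zigzag patterns\<close>

text \<open>In all types except $A_n^{(1)}$ one period of the pattern walks along the Dynkin diagram from one end to
  the other and back. A turn is what stands at an end of the diagram; in \<open>Turn_Split b c\<close> the
  colour \<open>b\<close> is at the back in even columns.\<close>

datatype turn = Turn_Split nat nat | Turn_Half nat | Turn_Cube nat

fun turn_levels :: "nat \<Rightarrow> turn \<Rightarrow> level list" where
  "turn_levels k (Turn_Split b c) = [alt_split k b c]"
| "turn_levels k (Turn_Half c) = [Half_Height c, Half_Height c]"
| "turn_levels k (Turn_Cube c) = [Cube c]"

fun turn_count :: "nat \<Rightarrow> turn \<Rightarrow> nat" where
  "turn_count i (Turn_Split b c) = of_bool (b = i) + of_bool (c = i)"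
| "turn_count i (Turn_Half c) = 2 * of_bool (c = i)"
| "turn_count i (Turn_Cube c) = of_bool (c = i)"

fun turn_colours :: "turn \<Rightarrow> nat set" where
  "turn_colours (Turn_Split b c) = {b, c}"
| "turn_colours (Turn_Half c) = {c}"
| "turn_colours (Turn_Cube c) = {c}"

fun turn_size :: "turn \<Rightarrow> nat" where
  "turn_size (Turn_Half c) = 2" | "turn_size _ = 1"

text \<open>A cube at a turn has its only neighbour in the diagram below and above it, which accounts for a
  double bond; the neighbour of a block at one of the other turns lies on one side of it.\<close>

fun turn_factor :: "turn \<Rightarrow> int" where
  "turn_factor (Turn_Cube c) = 2" | "turn_factor _ = 1"

fun turn_distinct :: "turn \<Rightarrow> bool" where
  "turn_distinct (Turn_Split b c) \<longleftrightarrow> b \<noteq> c" | "turn_distinct _ \<longleftrightarrow> True"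

definition zigzag :: "turn \<Rightarrow> nat list \<Rightarrow> turn \<Rightarrow> nat \<Rightarrow> level list" where
  "zigzag T0 xs T1 k = turn_levels k T0 @ map Cube xs @ turn_levels k T1 @ map Cube (rev xs)"

lemma length_turn_levels [simp]: "length (turn_levels k T) = turn_size T"
  by (cases T) auto

lemma turn_size_cases: "turn_size T = 1 \<or> turn_size T = 2"
  by (cases T) auto

text \<open>The Cartan matrix in terms of the walk: the columns of the matrix for the colours at the two
  turns and for the colours in between.\<close>

definition turning :: "(nat \<Rightarrow> nat \<Rightarrow> int) \<Rightarrow> nat \<Rightarrow> turn \<Rightarrow> nat list \<Rightarrow> turn \<Rightarrow> bool" where
  "turning A n T0 xs T1 \<longleftrightarrow> xs \<noteq> [] \<and> turn_distinct T0 \<and> turn_distinct T1 \<and>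
     (\<forall>c \<in> turn_colours T0 \<union> set xs \<union> turn_colours T1. c \<le> n) \<and>
     (\<forall>i\<le>n. A i i = 2 \<and>
       (\<forall>c\<in>turn_colours T0. A i c = 2 * of_bool (c = i) - turn_factor T0 * of_bool (xs ! 0 = i)) \<and>
       (\<forall>c\<in>turn_colours T1. A i c = 2 * of_bool (c = i) - turn_factor T1 * of_bool (xs ! (length xs - 1) = i)) \<and>
       (\<forall>j<length xs. A i (xs ! j) = 2 * of_bool (xs ! j = i)
          - int (if j = 0 then turn_count i T0 else of_bool (xs ! (j - 1) = i))
          - int (if j = length xs - 1 then turn_count i T1 else of_bool (xs ! (j + 1) = i))))"

lemma turning_rev:
  assumes "turning A n T0 xs T1"
  shows "turning A n T1 (rev xs) T0"
proof -
  let ?q = "length xs"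
  have ne: "?q > 0" using assms by (simp add: turning_def)
  have r: "rev xs ! j = xs ! (?q - 1 - j)" if "j < ?q" for j
    using that by (simp add: rev_nth)
  have "A i (rev xs ! j) = 2 * of_bool (rev xs ! j = i)
      - int (if j = 0 then turn_count i T1 else of_bool (rev xs ! (j - 1) = i))
      - int (if j = ?q - 1 then turn_count i T0 else of_bool (rev xs ! (j + 1) = i))"
    if ij: "i \<le> n" "j < ?q" for i j
  proof -
    let ?j = "?q - 1 - j"
    have "?j < ?q" using ne by simp
    then have "A i (xs ! ?j) = 2 * of_bool (xs ! ?j = i)
          - int (if ?j = 0 then turn_count i T0 else of_bool (xs ! (?j - 1) = i))
          - int (if ?j = ?q - 1 then turn_count i T1 else of_bool (xs ! (?j + 1) = i))"
      using assms ij unfolding turning_def by blast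
    moreover have "?j = 0 \<longleftrightarrow> j = ?q - 1" "?j = ?q - 1 \<longleftrightarrow> j = 0" using ij ne by auto
    moreover have "rev xs ! (j + 1) = xs ! (?j - 1)" if "j \<noteq> ?q - 1"
      using r[of "j + 1"] that ij by simp
    moreover have "rev xs ! (j - 1) = xs ! (?j + 1)" if "j \<noteq> 0"
    proof -
      have "?q - 1 - (j - 1) = ?j + 1" using that ij by simp
      moreover have "j - 1 < ?q" using ij by simp
      ultimately show ?thesis using r[of "j - 1"] by metis
    qed
    ultimately show ?thesis using r[OF ij(2)] by auto
  qed
  moreover have "rev xs ! 0 = xs ! (?q - 1)" "rev xs ! (?q - 1) = xs ! 0"
    using r[of 0] r[of "?q - 1"] ne by auto
  ultimately show ?thesis using assms unfolding turning_def by (simp add: Un_commute Un_left_commute)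
qed

lemma alt_split_simps [simp]: "is_half (alt_split k b c) = False" "is_split (alt_split k b c)"
  "mult i (alt_split k b c) = of_bool (b = i) + of_bool (c = i)"
  by (auto simp: alt_split_def)

lemma turn_ends:
  "is_half (turn_levels k T ! 0) \<longleftrightarrow> turn_size T = 2"
  "is_half (turn_levels k T ! (turn_size T - 1)) \<longleftrightarrow> turn_size T = 2"
  "mult i (turn_levels k T ! 0) * (if turn_size T = 2 then 2 else 1) = turn_count i T"
  "mult i (turn_levels k T ! (turn_size T - 1)) * (if turn_size T = 2 then 2 else 1) = turn_count i T"
  "turn_size T = 2 \<Longrightarrow> is_half (turn_levels k T ! d) \<longleftrightarrow> is_half ([Half_Height 0, Half_Height 0] ! d)"
  by (cases T; cases d; auto simp: nth_Cons split: nat.splits)+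

lemma turn_pos: "turn_size T > 0"
  by (cases T) auto

lemma turn_levels_cube:
  "turn_levels k T ! d = Cube c \<Longrightarrow> d < turn_size T \<Longrightarrow>
     turn_size T = 1 \<and> d = 0 \<and> c \<in> turn_colours T \<and> turn_factor T = 2 \<and> (\<forall>i. turn_count i T = of_bool (c = i))"
  by (cases T) (auto simp: alt_split_def less_2_cases_iff split: if_splits)

lemma turn_levels_half:
  "turn_levels k T ! d = Half_Height c \<Longrightarrow> d < turn_size T \<Longrightarrow>
     turn_size T = 2 \<and> (d = 0 \<or> d = 1) \<and> c \<in> turn_colours T \<and> turn_factor T = 1 \<and>
     (\<forall>k. turn_levels k T = [Half_Height c, Half_Height c])"
  by (cases T) (auto simp: alt_split_def less_2_cases_iff split: if_splits)

lemma turn_levels_split: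
  "turn_levels k T ! d = Split b f \<Longrightarrow> d < turn_size T \<Longrightarrow>
     turn_size T = 1 \<and> d = 0 \<and> b \<in> turn_colours T \<and> f \<in> turn_colours T \<and> turn_factor T = 1 \<and>
     (turn_distinct T \<longrightarrow> b \<noteq> f)"
  by (cases T) (auto simp: alt_split_def less_2_cases_iff split: if_splits)

text \<open>\<open>P\<close> is the number of levels of one period; \<open>residue z\<close> is the index of level \<open>z\<close> in its period.\<close>

locale turning_pattern =
  fixes A :: "nat \<Rightarrow> nat \<Rightarrow> int" and n :: nat and T0 :: turn and xs :: "nat list" and T1 :: turn
  assumes turning: "turning A n T0 xs T1"
begin

definition q where "q = length xs"
definition P where "P = turn_size T0 + q + turn_size T1 + q"
definition lv :: "nat \<Rightarrow> int \<Rightarrow> level" where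
  "lv k z = zigzag T0 xs T1 k ! nat (z mod int P)"
definition residue :: "int \<Rightarrow> nat" where "residue z = nat (z mod int P)"

lemma q_pos: "q > 0"
  using turning by (simp add: turning_def q_def)

lemma P_ge: "P \<ge> 2" "P > 0"
  using q_pos turn_size_cases[of T0] turn_size_cases[of T1] by (auto simp: P_def)

lemma length_zigzag: "length (zigzag T0 xs T1 k) = P"
  by (simp add: zigzag_def P_def q_def)

lemma residue_less: "residue z < P"
  using P_ge by (simp add: residue_def nat_less_iff)

lemma residue_next: "residue (z + 1) = (if residue z + 1 = P then 0 else residue z + 1)"
proof -
  have r: "int (residue z) = z mod int P" using P_ge by (simp add: residue_def)
  have "(z + 1) mod int P = (z mod int P + 1) mod int P" by (simp add: mod_simps)
  then have *: "(z + 1) mod int P = (int (residue z) + 1) mod int P" using r by simp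
  show ?thesis
  proof (cases "residue z + 1 = P")
    case True
    then have "int (residue z) + 1 = int P" by linarith
    then show ?thesis using * True by (simp add: residue_def)
  next
    case False
    then have "int (residue z) + 1 < int P" using residue_less[of z] by linarith
    then have "(z + 1) mod int P = int (residue z) + 1" using * by simp
    then show ?thesis using False by (simp add: residue_def[of "z + 1"])
  qed
qed

lemma residue_prev: "residue (z - 1) = (if residue z = 0 then P - 1 else residue z - 1)"
proof -
  have "residue z = (if residue (z - 1) + 1 = P then 0 else residue (z - 1) + 1)" using residue_next[of "z - 1"] by simp
  then show ?thesis using residue_less[of "z - 1"] P_ge by (auto split: if_splits)
qed

lemma residue_step:
  assumes "residue z < turn_size T0 + q + turn_size T1"
  shows "residue (z + 1) = residue z + 1"
proof -
  have "residue z + 1 \<noteq> P" using assms q_pos unfolding P_def by linarith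
  then show ?thesis using residue_next[of z] by simp
qed

lemma residue_small: "m < P \<Longrightarrow> residue (int m) = m"
  by (simp add: residue_def)

lemma lv_nth: "lv k z = (if residue z < turn_size T0 then turn_levels k T0 ! residue z
   else if residue z < turn_size T0 + q then Cube (xs ! (residue z - turn_size T0))
   else if residue z < turn_size T0 + q + turn_size T1 then turn_levels k T1 ! (residue z - (turn_size T0 + q))
   else Cube (xs ! (P - 1 - residue z)))"
proof -
  let ?r = "residue z"
  have "zigzag T0 xs T1 k ! ?r = (if ?r < turn_size T0 then turn_levels k T0 ! ?r
   else if ?r < turn_size T0 + q then Cube (xs ! (?r - turn_size T0))
   else if ?r < turn_size T0 + q + turn_size T1 then turn_levels k T1 ! (?r - (turn_size T0 + q))
   else Cube (rev xs ! (?r - (turn_size T0 + q + turn_size T1))))"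
    using residue_less[of z] by (auto simp: zigzag_def nth_append q_def P_def)
  moreover have "rev xs ! (?r - (turn_size T0 + q + turn_size T1)) = xs ! (P - 1 - ?r)"
    if "turn_size T0 + q + turn_size T1 \<le> ?r"
  proof -
    have "q - Suc (?r - (turn_size T0 + q + turn_size T1)) = P - 1 - ?r"
      using that residue_less[of z] by (simp add: P_def)
    then show ?thesis using that residue_less[of z] by (subst rev_nth) (auto simp: q_def[symmetric] P_def)
  qed
  ultimately show ?thesis by (auto simp: lv_def residue_def[symmetric])
qed

text \<open>Above and below each complete unit of the pattern (a cube, a split level or a pair of half-height
  levels) stands the next unit of the walk; the following lemmas count its colours, first
  those above and then those below a level.\<close>

lemma above_turn0: "residue z = 0 \<Longrightarrow> above (lv k) i z = turn_count i T0"
proof -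
  assume z: "residue z = 0"
  have l0: "lv k z = turn_levels k T0 ! 0" using z turn_pos[of T0] by (simp add: lv_nth)
  have "is_half (lv k (z + 1))" if "turn_size T0 = 2"
  proof -
    have "residue (z + 1) = 1" using residue_next[of z] P_ge z by auto
    then show ?thesis using that turn_ends(5)[OF that, of k 1] by (simp add: lv_nth)
  qed
  then have "(is_half (turn_levels k T0 ! 0) \<and> is_half (lv k (z + 1))) = (turn_size T0 = 2)"
    using turn_ends(1)[of k T0] by blast
  then show ?thesis unfolding above_def l0 by (simp only: turn_ends(3))
qed

lemma above_turn1:
  assumes "residue z = turn_size T0 + q"
  shows "above (lv k) i z = turn_count i T1"
proof -
  have r: "residue (z + 1) = residue z + 1" using residue_step[of z] assms turn_pos[of T1] by linarith
  have l0: "lv k z = turn_levels k T1 ! 0" using assms turn_pos[of T1] by (simp add: lv_nth)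
  have "is_half (lv k (z + 1))" if "turn_size T1 = 2"
    using that turn_ends(5)[OF that, of k 1] r assms by (simp add: lv_nth)
  then have "(is_half (turn_levels k T1 ! 0) \<and> is_half (lv k (z + 1))) = (turn_size T1 = 2)"
    using turn_ends(1)[of k T1] by blast
  then show ?thesis unfolding above_def l0 by (simp only: turn_ends(3))
qed

lemma above_up:
  assumes "turn_size T0 \<le> residue z" "residue z < turn_size T0 + q"
  shows "above (lv k) i z = of_bool (xs ! (residue z - turn_size T0) = i)"
  using assms by (simp add: above_def lv_nth)

lemma above_down:
  assumes "turn_size T0 + q + turn_size T1 \<le> residue z"
  shows "above (lv k) i z = of_bool (xs ! (P - 1 - residue z) = i)"
  using assms by (simp add: above_def lv_nth)

lemma below_turn0:
  assumes "residue z = turn_size T0"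
  shows "below (lv k) i z = turn_count i T0"
proof -
  have 1: "residue (z - 1) = turn_size T0 - 1" using residue_prev[of z] assms turn_pos[of T0] by auto
  have l0: "lv k (z - 1) = turn_levels k T0 ! (turn_size T0 - 1)"
    using 1 turn_pos[of T0] by (simp add: lv_nth)
  have "is_half (lv k (z - 2))" if "turn_size T0 = 2"
  proof -
    have "residue (z - 2) = 0" using residue_prev[of "z - 1"] 1 that by simp
    then show ?thesis using that turn_ends(5)[OF that, of k 0] by (simp add: lv_nth)
  qed
  then have "(is_half (turn_levels k T0 ! (turn_size T0 - 1)) \<and> is_half (lv k (z - 2))) = (turn_size T0 = 2)"
    using turn_ends(2)[of k T0] by blast
  then show ?thesis unfolding below_def l0 by (simp only: turn_ends(4))
qed

lemma below_turn1:
  assumes "residue z = turn_size T0 + q + turn_size T1"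
  shows "below (lv k) i z = turn_count i T1"
proof -
  have 1: "residue (z - 1) = turn_size T0 + q + turn_size T1 - 1"
    using residue_prev[of z] assms turn_size_cases[of T0] by auto
  have "\<not> residue (z - 1) < turn_size T0 + q" "residue (z - 1) < turn_size T0 + q + turn_size T1"
    "residue (z - 1) - (turn_size T0 + q) = turn_size T1 - 1" "\<not> residue (z - 1) < turn_size T0"
    using 1 turn_pos[of T1] by linarith+
  then have l0: "lv k (z - 1) = turn_levels k T1 ! (turn_size T1 - 1)"
    unfolding lv_nth[of k "z - 1"] by simp
  have "is_half (lv k (z - 2))" if "turn_size T1 = 2"
  proof -
    have "residue (z - 2) = turn_size T0 + q" using residue_prev[of "z - 1"] 1 that q_pos by simp
    then show ?thesis using that turn_ends(5)[OF that, of k 0] by (simp add: lv_nth)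
  qed
  then have "(is_half (turn_levels k T1 ! (turn_size T1 - 1)) \<and> is_half (lv k (z - 2))) = (turn_size T1 = 2)"
    using turn_ends(2)[of k T1] by blast
  then show ?thesis unfolding below_def l0 by (simp only: turn_ends(4))
qed

lemma below_up:
  assumes "turn_size T0 < residue z" "residue z \<le> turn_size T0 + q"
  shows "below (lv k) i z = of_bool (xs ! (residue z - 1 - turn_size T0) = i)"
proof -
  have r: "residue (z - 1) = residue z - 1" using residue_prev[of z] assms by auto
  then have "\<not> residue (z - 1) < turn_size T0" "residue (z - 1) < turn_size T0 + q" using assms by linarith+
  then have "lv k (z - 1) = Cube (xs ! (residue z - 1 - turn_size T0))"
    using r lv_nth[of k "z - 1"] by simp
  then show ?thesis by (simp add: below_def)
qed

lemma below_down:
  assumes "turn_size T0 + q + turn_size T1 < residue z"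
  shows "below (lv k) i z = of_bool (xs ! (P - residue z) = i)"
proof -
  have "residue (z - 1) = residue z - 1" using residue_prev[of z] assms by auto
  then have "lv k (z - 1) = Cube (xs ! (P - 1 - (residue z - 1)))"
    using assms lv_nth[of k "z - 1"] by auto
  moreover have "P - 1 - (residue z - 1) = P - residue z" using assms by simp
  ultimately show ?thesis by (simp add: below_def)
qed

lemma lv_before:
  assumes "residue z = 0"
  shows "lv k (z - 1) = Cube (xs ! 0)"
proof -
  have "residue (z - 1) = P - 1" using residue_prev[of z] assms by simp
  moreover have "turn_size T0 + q + turn_size T1 \<le> P - 1" using q_pos by (simp add: P_def)
  ultimately show ?thesis using lv_nth[of k "z - 1"] by auto
qed

lemma below_0:
  assumes "residue z = 0"
  shows "below (lv k) i z = of_bool (xs ! 0 = i)"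
  using lv_before[OF assms, of k] by (simp add: below_def)

lemma regions:
  obtains (turn0) "residue z < turn_size T0" | (up) "turn_size T0 \<le> residue z" "residue z < turn_size T0 + q"
  | (turn1) "turn_size T0 + q \<le> residue z" "residue z < turn_size T0 + q + turn_size T1"
  | (down) "turn_size T0 + q + turn_size T1 \<le> residue z" "residue z < P"
  using residue_less[of z] by linarith

lemma above_after_turn0:
  assumes "residue z = turn_size T0 - 1"
  shows "above (lv k) i (z + 1) = of_bool (xs ! 0 = i)"
proof -
  have "residue (z + 1) = turn_size T0"
    using residue_step[of z] assms turn_pos[of T0] turn_pos[of T1] by linarith
  then show ?thesis using above_up[of "z + 1"] q_pos by simp
qed

lemma above_after_turn1:
  assumes "residue z = turn_size T0 + q + turn_size T1 - 1"
  shows "above (lv k) i (z + 1) = of_bool (xs ! (q - 1) = i)"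
proof -
  have "residue (z + 1) = turn_size T0 + q + turn_size T1"
    using residue_step[of z] assms turn_pos[of T1] by linarith
  then show ?thesis using above_down[of "z + 1"] q_pos by (simp add: P_def)
qed

lemma below_turn1_start:
  assumes "residue z = turn_size T0 + q"
  shows "below (lv k) i z = of_bool (xs ! (q - 1) = i)"
proof -
  have "residue z - 1 - turn_size T0 = q - 1" using assms by simp
  then show ?thesis using below_up[of z] assms q_pos by simp
qed

lemma cube_condition:
  assumes "lv k z = Cube c" "i \<le> n"
  shows "A i c = 2 * of_bool (c = i) - int (below (lv k) i z) - int (above (lv k) i (z + 1))"
proof -
  note t = turning[unfolded turning_def, folded q_def]
  have X: "A i (xs ! j) = 2 * of_bool (xs ! j = i)
          - int (if j = 0 then turn_count i T0 else of_bool (xs ! (j - 1) = i))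
          - int (if j = q - 1 then turn_count i T1 else of_bool (xs ! (j + 1) = i))" if "j < q" for j
    using t that assms(2) by blast
  show ?thesis
  proof (cases rule: regions[of z])
    case turn0
    then have T: "turn_size T0 = 1" "residue z = 0" "c \<in> turn_colours T0" "turn_factor T0 = 2"
      using turn_levels_cube[of k T0 "residue z" c] assms(1) by (simp_all add: lv_nth)
    have "A i c = 2 * of_bool (c = i) - turn_factor T0 * of_bool (xs ! 0 = i)"
      using t T(3) assms(2) by blast
    then show ?thesis using below_0[of z k i] above_after_turn0[of z k i] T by simp
  next
    case up
    define j where "j = residue z - turn_size T0"
    have j: "j < q" "residue z = turn_size T0 + j" using up by (auto simp: j_def)
    have c: "c = xs ! j" using assms(1) up by (simp add: lv_nth j_def)
    have r1: "residue (z + 1) = residue z + 1" using residue_step[of z] up(2) by linarith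
    have "below (lv k) i z = (if j = 0 then turn_count i T0 else of_bool (xs ! (j - 1) = i))"
      using below_turn0[of z k i] below_up[of z k i] j by (simp add: diff_diff_add add.commute)
    moreover have "above (lv k) i (z + 1) = (if j = q - 1 then turn_count i T1 else of_bool (xs ! (j + 1) = i))"
      using above_turn1[of "z + 1" k i] above_up[of "z + 1" k i] j r1 by auto
    ultimately show ?thesis using X[OF j(1)] c by simp
  next
    case turn1
    then have T: "turn_size T1 = 1" "residue z - (turn_size T0 + q) = 0" "c \<in> turn_colours T1" "turn_factor T1 = 2"
      using turn_levels_cube[of k T1 "residue z - (turn_size T0 + q)" c] assms(1) by (simp_all add: lv_nth)
    then have "residue z = turn_size T0 + q" using turn1 by simp
    moreover have "A i c = 2 * of_bool (c = i) - turn_factor T1 * of_bool (xs ! (q - 1) = i)"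
      using t T(3) assms(2) by blast
    ultimately show ?thesis using below_turn1_start[of z k i] above_after_turn1[of z k i] T by simp
  next
    case down
    define j where "j = P - 1 - residue z"
    have j: "j < q" "residue z = P - 1 - j" using down by (auto simp: j_def P_def)
    have c: "c = xs ! j" using assms(1) down by (simp add: lv_nth j_def)
    have b: "below (lv k) i z = (if j = q - 1 then turn_count i T1 else of_bool (xs ! (j + 1) = i))"
    proof (cases "j = q - 1")
      case True
      then have "residue z = turn_size T0 + q + turn_size T1" using j q_pos by (simp add: P_def)
      then show ?thesis using below_turn1 True by simp
    next
      case False
      then have "turn_size T0 + q + turn_size T1 < residue z" "P - residue z = j + 1" using j by (auto simp: P_def)
      then show ?thesis using below_down[of z k i] False by simp
    qed
    have a: "above (lv k) i (z + 1) = (if j = 0 then turn_count i T0 else of_bool (xs ! (j - 1) = i))"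
    proof (cases "j = 0")
      case True
      then have "residue (z + 1) = 0" using residue_next[of z] j P_ge by simp
      then show ?thesis using above_turn0 True by simp
    next
      case False
      then have "residue (z + 1) = residue z + 1" using residue_next[of z] j down by auto
      moreover have "P - 1 - (residue z + 1) = j - 1" by (simp add: j_def)
      ultimately show ?thesis using above_down[of "z + 1" k i] down False by simp
    qed
    show ?thesis using X[OF j(1)] a b c by simp
  qed
qed

lemma half_cases:
  assumes "lv k z = Half_Height c"
  obtains (lower0) "residue z = 0" "c \<in> turn_colours T0" "turn_factor T0 = 1"
      "\<not> is_half (lv k (z - 1))" "lv k (z + 1) = Half_Height c"
  | (upper0) "residue z = turn_size T0 - 1" "c \<in> turn_colours T0" "turn_factor T0 = 1"
      "lv k (z - 1) = Half_Height c" "\<not> is_half (lv k (z + 1))"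
  | (lower1) "residue z = turn_size T0 + q" "c \<in> turn_colours T1" "turn_factor T1 = 1"
      "\<not> is_half (lv k (z - 1))" "lv k (z + 1) = Half_Height c"
  | (upper1) "residue z = turn_size T0 + q + turn_size T1 - 1" "c \<in> turn_colours T1" "turn_factor T1 = 1"
      "lv k (z - 1) = Half_Height c" "\<not> is_half (lv k (z + 1))"
proof -
  have nxt: "residue (z + 1) = residue z + 1" if "residue z < turn_size T0 + q + turn_size T1"
    using residue_step that .
  have prv: "residue (z - 1) = residue z - 1" if "residue z \<noteq> 0" using residue_prev[of z] that by simp
  show ?thesis
  proof (cases rule: regions[of z])
    case turn0
    then have T: "turn_size T0 = 2" "residue z = 0 \<or> residue z = 1" "c \<in> turn_colours T0" "turn_factor T0 = 1"
        "turn_levels k T0 = [Half_Height c, Half_Height c]"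
      using turn_levels_half[of k T0 "residue z" c] assms by (simp_all add: lv_nth)
    from T(2) show ?thesis
    proof
      assume z: "residue z = 0"
      have "lv k (z + 1) = Half_Height c" using nxt turn0 z T(1,5) by (simp add: lv_nth[of k "z + 1"])
      then show ?thesis using lower0 z T(3,4) lv_before[OF z, of k] by simp
    next
      assume z: "residue z = 1"
      have "lv k (z - 1) = Half_Height c" using prv z T(1,5) by (simp add: lv_nth[of k "z - 1"])
      moreover have "\<not> is_half (lv k (z + 1))"
        using nxt turn0 z T(1) q_pos by (simp add: lv_nth[of k "z + 1"])
      ultimately show ?thesis using upper0 z T(1,3,4) by simp
    qed
  next
    case turn1
    let ?d = "residue z - (turn_size T0 + q)"
    have T: "turn_size T1 = 2" "?d = 0 \<or> ?d = 1" "c \<in> turn_colours T1" "turn_factor T1 = 1"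
        "turn_levels k T1 = [Half_Height c, Half_Height c]"
      using turn_levels_half[of k T1 ?d c] assms turn1 by (simp_all add: lv_nth)
    have n: "residue (z + 1) = residue z + 1" using nxt turn1 by blast
    have p: "residue (z - 1) = residue z - 1" using prv turn1 q_pos by simp
    from T(2) show ?thesis
    proof
      assume "?d = 0"
      then have z: "residue z = turn_size T0 + q" using turn1 by simp
      have "lv k (z + 1) = Half_Height c" using n z T(1,5) by (simp add: lv_nth[of k "z + 1"])
      moreover have "\<not> is_half (lv k (z - 1))"
        using p z q_pos lv_nth[of k "z - 1"] by auto
      ultimately show ?thesis using lower1 z T(3,4) by blast
    next
      assume "?d = 1"
      then have z: "residue z = turn_size T0 + q + 1" using turn1 by simp
      have "lv k (z - 1) = Half_Height c" using p z T(1,5) by (simp add: lv_nth[of k "z - 1"])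
      moreover have "\<not> is_half (lv k (z + 1))"
        using n z T(1) by (simp add: lv_nth[of k "z + 1"])
      ultimately show ?thesis using upper1 z T(1,3,4) by simp
    qed
  qed (use assms in \<open>auto simp: lv_nth\<close>)
qed

lemma split_cases:
  assumes "lv k z = Split b f"
  obtains (0) "residue z = 0" "residue z = turn_size T0 - 1" "b \<in> turn_colours T0" "f \<in> turn_colours T0"
      "turn_factor T0 = 1" "b \<noteq> f"
  | (1) "residue z = turn_size T0 + q" "residue z = turn_size T0 + q + turn_size T1 - 1"
      "b \<in> turn_colours T1" "f \<in> turn_colours T1" "turn_factor T1 = 1" "b \<noteq> f"
proof (cases rule: regions[of z])
  case turn0
  then have "turn_levels k T0 ! residue z = Split b f" using assms by (simp add: lv_nth)
  note T = turn_levels_split[OF this turn0]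
  have "turn_distinct T0" using turning by (simp add: turning_def)
  with T have "b \<noteq> f" "residue z = 0" "residue z = turn_size T0 - 1" by auto
  then show ?thesis using that(1) T by blast
next
  case turn1
  let ?d = "residue z - (turn_size T0 + q)"
  have "turn_levels k T1 ! ?d = Split b f" using assms turn1 by (simp add: lv_nth)
  moreover have "?d < turn_size T1" using turn1 by linarith
  ultimately have T: "turn_size T1 = 1 \<and> ?d = 0 \<and> b \<in> turn_colours T1 \<and> f \<in> turn_colours T1 \<and> turn_factor T1 = 1 \<and>
     (turn_distinct T1 \<longrightarrow> b \<noteq> f)" by (rule turn_levels_split)
  have "turn_distinct T1" using turning by (simp add: turning_def)
  moreover have "residue z = turn_size T0 + q" "residue z = turn_size T0 + q + turn_size T1 - 1"
    using T turn1 by linarith+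
  ultimately show ?thesis using that(2) T by blast
qed (use assms in \<open>auto simp: lv_nth\<close>)

lemma swapped_turn: "turn_levels (Suc k) T = map swapped (turn_levels k T)"
  by (cases T) (auto simp: alt_split_def)

sublocale column_pattern lv "int P" A n
proof
  note t = turning[unfolded turning_def, folded q_def]
  show "int P > 0" using P_ge by simp
  show "lv k (z - int P) = lv k z" for k z by (simp add: lv_def)
  show "lv (Suc k) z = swapped (lv k z)" for k z
  proof -
    have "zigzag T0 xs T1 (Suc k) = map swapped (zigzag T0 xs T1 k)"
      by (simp add: zigzag_def swapped_turn)
    then show ?thesis using residue_less[of z] by (simp add: lv_def length_zigzag residue_def)
  qed
  show "b \<noteq> f" if "lv k z = Split b f" for k z b f
    by (rule split_cases[OF that])
  show "lv k (z - 1) = Half_Height c \<and> \<not> is_half (lv k (z + 1)) \<or>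
      \<not> is_half (lv k (z - 1)) \<and> lv k (z + 1) = Half_Height c" if "lv k z = Half_Height c" for k z c
    by (rule half_cases[OF that]) blast+
  show "i \<le> n" if "0 < mult i (lv k z)" for i k z
  proof -
    have le: "\<forall>c \<in> turn_colours T0 \<union> set xs \<union> turn_colours T1. c \<le> n" using t by blast
    have "set (zigzag T0 xs T1 k) = set (turn_levels k T0) \<union> Cube ` set xs \<union> set (turn_levels k T1)"
      by (auto simp: zigzag_def)
    moreover have "lv k z \<in> set (zigzag T0 xs T1 k)"
      unfolding lv_def residue_def[symmetric] using residue_less[of z] by (simp add: length_zigzag)
    moreover have "i \<in> turn_colours T" if "lv k z \<in> set (turn_levels k T)" for T
      using that \<open>0 < mult i (lv k z)\<close> by (cases T) (auto split: if_splits)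
    moreover have "i \<in> set xs" if "lv k z \<in> Cube ` set xs"
      using that \<open>0 < mult i (lv k z)\<close> by (auto split: if_splits)
    ultimately show ?thesis using le by blast
  qed
  show "A i i = 2" if "i \<le> n" for i using t that by blast
  show "A i c = 2 * of_bool (c = i) - int (below (lv k) i z) - int (above (lv k) i (z + 1))"
    if "lv k z = Cube c" "i \<le> n" for k z c i using cube_condition[OF that] .
  have T0: "A i c = 2 * of_bool (c = i) - of_bool (xs ! 0 = i)"
    if "c \<in> turn_colours T0" "turn_factor T0 = 1" "i \<le> n" for c i
  proof -
    have "A i c = 2 * of_bool (c = i) - turn_factor T0 * of_bool (xs ! 0 = i)" using t that(1,3) by blast
    then show ?thesis using that(2) by simp
  qed
  have T1: "A i c = 2 * of_bool (c = i) - of_bool (xs ! (q - 1) = i)"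
    if "c \<in> turn_colours T1" "turn_factor T1 = 1" "i \<le> n" for c i
  proof -
    have "A i c = 2 * of_bool (c = i) - turn_factor T1 * of_bool (xs ! (q - 1) = i)" using t that(1,3) by blast
    then show ?thesis using that(2) by simp
  qed
  show "A i c = 2 * of_bool (c = i) - int (below (lv k) i z)"
    if h: "lv k z = Half_Height c" "is_half (lv k (z + 1))" "i \<le> n" for k z c i
  proof (cases rule: half_cases[OF h(1)])
    case 1
    then show ?thesis using below_0[of z k i] T0[OF 1(2,3) h(3)] by simp
  next
    case 3
    then show ?thesis using below_turn1_start[of z k i] T1[OF 3(2,3) h(3)] by simp
  qed (use h in auto)
  show "A i c = 2 * of_bool (c = i) - int (above (lv k) i (z + 1))"
    if h: "lv k z = Half_Height c" "is_half (lv k (z - 1))" "i \<le> n" for k z c i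
  proof (cases rule: half_cases[OF h(1)])
    case 2
    then show ?thesis using above_after_turn0[of z k i] T0[OF 2(2,3) h(3)] by simp
  next
    case 4
    then show ?thesis using above_after_turn1[of z k i] T1[OF 4(2,3) h(3)] by simp
  qed (use h in auto)
  show "A i c = 2 * of_bool (c = i) - int (below (lv k) i z) \<and>
      A i c = 2 * of_bool (c = i) - int (above (lv k) i (z + 1))"
    if h: "lv k z = Split b f" "c \<in> {b, f}" "i \<le> n" for k z b f c i
  proof (cases rule: split_cases[OF h(1)])
    case 1
    then have "c \<in> turn_colours T0" using h(2) by blast
    then show ?thesis using 1(1,2) below_0[of z k i] above_after_turn0[of z k i] T0[OF _ 1(5) h(3), of c] by simp
  next
    case 2
    then have "c \<in> turn_colours T1" using h(2) by blast
    then show ?thesis using 2(1,2) below_turn1_start[of z k i] above_after_turn1[of z k i]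
        T1[OF _ 2(5) h(3), of c] by simp
  qed
qed

text \<open>The ground state contains the back half of a split level, or the lower one of a pair of
  half-height levels.\<close>

definition zigzag_ground :: "nat \<Rightarrow> state" where
  "zigzag_ground k = (if turn_size T0 = 2 then (1, Whole) else (0, Back))"

lemma sum_lv: "(\<Sum>z\<in>{0..<int P}. mult j (lv k z)) = sum_list (map (mult j) (zigzag T0 xs T1 k))"
proof -
  have "(\<Sum>z\<in>{0..<int P}. mult j (lv k z)) = (\<Sum>m<P. mult j (lv k (int m)))"
    by (rule sum.reindex_bij_witness[of _ int nat]) auto
  also have "\<dots> = (\<Sum>m<P. map (mult j) (zigzag T0 xs T1 k) ! m)"
    by (rule sum.cong) (simp_all add: lv_def length_zigzag)
  also have "\<dots> = sum_list (map (mult j) (zigzag T0 xs T1 k))"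
    by (simp add: sum_list_sum_nth length_zigzag atLeast0LessThan)
  finally show ?thesis .
qed

end

fun turn_front :: "turn \<Rightarrow> nat" where
  "turn_front (Turn_Split b c) = c" | "turn_front (Turn_Half c) = c" | "turn_front (Turn_Cube c) = c"

text \<open>The colour of the only block that can be added to column 0 of the ground-state wall is
  \<open>turn_front T0\<close>; it is \<open>l\<close> because the highest weight is $\Lambda_l$.\<close>

lemma turning_wall_pattern:
  assumes turning: "turning (cartan t n) n T0 xs T1"
    and pattern: "\<And>k. pattern t n l k = zigzag T0 xs T1 k"
    and t: "t \<noteq> A1" and T0: "\<And>c. T0 \<noteq> Turn_Cube c" and l: "turn_front T0 = l"
    and count: "\<And>j k. j \<le> n \<Longrightarrow> sum_list (map (mult j) (zigzag T0 xs T1 k)) = delta_coeff t n j"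
  shows "wall_pattern t n (turning_pattern.lv T0 xs T1) (int (turning_pattern.P T0 xs T1)) l
    (\<lambda>k. 0) (turning_pattern.zigzag_ground T0)"
proof -
  interpret turning_pattern "cartan t n" n T0 xs T1 by unfold_locales (rule turning)
  have at: "level_at t n l k m = lv k (int m)" for k m
    by (simp add: level_at_def pattern length_zigzag lv_def flip: zmod_int)
  have rr0: "residue 0 = 0" and rr1: "residue 1 = 1" and rrm: "residue (-1) = P - 1"
    using residue_small[of 0] residue_small[of 1] residue_prev[of 0] P_ge by auto
  have minus1: "\<not> half_at (-1)" using lv_before[OF rr0] is_half_lev[of 0 "-1"] by auto
  have ground_turn: "(\<exists>b. \<forall>k. turn_levels k T0 = [alt_split k b l]) \<and> turn_size T0 = 1 \<or>
    (\<forall>k. turn_levels k T0 = [Half_Height l, Half_Height l]) \<and> turn_size T0 = 2"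
    using T0 l by (cases T0) auto
  have lv0: "lv k 0 = turn_levels k T0 ! 0" for k using turn_pos[of T0] by (simp add: lv_nth rr0)
  have sp0: "split_at 0 \<longleftrightarrow> turn_size T0 = 1"
  proof -
    have "is_split (lv 0 0) \<longleftrightarrow> turn_size T0 = 1" unfolding lv0 using ground_turn by auto
    then show ?thesis by simp
  qed
  have h01: "lv k 0 = Half_Height l" "lv k 1 = Half_Height l" "half_at 0" "half_at 1" "\<not> half_at 2" if "turn_size T0 = 2" for k
  proof -
    have T: "turn_levels k T0 = [Half_Height l, Half_Height l]" for k using ground_turn that by auto
    show a: "lv k 0 = Half_Height l" "lv k 1 = Half_Height l" for k
      using that by (simp_all add: lv_nth rr0 rr1 T)
    show "half_at 0" "half_at 1" using half_lev a by blast+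
    have "residue 2 = 2" using residue_next[of 1] rr1 q_pos that turn_pos[of T1] by (simp add: P_def)
    then have "\<not> is_half (lv 0 2)" using q_pos that by (simp add: lv_nth del: is_half_lev)
    then show "\<not> half_at 2" by simp
  qed
  show ?thesis
  proof
    show "level_at t n l k m = lv k (int m - int 0)" for k m using at by simp
    show "Place k m s \<in> ground_wall t n l \<longleftrightarrow>
      s \<in> parts_at (int m - int 0) \<and> filled (zigzag_ground k) (int m - int 0) s" for k m s
    proof -
      have "Place k m s \<in> ground_wall t n l \<longleftrightarrow> s \<in> parts_at (int m) \<and> m = 0 \<and> s \<noteq> Front"
        using t by (auto simp: ground_wall_def places_def at)
      moreover have "s \<in> parts_at 0 \<and> s \<noteq> Front \<longleftrightarrow> s \<in> parts_at 0 \<and> (turn_size T0 = 2 \<or> s = Back)"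
        using ground_turn sp0 by (auto simp: parts_at_def)
      ultimately show ?thesis by (auto simp: filled_def zigzag_ground_def)
    qed
    show v: "valid (zigzag_ground k)" for k
      using ground_turn sp0 by (auto simp: valid_def zigzag_ground_def)
    show "- int 0 \<le> fst (zigzag_ground k)" for k by (simp add: zigzag_ground_def)
    show "fits (zigzag_ground (Suc k)) b \<longleftrightarrow> le (zigzag_ground k) b" if "valid b" for k b
    proof -
      have "\<not> full (zigzag_ground k)"
      proof (cases "turn_size T0 = 2")
        case True
        then show ?thesis using h01 by (simp add: full_def zigzag_ground_def mid_def)
      next
        case False
        then show ?thesis by (simp add: full_def zigzag_ground_def)
      qed
      moreover have "zigzag_ground (Suc k) = zigzag_ground k" by (simp add: zigzag_ground_def)
      ultimately show ?thesis by (auto simp: fits_def)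
    qed
    have g: "phi (Suc k) i (zigzag_ground (Suc k)) = eps k i (zigzag_ground k) \<and>
        phi 0 i (zigzag_ground 0) = of_bool (l = i)" for k i
    proof (cases "turn_size T0 = 2")
      case True
      note h = h01[OF True]
      have "phi k i (zigzag_ground k) = of_bool (l = i)" for k
        using True h by (simp add: zigzag_ground_def above_def)
      moreover have "eps k i (zigzag_ground k) = of_bool (l = i)"
        using True h minus1 by (simp add: zigzag_ground_def below_def)
      ultimately show ?thesis by simp
    next
      case False
      then obtain b where "\<forall>k. turn_levels k T0 = [alt_split k b l]" using ground_turn by auto
      then have "lv k 0 = alt_split k b l" for k by (simp add: lv0)
      then show ?thesis using False by (simp add: zigzag_ground_def colour_at_def alt_split_def)
    qed
    show "phi (Suc k) i (zigzag_ground (Suc k)) = eps k i (zigzag_ground k)" for k i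
      using g by blast
    show "phi 0 i (zigzag_ground 0) = of_bool (i = l)" for i using g by (auto simp: eq_commute)
    show "t = A1 \<and> (\<forall>k. 0 = k) \<and> (\<forall>z. \<not> split_at z \<and> \<not> half_at z) \<or> t \<noteq> A1 \<and> (\<forall>k::nat. (0::nat) = 0) \<and> \<not> mid 0"
      using t minus1 by (simp add: mid_def)
    show "(\<Sum>z\<in>{0..<int P}. mult j (lv k z)) = delta_coeff t n j" if "j \<le> n" for j k
      unfolding sum_lv using count[OF that] .
    have "turn_front T0 \<in> turn_colours T0" by (cases T0) auto
    then show "l \<le> n" using turning l by (auto simp: turning_def)
  qed
qed

section \<open>The patterns of the affine types\<close>

lemma count_cubes: "sum_list (map (mult j) (map Cube xs)) = count_list xs j"
  by (induction xs) auto

lemma count_upt: "count_list [a..<b] j = of_bool (a \<le> j \<and> j < b)"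
  by (induction b) auto

lemma count_turn: "sum_list (map (mult j) (turn_levels k T)) = turn_count j T"
  by (cases T) auto

lemma count_zigzag:
  "sum_list (map (mult j) (zigzag T0 xs T1 k)) = turn_count j T0 + turn_count j T1 + 2 * count_list xs j"
proof -
  have "count_list (rev xs) j = count_list xs j" by simp
  then show ?thesis
    unfolding zigzag_def map_append sum_list_append count_cubes count_turn by simp
qed

lemma turningI:
  assumes "a < b" "turn_distinct T0" "turn_distinct T1" "b \<le> Suc n"
    and "\<And>c. c \<in> turn_colours T0 \<Longrightarrow> c \<le> n" "\<And>c. c \<in> turn_colours T1 \<Longrightarrow> c \<le> n"
    and "\<And>i. i \<le> n \<Longrightarrow> A i i = 2"
    and "\<And>i c. i \<le> n \<Longrightarrow> c \<in> turn_colours T0 \<Longrightarrow>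
      A i c = 2 * of_bool (c = i) - turn_factor T0 * of_bool (a = i)"
    and "\<And>i c. i \<le> n \<Longrightarrow> c \<in> turn_colours T1 \<Longrightarrow>
      A i c = 2 * of_bool (c = i) - turn_factor T1 * of_bool (b - 1 = i)"
    and "\<And>i c. i \<le> n \<Longrightarrow> a \<le> c \<Longrightarrow> c < b \<Longrightarrow> A i c = 2 * of_bool (c = i)
      - int (if c = a then turn_count i T0 else of_bool (c - 1 = i))
      - int (if c = b - 1 then turn_count i T1 else of_bool (c + 1 = i))"
  shows "turning A n T0 [a..<b] T1"
proof -
  have "A i ([a..<b] ! j) = 2 * of_bool ([a..<b] ! j = i)
      - int (if j = 0 then turn_count i T0 else of_bool ([a..<b] ! (j - 1) = i))
      - int (if j = length [a..<b] - 1 then turn_count i T1 else of_bool ([a..<b] ! (j + 1) = i))"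
    if ij: "i \<le> n" "j < length [a..<b]" for i j
  proof -
    have j: "[a..<b] ! j = a + j" "a + j < b" using ij by simp_all
    have last: "(a + j = b - 1) = (j = length [a..<b] - 1)" using j(2) by simp linarith
    have prv: "[a..<b] ! (j - 1) = a + j - 1" if "j \<noteq> 0" using that j(2) by simp
    have nxt: "[a..<b] ! (j + 1) = a + j + 1" if "j \<noteq> length [a..<b] - 1" using that j(2) by simp
    have f1: "(if a + j = a then turn_count i T0 else of_bool (a + j - 1 = i)) =
        (if j = 0 then turn_count i T0 else of_bool ([a..<b] ! (j - 1) = i))"
      by (rule if_cong) (simp, rule refl, metis prv)
    have f2: "(if a + j = b - 1 then turn_count i T1 else of_bool (a + j + 1 = i)) =
        (if j = length [a..<b] - 1 then turn_count i T1 else of_bool ([a..<b] ! (j + 1) = i))"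
      by (rule if_cong) (rule last, rule refl, metis nxt)
    have f3: "A i (a + j) = 2 * of_bool (a + j = i)
      - int (if a + j = a then turn_count i T0 else of_bool (a + j - 1 = i))
      - int (if a + j = b - 1 then turn_count i T1 else of_bool (a + j + 1 = i))"
      using j(2) by (intro assms(10)[OF ij(1)]) simp_all
    show ?thesis unfolding j(1) f1[symmetric] f2[symmetric] by (rule f3)
  qed
  note X = this
  have ends: "[a..<b] ! 0 = a" "[a..<b] ! (length [a..<b] - 1) = b - 1" using assms(1) by simp_all
  show ?thesis unfolding turning_def
  proof (intro conjI allI impI ballI)
    show "[a..<b] \<noteq> []" using assms(1) by simp
    show "c \<le> n" if "c \<in> turn_colours T0 \<union> set [a..<b] \<union> turn_colours T1" for c
      using that assms(4-6) by auto
    show "A i c = 2 * of_bool (c = i) - turn_factor T0 * of_bool ([a..<b] ! 0 = i)"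
      if "i \<le> n" "c \<in> turn_colours T0" for i c unfolding ends by (rule assms(8)[OF that])
    show "A i c = 2 * of_bool (c = i) - turn_factor T1 * of_bool ([a..<b] ! (length [a..<b] - 1) = i)"
      if "i \<le> n" "c \<in> turn_colours T1" for i c unfolding ends by (rule assms(9)[OF that])
  qed (fact assms(2,3) | rule assms(7) X; assumption)+
qed

text \<open>The colours in between are shifted by one in order to avoid subtraction.\<close>

lemma turning_SucI:
  assumes "a < m" "turn_distinct T0" "turn_distinct T1" "m \<le> n"
    and "\<And>c. c \<in> turn_colours T0 \<Longrightarrow> c \<le> n" "\<And>c. c \<in> turn_colours T1 \<Longrightarrow> c \<le> n"
    and "\<And>i. i \<le> n \<Longrightarrow> A i i = 2"
    and "\<And>i c. i \<le> n \<Longrightarrow> c \<in> turn_colours T0 \<Longrightarrow>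
      A i c = 2 * of_bool (c = i) - turn_factor T0 * of_bool (Suc a = i)"
    and "\<And>i c. i \<le> n \<Longrightarrow> c \<in> turn_colours T1 \<Longrightarrow>
      A i c = 2 * of_bool (c = i) - turn_factor T1 * of_bool (m = i)"
    and *: "\<And>i c. i \<le> n \<Longrightarrow> a \<le> c \<Longrightarrow> c < m \<Longrightarrow> A i (Suc c) = 2 * of_bool (Suc c = i)
      - int (if c = a then turn_count i T0 else of_bool (c = i))
      - int (if Suc c = m then turn_count i T1 else of_bool (Suc (Suc c) = i))"
  shows "turning A n T0 [Suc a..<Suc m] T1"
proof (rule turningI)
  fix i c assume i: "i \<le> n" and c: "Suc a \<le> c" "c < Suc m"
  obtain d where d: "c = Suc d" using c(1) by (cases c) auto
  have d': "a \<le> d" "d < m" using c d by simp_all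
  show "A i c = 2 * of_bool (c = i) - int (if c = Suc a then turn_count i T0 else of_bool (c - 1 = i))
      - int (if c = Suc m - 1 then turn_count i T1 else of_bool (c + 1 = i))"
    unfolding d using *[OF i d'] by simp
next
  show "A i c = 2 * of_bool (c = i) - turn_factor T1 * of_bool (Suc m - 1 = i)"
    if "i \<le> n" "c \<in> turn_colours T1" for i c using assms(9)[OF that] by simp
qed (use assms(1-8) in \<open>simp_all\<close>)

lemma neighbour_cases:
  fixes i c :: nat
  obtains "i = Suc c" | "i = c" | "i = Suc (Suc c)" | "i \<noteq> Suc c" "i \<noteq> c" "i \<noteq> Suc (Suc c)"
  by blast

lemma fork_iff: "fork i j \<longleftrightarrow> i = 0 \<and> j = 2 \<or> i = 2 \<and> j = 0 \<or> i = 1 \<and> j = 2 \<or> i = 2 \<and> j = 1"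
  by (auto simp: fork_def doubleton_eq_iff)

lemma turning_A2odd:
  assumes "2 \<le> m" "(b0, c0) = (0, 1) \<or> (b0, c0) = (1, 0)"
  shows "turning (cartan A2odd (Suc m)) (Suc m) (Turn_Split b0 c0) [Suc 1..<Suc m] (Turn_Cube (Suc m))"
proof -
  have T: "turn_count i (Turn_Split b0 c0) = of_bool (i = 0) + of_bool (i = 1)"
      "turn_colours (Turn_Split b0 c0) = {0, 1}" "turn_distinct (Turn_Split b0 c0)" for i
    using assms(2) by auto
  show ?thesis
  proof (rule turning_SucI)
    fix i c assume i: "i \<le> Suc m" and c: "1 \<le> c" "c < m"
    show "cartan A2odd (Suc m) i (Suc c) = 2 * of_bool (Suc c = i)
        - int (if c = 1 then turn_count i (Turn_Split b0 c0) else of_bool (c = i))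
        - int (if Suc c = m then turn_count i (Turn_Cube (Suc m)) else of_bool (Suc (Suc c) = i))"
      using assms(1) i c unfolding T
      by (cases rule: neighbour_cases[of i c]) (auto simp: cartan_def fork_iff chain_def)
  qed (use assms(1) in \<open>auto simp: T cartan_def fork_iff chain_def
      simp del: turn_count.simps turn_colours.simps(1) turn_distinct.simps(1)\<close>)
qed

lemma turning_D1:
  assumes "2 \<le> m" "(b0, c0) = (0, 1) \<or> (b0, c0) = (1, 0)"
    "(b1, c1) = (Suc m, Suc (Suc m)) \<or> (b1, c1) = (Suc (Suc m), Suc m)"
  shows "turning (cartan D1 (Suc (Suc m))) (Suc (Suc m)) (Turn_Split b0 c0) [Suc 1..<Suc m] (Turn_Split b1 c1)"
proof -
  have T: "turn_count i (Turn_Split b0 c0) = of_bool (i = 0) + of_bool (i = 1)"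
      "turn_colours (Turn_Split b0 c0) = {0, 1}" "turn_distinct (Turn_Split b0 c0)" for i
    using assms(2) by auto
  have T': "turn_count i (Turn_Split b1 c1) = of_bool (i = Suc m) + of_bool (i = Suc (Suc m))"
      "turn_colours (Turn_Split b1 c1) = {Suc m, Suc (Suc m)}" "turn_distinct (Turn_Split b1 c1)" for i
    using assms(3) by auto
  show ?thesis
  proof (rule turning_SucI)
    fix i c assume i: "i \<le> Suc (Suc m)" and c: "1 \<le> c" "c < m"
    show "cartan D1 (Suc (Suc m)) i (Suc c) = 2 * of_bool (Suc c = i)
        - int (if c = 1 then turn_count i (Turn_Split b0 c0) else of_bool (c = i))
        - int (if Suc c = m then turn_count i (Turn_Split b1 c1) else of_bool (Suc (Suc c) = i))"
      using assms(1) i c unfolding T T'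
      by (cases rule: neighbour_cases[of i c]) (auto simp: cartan_def fork_iff chain_def doubleton_eq_iff)
  qed (use assms(1) in \<open>auto simp: T T' cartan_def fork_iff chain_def doubleton_eq_iff
      simp del: turn_count.simps turn_colours.simps(1) turn_distinct.simps(1)\<close>)
qed

lemma turning_A2even:
  assumes "1 \<le> m"
  shows "turning (cartan A2even (Suc m)) (Suc m) (Turn_Half 0) [Suc 0..<Suc m] (Turn_Cube (Suc m))"
proof (rule turning_SucI)
  fix i c assume i: "i \<le> Suc m" and c: "0 \<le> c" "c < m"
  show "cartan A2even (Suc m) i (Suc c) = 2 * of_bool (Suc c = i)
      - int (if c = 0 then turn_count i (Turn_Half 0) else of_bool (c = i))
      - int (if Suc c = m then turn_count i (Turn_Cube (Suc m)) else of_bool (Suc (Suc c) = i))"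
    using assms i c
    by (cases rule: neighbour_cases[of i c]) (auto simp: cartan_def chain_def)
qed (use assms in \<open>auto simp: cartan_def chain_def\<close>)

lemma turning_D2:
  assumes "1 \<le> m"
  shows "turning (cartan D2 (Suc m)) (Suc m) (Turn_Half 0) [Suc 0..<Suc m] (Turn_Half (Suc m))"
proof (rule turning_SucI)
  fix i c assume i: "i \<le> Suc m" and c: "0 \<le> c" "c < m"
  show "cartan D2 (Suc m) i (Suc c) = 2 * of_bool (Suc c = i)
      - int (if c = 0 then turn_count i (Turn_Half 0) else of_bool (c = i))
      - int (if Suc c = m then turn_count i (Turn_Half (Suc m)) else of_bool (Suc (Suc c) = i))"
    using assms i c
    by (cases rule: neighbour_cases[of i c]) (auto simp: cartan_def chain_def)
qed (use assms in \<open>auto simp: cartan_def chain_def\<close>)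

lemma turning_B1:
  assumes "2 \<le> m" "(b0, c0) = (0, 1) \<or> (b0, c0) = (1, 0)"
  shows "turning (cartan B1 (Suc m)) (Suc m) (Turn_Split b0 c0) [Suc 1..<Suc m] (Turn_Half (Suc m))"
proof -
  have T: "turn_count i (Turn_Split b0 c0) = of_bool (i = 0) + of_bool (i = 1)"
      "turn_colours (Turn_Split b0 c0) = {0, 1}" "turn_distinct (Turn_Split b0 c0)" for i
    using assms(2) by auto
  show ?thesis
  proof (rule turning_SucI)
    fix i c assume i: "i \<le> Suc m" and c: "1 \<le> c" "c < m"
    show "cartan B1 (Suc m) i (Suc c) = 2 * of_bool (Suc c = i)
        - int (if c = 1 then turn_count i (Turn_Split b0 c0) else of_bool (c = i))
        - int (if Suc c = m then turn_count i (Turn_Half (Suc m)) else of_bool (Suc (Suc c) = i))"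
      using assms(1) i c unfolding T
      by (cases rule: neighbour_cases[of i c]) (auto simp: cartan_def fork_iff chain_def)
  qed (use assms(1) in \<open>auto simp: T cartan_def fork_iff chain_def
      simp del: turn_count.simps turn_colours.simps(1) turn_distinct.simps(1)\<close>)
qed

text \<open>Level \<open>z\<close> is the content of a box, and the colour depends on the content only. Column \<open>k\<close> is empty in the
  ground state, so it ends below content \<open>- k\<close>.\<close>

lemma wall_pattern_A1:
  assumes "1 \<le> n" "l \<le> n"
  shows "wall_pattern A1 n (\<lambda>k z. Cube (nat ((int l + z) mod (int n + 1)))) (int n + 1) l
    (\<lambda>k. k) (\<lambda>k. (- int k, Whole))"
proof -
  let ?N = "int n + 1"
  define cl where "cl z = nat ((int l + z) mod ?N)" for z
  define lev where "lev k z = Cube (cl z)" for k :: nat and z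
  have cl: "int (cl z) = (int l + z) mod ?N" for z by (simp add: cl_def)
  have cl_le: "cl z \<le> n" for z
  proof -
    have "(int l + z) mod ?N < ?N" by (rule pos_mod_bound) simp
    then show ?thesis unfolding cl[symmetric] by simp
  qed
  have ab: "above (lev k) i z = of_bool (cl z = i)" "below (lev k) i z = of_bool (cl (z - 1) = i)" for k i z
    by (simp_all add: above_def below_def lev_def)
  have lt: "int i mod ?N = int i" if "i \<le> n" for i using that by simp
  have nxt: "cl (z + 1) = i \<longleftrightarrow> (int i - int (cl z)) mod ?N = 1" if "i \<le> n" for z i
  proof -
    have "cl (z + 1) = i \<longleftrightarrow> (int l + (z + 1)) mod ?N = int i mod ?N"
      unfolding lt[OF that] cl[symmetric] by simp
    also have "\<dots> \<longleftrightarrow> ?N dvd int l + (z + 1) - int i" by (rule mod_eq_dvd_iff)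
    also have "\<dots> \<longleftrightarrow> ?N dvd int i - (int l + z) - 1" by (subst dvd_minus_iff[symmetric]) (simp add: algebra_simps)
    also have "\<dots> \<longleftrightarrow> (int i - (int l + z)) mod ?N = 1 mod ?N" by (rule mod_eq_dvd_iff[symmetric])
    also have "(int i - (int l + z)) mod ?N = (int i - int (cl z)) mod ?N" by (simp add: cl mod_simps)
    also have "1 mod ?N = 1" using assms by simp
    finally show ?thesis .
  qed
  have prv: "cl (z - 1) = i \<longleftrightarrow> (int i - int (cl z)) mod ?N = int n" if "i \<le> n" for z i
  proof -
    have "cl (z - 1) = i \<longleftrightarrow> (int l + (z - 1)) mod ?N = int i mod ?N"
      unfolding lt[OF that] cl[symmetric] by simp
    also have "\<dots> \<longleftrightarrow> ?N dvd int l + (z - 1) - int i" by (rule mod_eq_dvd_iff)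
    also have "\<dots> \<longleftrightarrow> ?N dvd int i - (int l + z) - (- 1)" by (subst dvd_minus_iff[symmetric]) (simp add: algebra_simps)
    also have "\<dots> \<longleftrightarrow> (int i - (int l + z)) mod ?N = (- 1) mod ?N" by (rule mod_eq_dvd_iff[symmetric])
    also have "(int i - (int l + z)) mod ?N = (int i - int (cl z)) mod ?N" by (simp add: cl mod_simps)
    also have "(- 1) mod ?N = int n" by (simp add: zmod_minus1)
    finally show ?thesis .
  qed
  have ne: "cl (z + 1) \<noteq> cl z" "cl (z - 1) \<noteq> cl z" for z
    using nxt[OF cl_le, of z z] prv[OF cl_le, of z z] assms by auto
  interpret column_pattern lev ?N "cartan A1 n" n
  proof
    show "lev k (z - ?N) = lev k z" for k z
    proof -
      have "(int l + (z - ?N)) mod ?N = (int l + z) mod ?N"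
        by (metis add_diff_eq minus_mod_self2)
      then show ?thesis by (simp add: lev_def cl_def)
    qed
    show "cartan A1 n i c = 2 * of_bool (c = i) - int (below (lev k) i z) - int (above (lev k) i (z + 1))"
      if "lev k z = Cube c" "i \<le> n" for k z c i
    proof -
      have c: "c = cl z" using that by (simp add: lev_def)
      show ?thesis
      proof (cases "i = c")
        case True
        then show ?thesis using ne[of z] c cl_le[of z] by (auto simp: ab cartan_def)
      next
        case False
        have "cl (z + 1) = i \<longleftrightarrow> (int i - int c) mod ?N = 1" "cl (z - 1) = i \<longleftrightarrow> (int i - int c) mod ?N = int n"
          using nxt prv that(2) c by auto
        then have e: "below (lev k) i z = of_bool ((int i - int c) mod ?N = int n)"
          "above (lev k) i (z + 1) = of_bool ((int i - int c) mod ?N = 1)" by (simp_all add: ab)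
        show ?thesis
        proof (cases "n = 1")
          case True
          then have "i = 0 \<and> c = 1 \<or> i = 1 \<and> c = 0" using False that(2) cl_le[of z] c by auto
          then have "(int i - int c) mod ?N = 1" using True by auto
          then show ?thesis using True False that(2) cl_le[of z] c unfolding e by (simp add: cartan_def)
        next
          case n1: False
          then show ?thesis using False that(2) cl_le[of z] c assms(1) unfolding e by (auto simp: cartan_def)
        qed
      qed
    qed
  qed (use cl_le in \<open>auto simp: lev_def cartan_def split: if_splits\<close>)
  have ns: "\<not> split_at z" "\<not> half_at z" for z by (simp_all add: split_at_def half_at_def lev_def)
  have parts_at: "parts_at z = {Whole}" for z by (simp add: parts_at_def ns)
  have "wall_pattern A1 n lev ?N l (\<lambda>k. k) (\<lambda>k. (- int k, Whole))"
  proof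
    show "level_at A1 n l k m = lev k (int m - int k)" for k m
    proof -
      have "level_at A1 n l k m = Cube (nat ((int l - int k + int (m mod (n + 1))) mod ?N))"
        using mod_less_divisor[of "n + 1" m] by (simp add: level_at_def del: upt_Suc mod_less_divisor)
      also have "(int l - int k + int (m mod (n + 1))) mod ?N = (int l - int k + int m) mod ?N"
        by (simp add: zmod_int mod_simps add.commute)
      finally show ?thesis by (simp add: lev_def cl_def algebra_simps)
    qed
    show "Place k m s \<in> ground_wall A1 n l \<longleftrightarrow>
      s \<in> parts_at (int m - int k) \<and> filled (- int k, Whole) (int m - int k) s" for k m s
      by (simp add: ground_wall_def filled_def)
    show "valid (- int k, Whole)" for k by (simp add: valid_def)
    show "- int k \<le> fst (- int k, Whole)" for k by simp
    show "fits (- int (Suc k), Whole) b \<longleftrightarrow> le (- int k, Whole) b" if "valid b" for k b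
      using that ns by (cases b) (auto simp: fits_def le_def full_def mid_def valid_def)
    show "phi (Suc k) i (- int (Suc k), Whole) = eps k i (- int k, Whole)" for k i
    proof -
      have "- int k - 1 = - int (Suc k)" by simp
      then show ?thesis unfolding phi.simps eps.simps ab by metis
    qed
    show "phi 0 i (- int 0, Whole) = of_bool (i = l)" for i
    proof -
      have "cl 0 = l" using assms(2) by (simp add: cl_def)
      then show ?thesis by (auto simp: ab)
    qed
    show "A1 = A1 \<and> (\<forall>k. k = k) \<and> (\<forall>z. \<not> split_at z \<and> \<not> half_at z) \<or> A1 \<noteq> A1 \<and> (\<forall>k::nat. k = 0) \<and> \<not> mid 0"
      using ns by simp
    show "(\<Sum>z\<in>{0..<?N}. mult j (lev k z)) = delta_coeff A1 n j" if "j \<le> n" for j k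
    proof -
      have "mult j (lev k z) = of_bool (z = (int j - int l) mod ?N)" if z: "z \<in> {0..<?N}" for z
      proof -
        have "cl z = j \<longleftrightarrow> (int l + z) mod ?N = int j mod ?N"
          unfolding lt[OF \<open>j \<le> n\<close>] cl[symmetric] by simp
        also have "\<dots> \<longleftrightarrow> ?N dvd int l + z - int j" by (rule mod_eq_dvd_iff)
        also have "\<dots> \<longleftrightarrow> ?N dvd z - (int j - int l)" by (simp add: algebra_simps)
        also have "\<dots> \<longleftrightarrow> z mod ?N = (int j - int l) mod ?N" by (rule mod_eq_dvd_iff[symmetric])
        also have "z mod ?N = z" using z by simp
        finally show ?thesis by (simp add: lev_def)
      qed
      then have "(\<Sum>z\<in>{0..<?N}. mult j (lev k z)) = (\<Sum>z\<in>{0..<?N}. of_bool (z = (int j - int l) mod ?N))"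
        by (intro sum.cong) auto
      also have "\<dots> = 1"
      proof -
        have "(int j - int l) mod ?N < ?N" by (rule pos_mod_bound) simp
        then show ?thesis by (simp add: of_bool_def sum.delta)
      qed
      finally show ?thesis by (simp add: delta_coeff_def)
    qed
    show "l \<le> n" by fact
  qed
  then show ?thesis unfolding lev_def cl_def .
qed

lemma wall_pattern_of_turning:
  assumes "turning (cartan t n) n T0 xs T1" "\<And>k. pattern t n l k = zigzag T0 xs T1 k"
    and "t \<noteq> A1" "\<And>c. T0 \<noteq> Turn_Cube c" "turn_front T0 = l"
    and "\<And>j. j \<le> n \<Longrightarrow> turn_count j T0 + turn_count j T1 + 2 * count_list xs j = delta_coeff t n j"
  shows "\<exists>lev period off g. wall_pattern t n lev period l off g"
  using turning_wall_pattern[OF assms(1-5)] assms(6) unfolding count_zigzag by blast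

text \<open>The patterns that start at the other end of the diagram are obtained by reversing the walk.\<close>

lemma wall_pattern_exists:
  assumes "rank_ok t n" "l \<in> level1 t n"
  shows "\<exists>lev period off g. wall_pattern t n lev period l off g"
proof (cases t)
  case A1
  then show ?thesis using wall_pattern_A1[of n l] assms by auto
next
  case A2odd
  define b where "b = 1 - l"
  obtain m where n: "n = Suc m" and m: "2 \<le> m" using A2odd assms by (cases n) auto
  have bl: "(b, l) = (0, 1) \<or> (b, l) = (1, 0)" using A2odd assms by (auto simp: b_def)
  show ?thesis unfolding A2odd n
    by (rule wall_pattern_of_turning[OF turning_A2odd[OF m bl]])
      (use m bl in \<open>auto simp: zigzag_def delta_coeff_def count_upt numeral_2_eq_2\<close>)
next
  case D1
  obtain m where n: "n = Suc (Suc m)" and m: "2 \<le> m"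
  proof -
    have "n = Suc (Suc (n - 2))" "2 \<le> n - 2" using D1 assms by auto
    then show ?thesis by (rule that)
  qed
  have l: "l \<in> {0, 1, Suc m, n}" using D1 assms n by auto
  show ?thesis
  proof (cases "l \<le> 1")
    case True
    define b where "b = 1 - l"
    have bl: "(b, l) = (0, 1) \<or> (b, l) = (1, 0)" using True by (auto simp: b_def)
    have ends: "(n, Suc m) = (Suc m, Suc (Suc m)) \<or> (n, Suc m) = (Suc (Suc m), Suc m)"
      using n by simp
    show ?thesis unfolding D1
      by (rule wall_pattern_of_turning[OF turning_D1[OF m bl ends, folded n]])
        (use m n bl in \<open>auto simp: zigzag_def delta_coeff_def count_upt numeral_2_eq_2\<close>)
  next
    case False
    define b where "b = (if l = n then Suc m else n)"
    have bl: "(b, l) = (Suc m, Suc (Suc m)) \<or> (b, l) = (Suc (Suc m), Suc m)"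
      using False l n by (auto simp: b_def)
    have ends: "(1, 0) = (0, 1) \<or> (1, 0) = (1, 0 :: nat)" by simp
    show ?thesis unfolding D1
      by (rule wall_pattern_of_turning[OF turning_rev[OF turning_D1[OF m ends bl, folded n]]])
        (use m n bl False in \<open>auto simp: zigzag_def delta_coeff_def count_upt numeral_2_eq_2\<close>)
  qed
next
  case A2even
  obtain m where n: "n = Suc m" and m: "1 \<le> m" using A2even assms by (cases n) auto
  have l: "l = 0" using A2even assms by auto
  show ?thesis unfolding A2even l n
    by (rule wall_pattern_of_turning[OF turning_A2even[OF m]])
      (use m in \<open>auto simp: zigzag_def delta_coeff_def count_upt\<close>)
next
  case D2
  obtain m where n: "n = Suc m" and m: "1 \<le> m" using D2 assms by (cases n) auto
  have l: "l = 0 \<or> l = Suc m" using D2 assms n by auto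
  show ?thesis
  proof (cases "l = 0")
    case True
    show ?thesis unfolding D2 True n
      by (rule wall_pattern_of_turning[OF turning_D2[OF m]])
        (use m in \<open>auto simp: zigzag_def delta_coeff_def count_upt\<close>)
  next
    case False
    then have l: "l = Suc m" using l by blast
    show ?thesis unfolding D2 l n
      by (rule wall_pattern_of_turning[OF turning_rev[OF turning_D2[OF m]]])
        (use m in \<open>auto simp: zigzag_def delta_coeff_def count_upt\<close>)
  qed
next
  case B1
  obtain m where n: "n = Suc m" and m: "2 \<le> m" using B1 assms by (cases n) auto
  have l: "l \<in> {0, 1, Suc m}" using B1 assms n by auto
  show ?thesis
  proof (cases "l \<le> 1")
    case True
    define b where "b = 1 - l"
    have bl: "(b, l) = (0, 1) \<or> (b, l) = (1, 0)" using True by (auto simp: b_def)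
    show ?thesis unfolding B1 n
      by (rule wall_pattern_of_turning[OF turning_B1[OF m bl]])
        (use m bl in \<open>auto simp: zigzag_def delta_coeff_def count_upt numeral_2_eq_2\<close>)
  next
    case False
    then have l: "l = Suc m" using l by auto
    have ends: "(1, 0) = (0, 1) \<or> (1, 0) = (1, 0 :: nat)" by simp
    show ?thesis unfolding B1 l n
      by (rule wall_pattern_of_turning[OF turning_rev[OF turning_B1[OF m ends]]])
        (use m in \<open>auto simp: zigzag_def delta_coeff_def count_upt numeral_2_eq_2\<close>)
  qed
qed

theorem theorem6p7:
  fixes t :: affine_type and n l :: nat
  assumes "rank_ok t n" and "l \<in> level1 t n"
  shows "(\<forall>i\<in>{0..n}. \<forall>Y\<in>reduced_walls t n l.
            e_op t n l i Y \<in> insert None (Some ` reduced_walls t n l) \<and>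
            f_op t n l i Y \<in> insert None (Some ` reduced_walls t n l)) \<and>
         affine_crystal n (cartan t n) (reduced_walls t n l)
           (wall_wt t n l) (wall_eps t n l) (wall_phi t n l) (e_op t n l) (f_op t n l)"
proof -
  obtain lev period off g where "wall_pattern t n lev period l off g"
    using wall_pattern_exists[OF assms] by blast
  then show ?thesis by (rule wall_pattern.crystal_of_reduced_walls)
qed

end
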